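(* Let $N\in\mathbb{N}$ and $s>-1$. Define \[ \pi_N^{(s)}(x)=\frac{(p^{-1-s};p^{-1})_N^2(p^{-1};p^{-1})_N^2}{(p^{-1-s};p^{-1})_{2N}(p^{-1};p^{-1})_x^2(p^{-1};p^{-1})_{N-x}(p^{-1-s};p^{-1})_{N-x}}\,p^{-(N-x)^2-s(N-x)},\quad0\le x\le N. \] Then $\pi_N^{(s)}$ is a probability measure on $\{0,1,\dots,N\}$. Moreover, for every $\mathbf{k}\in\Delta_N$, setting $v_i=\sum_{j=-\infty}^{-i}l_j(\mathbf{k})$ for $i\ge0$ and $u_i=N-\sum_{j=-\infty}^{i}l_j(\mathbf{k})$ for $i\ge0$ (so $u_0=N-v_0$), \[ \mathsf{m}_N^{(s)}(\mathbf{k})=\pi_N^{(s)}(v_0)\prod_{i=0}^\infty\mathsf{P}^{(s)}(u_i,u_{i+1})\prod_{i=0}^\infty\mathsf{P}^{(0)}(v_i,v_{i+1}). \] Equivalently, a $\mathbf{k}$ with law $\mathsf{m}_N^{(s)}$ can be sampled by drawing $\sum_{i=-\infty}^0l_i(\mathbf{k})$ from $\pi_N^{(s)}$, then running from $N-\sum_{i=-\infty}^0l_i(\mathbf{k})$ a Markov chain with kernel $\mathsf{P}^{(s)}$ to produce $N-\sum_{i=-\infty}^1l_i(\mathbf{k}),N-\sum_{i=-\infty}^2l_i(\mathbf{k}),\dots$, and (independently given the starting point) running from $\sum_{i=-\infty}^0l_i(\mathbf{k})$ a Markov chain with kernel $\mathsf{P}^{(0)}$ to produce $\sum_{i=-\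infty}^{-1}l_i(\mathbf{k}),\sum_{i=-\infty}^{-2}l_i(\mathbf{k}),\dots$.
   Context: $(\alpha;q)_N=\prod_{j=0}^{N-1}(1-\alpha q^j)$. $\mathsf{vol}$ is the Haar measure on $\mathrm{Mat}(N,\mathbb{Q}_p)$ with $\mathsf{vol}(\mathrm{Mat}(N,\mathbb{Z}_p))=1$. Every $\mathbf{Z}\in\mathrm{Mat}(N,\mathbb{Q}_p)$ is $\mathbf{B}\,\mathrm{diag}(p^{-k_1},\dots,p^{-k_N})\,\mathbf{C}$ with $\mathbf{B},\mathbf{C}\in\mathrm{GL}(N,\mathbb{Z}_p)$ and unique $k_1\ge\dots\ge k_N\ge-\infty$ ($p^{-(-\infty)}=0$); $\mathsf{Sing}_N(\mathbf{Z})=(k_1,\dots,k_N)\in\Delta_N=\{(k_1,\dots,k_N)\in(\mathbb{Z}\cup\{-\infty\})^N:k_1\ge\dots\ge k_N\}$. $l_i(\mathbf{k})=\#\{j:k_j=i\}$ for $i\in\mathbb{Z}\cup\{-\infty\}$; sums $\sum_{j=-\infty}^m$ run over $\{-\infty\}\cup\{j\in\mathbb{Z}:j\le m\}$. $\gamma(\mathbf{Z})=\prod_{j:k_j>0}p^{k_j}$ ($=1$ if none); $d\mathsf{M}_N^{(s)}(\mathbf{Z})=\frac{(p^{-1-s};p^{-1})_N^2}{(p^{-1-s};p^{-1})_{2N}}\gamma(\mathbf{Z})^{-s-2N}d\mathsf{vol}(\mathbf{Z})$ is a probability measure and $\mathsf{m}_N^{(s)}=(\mathsf{Sing}_N)_*\mathsf{M}_N^{(s)}$.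 For $s>-1$, $\mathsf{P}^{(s)}(x_1,x_2)=\frac{p^{-x_2^2-sx_2}(p^{-1};p^{-1})_{x_1}(p^{-1-s};p^{-1})_{x_1}}{(p^{-1};p^{-1})_{x_2}(p^{-1};p^{-1})_{x_1-x_2}(p^{-1-s};p^{-1})_{x_2}}\mathbf{1}(0\le x_2\le x_1)$ for $x_1,x_2\in\mathbb{Z}_+$; it is a Markov kernel on $\mathbb{Z}_+$. *)

theory Defs
  imports "HOL-Probability.Probability"
begin

definition qpoch :: "real \<Rightarrow> real \<Rightarrow> nat \<Rightarrow> real" where
  "qpoch a q n = (\<Prod>j<n. 1 - a * q ^ j)"

text \<open>An element x of Q_p is represented by the compatible system of its residues
  modulo p^n Z_p, for all integers n: the component at n is the canonical
  representative of x mod p^n Z_p in Z[1/p] intersected with the interval from 0 (incl.)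
  to p^n (excl.).  The component at n vanishes iff x lies in p^n Z_p.\<close>

definition qmod :: "rat \<Rightarrow> rat \<Rightarrow> rat" where
  "qmod a m = a - m * of_int \<lfloor>a / m\<rfloor>"

definition Zinvp :: "nat \<Rightarrow> rat set" where
  "Zinvp p = {q. \<exists>a::int. \<exists>e::nat. q = of_int a / of_nat p ^ e}"

definition Qp :: "nat \<Rightarrow> (int \<Rightarrow> rat) set" where
  "Qp p = {x. (\<forall>n. x n \<in> Zinvp p \<and> 0 \<le> x n \<and> x n < of_nat p powi n
                  \<and> qmod (x (n + 1)) (of_nat p powi n) = x n)
             \<and> (\<exists>M. \<forall>n\<le>M. x n = 0)}"

definition pzero :: "int \<Rightarrow> rat" where
  "pzero = (\<lambda>_. 0)"

definition pone :: "int \<Rightarrow> rat" where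
  "pone = (\<lambda>n. if n \<le> 0 then 0 else 1)"

definition ppow :: "nat \<Rightarrow> int \<Rightarrow> int \<Rightarrow> rat" where
  "ppow p e = (\<lambda>n. if n \<le> e then 0 else of_nat p powi e)"

definition padd :: "nat \<Rightarrow> (int \<Rightarrow> rat) \<Rightarrow> (int \<Rightarrow> rat) \<Rightarrow> (int \<Rightarrow> rat)" where
  "padd p x y = (\<lambda>n. qmod (x n + y n) (of_nat p powi n))"

text \<open>nd x = max(0, - val x): the least k with x in p^(-k) Z_p.\<close>
definition nd :: "(int \<Rightarrow> rat) \<Rightarrow> nat" where
  "nd x = (LEAST k::nat. x (- int k) = 0)"

text \<open>Product: residues of x*y modulo p^n are computed from residues of x and y
  at a sufficiently high level.\<close>
definition pmul :: "nat \<Rightarrow> (int \<Rightarrow> rat) \<Rightarrow> (int \<Rightarrow> rat) \<Rightarrow> (int \<Rightarrow> rat)" where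
  "pmul p x y = (\<lambda>n. let m = n + int (nd x + nd y) in
                      qmod (x m * y m) (of_nat p powi n))"

definition inZp :: "(int \<Rightarrow> rat) \<Rightarrow> bool" where
  "inZp x \<longleftrightarrow> x 0 = 0"

type_synonym qpmat = "nat \<times> nat \<Rightarrow> int \<Rightarrow> rat"

definition QpMat :: "nat \<Rightarrow> nat \<Rightarrow> qpmat set" where
  "QpMat p N = {Z. \<forall>i j. (i < N \<and> j < N \<longrightarrow> Z (i, j) \<in> Qp p)
                        \<and> (\<not> (i < N \<and> j < N) \<longrightarrow> Z (i, j) = pzero)}"

definition ZpMat :: "nat \<Rightarrow> nat \<Rightarrow> qpmat set" where
  "ZpMat p N = {Z \<in> QpMat p N. \<forall>i<N. \<forall>j<N. inZp (Z (i, j))}"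

fun psum :: "nat \<Rightarrow> (nat \<Rightarrow> int \<Rightarrow> rat) \<Rightarrow> nat \<Rightarrow> (int \<Rightarrow> rat)" where
  "psum p f 0 = pzero"
| "psum p f (Suc n) = padd p (psum p f n) (f n)"

definition mmul :: "nat \<Rightarrow> nat \<Rightarrow> qpmat \<Rightarrow> qpmat \<Rightarrow> qpmat" where
  "mmul p N A B = (\<lambda>(i, j). if i < N \<and> j < N
       then psum p (\<lambda>l. pmul p (A (i, l)) (B (l, j))) N else pzero)"

definition idm :: "nat \<Rightarrow> qpmat" where
  "idm N = (\<lambda>(i, j). if i < N \<and> j < N \<and> i = j then pone else pzero)"

definition GLZp :: "nat \<Rightarrow> nat \<Rightarrow> qpmat set" where
  "GLZp p N = {B \<in> ZpMat p N. \<exists>C \<in> ZpMat p N. mmul p N B C = idm N \<and> mmul p N C B = idm N}"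

datatype zinf = NegInf | Fin int

fun zle :: "zinf \<Rightarrow> zinf \<Rightarrow> bool" where
  "zle NegInf _ = True"
| "zle (Fin a) NegInf = False"
| "zle (Fin a) (Fin b) = (a \<le> b)"

definition Delta :: "nat \<Rightarrow> zinf list set" where
  "Delta N = {k. length k = N \<and> sorted_wrt (\<lambda>a b. zle b a) k}"

definition diagm :: "nat \<Rightarrow> nat \<Rightarrow> zinf list \<Rightarrow> qpmat" where
  "diagm p N k = (\<lambda>(i, j). if i < N \<and> j < N \<and> i = j
       then (case k ! i of NegInf \<Rightarrow> pzero | Fin a \<Rightarrow> ppow p (- a)) else pzero)"

definition Sing :: "nat \<Rightarrow> nat \<Rightarrow> qpmat \<Rightarrow> zinf list" where
  "Sing p N Z = (THE k. k \<in> Delta N \<and>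
      (\<exists>B C. B \<in> GLZp p N \<and> C \<in> GLZp p N \<and> Z = mmul p N (mmul p N B (diagm p N k)) C))"

definition gamma_k :: "nat \<Rightarrow> zinf list \<Rightarrow> real" where
  "gamma_k p k = (\<Prod>j<length k. case k ! j of NegInf \<Rightarrow> 1
                     | Fin a \<Rightarrow> (if a > 0 then real p ^ nat a else 1))"

text \<open>Measurable space: the sigma algebra generated by all residue maps of all entries
  (this is the Borel sigma algebra of Mat(N,Q_p)).\<close>
definition MatSp :: "nat \<Rightarrow> nat \<Rightarrow> qpmat measure" where
  "MatSp p N = restrict_space
     (PiM UNIV (\<lambda>_::nat \<times> nat. PiM UNIV (\<lambda>_::int. count_space (UNIV :: rat set)))) (QpMat p N)"

text \<open>Uniform (normalized Haar) probability on the lattice p^(-m) Mat(N, Z_p):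
  i.i.d. uniform p-adic digits, digit t of entry (i,j) sitting at position t - m.\<close>
definition digits_to_mat :: "nat \<Rightarrow> nat \<Rightarrow> nat \<Rightarrow> (nat \<times> nat \<times> nat \<Rightarrow> nat) \<Rightarrow> qpmat" where
  "digits_to_mat p N m d = (\<lambda>(i, j). if i < N \<and> j < N
      then (\<lambda>n. \<Sum>t<nat (n + int m). of_nat (d (i, j, t)) * of_nat p powi (int t - int m))
      else pzero)"

definition latt :: "nat \<Rightarrow> nat \<Rightarrow> nat \<Rightarrow> qpmat measure" where
  "latt p N m = distr (PiM ({..<N} \<times> {..<N} \<times> UNIV) (\<lambda>_. uniform_count_measure {0..<p}))
                      (MatSp p N) (digits_to_mat p N m)"

text \<open>Haar measure with vol(Mat(N,Z_p)) = 1: its restriction to p^(-m) Mat(N,Z_p) is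
  p^(N^2 m) times the uniform probability there; take the increasing limit.\<close>
definition vol :: "nat \<Rightarrow> nat \<Rightarrow> qpmat measure" where
  "vol p N = measure_of (space (MatSp p N)) (sets (MatSp p N))
     (\<lambda>A. SUP m::nat. ennreal (real p ^ (N * N * m)) * emeasure (latt p N m) A)"

definition MN :: "nat \<Rightarrow> real \<Rightarrow> nat \<Rightarrow> qpmat measure" where
  "MN p s N = density (vol p N)
     (\<lambda>Z. ennreal (qpoch (real p powr (-1 - s)) (1 / real p) N ^ 2
                   / qpoch (real p powr (-1 - s)) (1 / real p) (2 * N)
                   * gamma_k p (Sing p N Z) powr (- s - 2 * real N)))"

definition mN :: "nat \<Rightarrow> real \<Rightarrow> nat \<Rightarrow> zinf list measure" where
  "mN p s N = distr (MN p s N) (count_space UNIV) (Sing p N)"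

definition piN :: "nat \<Rightarrow> real \<Rightarrow> nat \<Rightarrow> nat \<Rightarrow> real" where
  "piN p s N x = (if x \<le> N then
     qpoch (real p powr (-1 - s)) (1 / real p) N ^ 2 * qpoch (1 / real p) (1 / real p) N ^ 2
     / (qpoch (real p powr (-1 - s)) (1 / real p) (2 * N)
        * qpoch (1 / real p) (1 / real p) x ^ 2
        * qpoch (1 / real p) (1 / real p) (N - x)
        * qpoch (real p powr (-1 - s)) (1 / real p) (N - x))
     * real p powr (- ((real (N - x))^2) - s * real (N - x))
   else 0)"

definition Pker :: "nat \<Rightarrow> real \<Rightarrow> nat \<Rightarrow> nat \<Rightarrow> real" where
  "Pker p s x1 x2 = (if x2 \<le> x1 then
     real p powr (- ((real x2)^2) - s * real x2)
     * qpoch (1 / real p) (1 / real p) x1 * qpoch (real p powr (-1 - s)) (1 / real p) x1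
     / (qpoch (1 / real p) (1 / real p) x2 * qpoch (1 / real p) (1 / real p) (x1 - x2)
        * qpoch (real p powr (-1 - s)) (1 / real p) x2)
   else 0)"

text \<open>v_i = sum_{j = -infinity}^{-i} l_j(k),  u_i = N - sum_{j=-infinity}^{i} l_j(k).\<close>
definition vseq :: "zinf list \<Rightarrow> nat \<Rightarrow> nat" where
  "vseq k i = card {j. j < length k \<and> zle (k ! j) (Fin (- int i))}"

definition useq :: "zinf list \<Rightarrow> nat \<Rightarrow> nat" where
  "useq k i = length k - card {j. j < length k \<and> zle (k ! j) (Fin (int i))}"

end

(*
  Let X be a p-adic integer matrix with Smith form diag(p^l_1, ..., p^l_N). Its left kernel
  modulo p^n has p^(sum_j min(n, l_j)) elements, so the numbers r_i = #{j. l_j >= i} for i <= n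
  can be read off from X modulo p^n, and together they determine the Smith form. Hence, on each
  lattice p^(-m) Mat(N, Z_p), the event that the singular numbers equal k is a decreasing
  intersection over n of events prescribing r_1, ..., r_n; singular numbers equal to minus
  infinity need no separate treatment.

  For a matrix that is uniform modulo p^n the r_i are found by processing columns one at a time.
  A column with a unit entry eliminates one row, and the other columns stay uniform; a column
  divisible by p is set aside. When only columns divisible by p are left, they form a square
  matrix, which is divided by p. So N, r_1, r_2, ... is a Markov chain with kernel P^(0).

  The density gamma^(-s-2N) only involves the first m steps of this chain. The product of these
  steps telescopes, and read backwards it is pi_N times a product of steps of the kernel P^(s).
  That pi_N has total mass 1 is the q-Chu-Vandermonde identity.
*)
theory Submission
  imports Defs "HOL-Number_Theory.Cong"
begin

text \<open>\<open>Qp\<close> is a set of residue systems equipped with bare operations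
  \<open>padd\<close> and \<open>pmul\<close>. A matrix in p^(-m) Mat(N, Z_p) is therefore handled
  through integer representatives modulo p^t for all t, and matrix identities, including
  invertibility in \<open>GLZp\<close>, become coherent families of congruences. Existence of a
  Smith form is then a compactness statement, and uniqueness rests on kernel sizes instead of
  minors.

  Uniformity is treated as exact counting modulo p^n: that the other columns stay uniform means that
  the elimination map has fibers of constant size.

  Since \<open>vol\<close> is a supremum over m, the result must not depend on the lattice. Digit
  shifts give monotonicity in m. Equality for large m is obtained indirectly: the chain weight does
  not mention m, yet for every large m it converges to the rescaled lattice probability times the
  density.

  The exponent -s - 2N completes a square: the factor p^(N^2) of one rescaling, the weight
  p^(-(N-u)^2) of a reversed step and p^(-(s+2N)u) multiply to p^(-u^2 - su), the weight of
  P^(s).\<close>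

section \<open>Summation identities\<close>

text \<open>The factor with i = M is zero, so this vanishes for y > M despite the truncated subtraction.\<close>

definition q_falling :: "real \<Rightarrow> nat \<Rightarrow> nat \<Rightarrow> real" where
  "q_falling q M y = (\<Prod>i<y. 1 - q ^ (M - i))"

lemma q_falling_0 [simp]: "q_falling q M 0 = 1"
  by (simp add: q_falling_def)

lemma q_falling_Suc: "q_falling q M (Suc y) = q_falling q M y * (1 - q ^ (M - y))"
  by (simp add: q_falling_def)

lemma q_falling_Suc_Suc: "q_falling q (Suc M) (Suc y) = (1 - q ^ Suc M) * q_falling q M y"
  unfolding q_falling_def by (subst prod.lessThan_Suc_shift) simp

lemma q_falling_eq_0: "M < y \<Longrightarrow> q_falling q M y = 0"
  unfolding q_falling_def by (auto intro!: bexI[of _ M])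

text \<open>The q-Pascal rule, from 1 - q^(M+1) = (1 - q^(M-y)) + q^(M-y) * (1 - q^(y+1)). For y > M
  the subtraction M - y is truncated, but then every term is zero.\<close>

lemma q_falling_pascal: "q_falling q (Suc M) (Suc y) = q_falling q M (Suc y) + q ^ (M - y) * (1 - q ^ Suc y) * q_falling q M y"
proof (cases "y \<le> M")
  case True
  then have "q ^ M = q ^ (M - y) * q ^ y" by (simp flip: power_add)
  then show ?thesis by (subst q_falling_Suc_Suc, subst q_falling_Suc) (simp add: algebra_simps)
qed (simp add: q_falling_eq_0 q_falling_Suc_Suc)

lemma qpoch_0 [simp]: "qpoch a q 0 = 1"
  by (simp add: qpoch_def)

lemma qpoch_Suc: "qpoch a q (Suc n) = qpoch a q n * (1 - a * q ^ n)"
  by (simp add: qpoch_def)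

lemma qpoch_Suc_shift: "qpoch a q (Suc n) = (1 - a) * qpoch (a * q) q n"
  unfolding qpoch_def by (subst prod.lessThan_Suc_shift) (simp add: mult_ac)

lemma qpoch_pos:
  assumes "0 < q" "q < 1" "0 < a" "a < 1"
  shows "0 < qpoch a q n"
proof -
  have "a * q ^ j < 1" for j
    using assms mult_less_le_imp_less[of a 1 "q ^ j" 1] by (simp add: power_le_one)
  then show ?thesis unfolding qpoch_def by (intro prod_pos) auto
qed

lemma q_falling_qpoch:
  assumes "0 < q" "q < 1" "y \<le> M"
  shows "q_falling q M y = qpoch q q M / qpoch q q (M - y)"
  using \<open>y \<le> M\<close>
proof (induction y)
  case 0
  then show ?case using qpoch_pos[OF assms(1,2,1,2), of M] by simp
next
  case (Suc y)
  then have e: "M - y = Suc (M - Suc y)" by simp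
  have "qpoch q q (M - y) \<noteq> 0" "qpoch q q (M - Suc y) \<noteq> 0"
    using qpoch_pos[OF assms(1,2,1,2)] by (auto simp: less_le)
  moreover have "qpoch q q (M - y) = qpoch q q (M - Suc y) * (1 - q ^ (M - y))"
    by (subst (1) e, subst qpoch_Suc) (simp add: e)
  ultimately show ?case using Suc by (simp add: q_falling_Suc)
qed

text \<open>The q-Chu-Vandermonde sum. The q-Pascal rule splits the sum for \<open>Suc M\<close>
  into the sum for M and a sum with y shifted by one, in which a is replaced by a * q and N drops by
  one; hence the induction on M keeps both N and a arbitrary.\<close>

lemma q_vandermonde:
  assumes q: "0 < q" "q < 1" and a: "0 < a" "a < 1"
  shows "(\<Sum>y\<le>M. q_falling q M y * q_falling q N y / (qpoch q q y * qpoch a q y) * q ^ (y * (y - 1)) * a ^ y)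
         = qpoch a q (M + N) / (qpoch a q M * qpoch a q N)"
  using a
proof (induction M arbitrary: N a)
  case 0
  then have "qpoch a q N \<noteq> 0" using qpoch_pos[OF q] by (simp add: less_le)
  then show ?case by simp
next
  case (Suc M)
  define T where "T M N a y = q_falling q M y * q_falling q N y / (qpoch q q y * qpoch a q y) * q ^ (y * (y - 1)) * a ^ y"
    for M N y :: nat and a :: real
  have pos: "0 < a \<Longrightarrow> a < 1 \<Longrightarrow> qpoch a q n \<noteq> 0" for a n
    using qpoch_pos[OF q] by (simp add: less_le)
  have posq: "qpoch q q n \<noteq> 0" for n using pos q by blast
  have aq: "0 < a * q" "a * q < 1" using q Suc.prems mult_strict_mono[of a 1 q 1] by auto
  have nz: "qpoch a q n \<noteq> 0" "qpoch (a * q) q n \<noteq> 0" for n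
    using pos Suc.prems aq by blast+
  show ?case
  proof (cases N)
    case 0
    have "(\<Sum>y\<le>Suc M. T (Suc M) 0 a y) = (\<Sum>y\<le>Suc M. if y = 0 then 1 else 0)"
      by (rule sum.cong) (auto simp: T_def q_falling_eq_0)
    then show ?thesis using nz by (simp add: 0 T_def sum.atMost_Suc)
  next
    case (Suc K)
    have step: "T (Suc M) N a (Suc z) = T M N a (Suc z) + a * q ^ M * (1 - q ^ N) / (1 - a) * T M K (a * q) z" (is "?l z")
      if "z \<le> M" for z
    proof -
      \<comment> \<open>The factor q ^ M leaves the sum, and the surplus q ^ z joins a ^ z, which
        turns the parameter a into a * q.\<close>
      have p1: "q ^ (Suc z * z) * q ^ (M - z) = q ^ M * q ^ (z * (z - 1)) * q ^ z"
      proof -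
        obtain d where "M = z + d" using \<open>z \<le> M\<close> le_Suc_ex by blast
        then have "Suc z * z + (M - z) = M + z * (z - 1) + z"
          by (cases z) (simp_all add: algebra_simps)
        then show ?thesis by (simp only: power_add [symmetric])
      qed
      have n1: "1 - q ^ Suc z \<noteq> 0"
        using q power_Suc_less_one[of q z] by auto
      have n2: "1 - a \<noteq> 0" using Suc.prems by auto
      have d: "qpoch q q (Suc z) = qpoch q q z * (1 - q ^ Suc z)" by (simp add: qpoch_Suc)
      have "T (Suc M) N a (Suc z) - T M N a (Suc z)
          = q ^ (M - z) * (1 - q ^ Suc z) * q_falling q M z * q_falling q N (Suc z)
             / (qpoch q q (Suc z) * qpoch a q (Suc z)) * q ^ (Suc z * z) * a ^ Suc z"
        unfolding T_def q_falling_pascal by (simp add: algebra_simps add_divide_distrib diff_divide_distrib)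
      also have "\<dots> = q_falling q M z * q_falling q N (Suc z)
             / (qpoch q q z * qpoch a q (Suc z)) * (q ^ (Suc z * z) * q ^ (M - z)) * a ^ Suc z"
        unfolding d using n1 posq by (simp add: divide_simps)
      also have "\<dots> = a * q ^ M * (1 - q ^ N) / (1 - a) * T M K (a * q) z"
        unfolding p1 T_def Suc q_falling_Suc_Suc qpoch_Suc_shift[of a] using n2 nz posq
        by (simp add: divide_simps power_mult_distrib)
      finally show ?thesis by simp
    qed
    have "(\<Sum>y\<le>Suc M. T (Suc M) N a y) = T (Suc M) N a 0 + (\<Sum>z\<le>M. T (Suc M) N a (Suc z))"
      by (rule sum.atMost_Suc_shift)
    also have "(\<Sum>z\<le>M. T (Suc M) N a (Suc z)) = (\<Sum>z\<le>M. T M N a (Suc z))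
        + a * q ^ M * (1 - q ^ N) / (1 - a) * (\<Sum>z\<le>M. T M K (a * q) z)"
      using step by (simp add: sum.distrib sum_distrib_left)
    also have "T (Suc M) N a 0 = T M N a 0" by (simp add: T_def)
    also have "T M N a 0 + ((\<Sum>z\<le>M. T M N a (Suc z)) + a * q ^ M * (1 - q ^ N) / (1 - a) * (\<Sum>z\<le>M. T M K (a * q) z))
       = (\<Sum>y\<le>Suc M. T M N a y) + a * q ^ M * (1 - q ^ N) / (1 - a) * (\<Sum>z\<le>M. T M K (a * q) z)"
      using sum.atMost_Suc_shift[of "T M N a" M] by simp
    also have "(\<Sum>y\<le>Suc M. T M N a y) = (\<Sum>y\<le>M. T M N a y)"
      by (simp add: T_def q_falling_eq_0)
    also have "\<dots> = qpoch a q (M + N) / (qpoch a q M * qpoch a q N)"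
      unfolding T_def using Suc.IH[OF Suc.prems] .
    also have "(\<Sum>z\<le>M. T M K (a * q) z) = qpoch (a * q) q (M + K) / (qpoch (a * q) q M * qpoch (a * q) q K)"
      unfolding T_def using Suc.IH[OF aq] .
    also have "a * q ^ M * (1 - q ^ N) / (1 - a) * (qpoch (a * q) q (M + K) / (qpoch (a * q) q M * qpoch (a * q) q K))
       = a * q ^ M * (1 - q ^ N) * qpoch a q (M + N) / (qpoch a q (Suc M) * qpoch a q N)"
      unfolding Suc qpoch_Suc_shift[of a] add_Suc_right using Suc.prems nz by (simp add: divide_simps)
    also have "qpoch a q (M + N) / (qpoch a q M * qpoch a q N) + \<dots> = qpoch a q (Suc M + N) / (qpoch a q (Suc M) * qpoch a q N)"
    proof -
      have "1 - a * q ^ M \<noteq> 0" using nz(1)[of "Suc M"] by (auto simp: qpoch_Suc)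
      then show ?thesis using nz(1) unfolding add_Suc qpoch_Suc by (simp add: divide_simps) (simp add: algebra_simps power_add)
    qed
    finally show ?thesis unfolding T_def .
  qed
qed

section \<open>Total mass of pi_N\<close>

context
  fixes p :: nat and s :: real
  assumes p: "prime p" and s: "s > -1"
begin

lemma inverse_p: "0 < 1 / real p" "1 / real p < 1"
  using prime_gt_1_nat[OF p] by auto

lemma p_powr: "0 < real p powr (-1 - s)" "real p powr (-1 - s) < 1"
  using prime_gt_1_nat[OF p] s by (auto simp: powr_less_one)

text \<open>Since y^2 + s y = y (y - 1) + (1 + s) y, the weight takes the form of a summand of
  \<open>q_vandermonde\<close> with q = 1/p and a = p^(-1-s).\<close>

lemma p_powr_neg_square:
  "real p powr (- ((real y)\<^sup>2) - s * real y) = (1 / real p) ^ (y * (y - 1)) * (real p powr (-1 - s)) ^ y"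
proof -
  have p0: "real p > 0" using prime_gt_0_nat[OF p] by simp
  have "(1 / real p) ^ n = real p powr (- real n)" for n
    using p0 by (simp add: powr_minus powr_realpow power_one_over inverse_eq_divide)
  then have "(1 / real p) ^ (y * (y - 1)) = real p powr (- real (y * (y - 1)))" .
  moreover have "(real p powr (-1 - s)) ^ y = real p powr ((-1 - s) * real y)"
    using p0 by (simp add: powr_powr flip: powr_realpow)
  moreover have "real (y * (y - 1)) = (real y)\<^sup>2 - real y"
    by (cases y) (auto simp: power2_eq_square algebra_simps)
  ultimately show ?thesis
    by (simp only: powr_add [symmetric]) (rule arg_cong[of _ _ "(powr) (real p)"], simp add: algebra_simps)
qed

lemma piN_nonneg: "0 \<le> piN p s N x"
  unfolding piN_def using qpoch_pos[OF inverse_p inverse_p] qpoch_pos[OF inverse_p p_powr]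
  by (auto intro!: divide_nonneg_nonneg mult_nonneg_nonneg simp: less_imp_le)

text \<open>With y = N - x the squared quotient of q-Pochhammer symbols is a square of
  \<open>q_falling q N y\<close>, so the sum is \<open>q_vandermonde\<close> with M = N, and the
  prefactor is the inverse of its value.\<close>

lemma sum_piN: "(\<Sum>x\<le>N. piN p s N x) = 1"
proof -
  define q where "q = 1 / real p"
  define a where "a = real p powr (-1 - s)"
  have q: "0 < q" "q < 1" and a: "0 < a" "a < 1"
    using inverse_p p_powr by (auto simp: q_def a_def)
  have Q: "qpoch q q n > 0" and A: "qpoch a q n > 0" for n
    using qpoch_pos q a by auto
  have "(\<Sum>x\<le>N. piN p s N x) = (\<Sum>y\<le>N. piN p s N (N - y))"
    by (intro sum.reindex_bij_witness[of _ "\<lambda>y. N - y" "\<lambda>y. N - y"]) auto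
  also have "\<dots> = (\<Sum>y\<le>N. (qpoch a q N)\<^sup>2 / qpoch a q (2 * N) *
     (q_falling q N y * q_falling q N y / (qpoch q q y * qpoch a q y) * q ^ (y * (y - 1)) * a ^ y))"
  proof (rule sum.cong)
    fix y assume "y \<in> {..N}"
    then have y: "y \<le> N" and e: "N - (N - y) = y" by auto
    show "piN p s N (N - y) = (qpoch a q N)\<^sup>2 / qpoch a q (2 * N) *
     (q_falling q N y * q_falling q N y / (qpoch q q y * qpoch a q y) * q ^ (y * (y - 1)) * a ^ y)"
      unfolding piN_def e p_powr_neg_square q_def[symmetric] a_def[symmetric] q_falling_qpoch[OF q y]
      by (simp add: power2_eq_square)
  qed auto
  also have "\<dots> = (qpoch a q N)\<^sup>2 / qpoch a q (2 * N) * (qpoch a q (N + N) / (qpoch a q N * qpoch a q N))"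
    by (subst sum_distrib_left[symmetric], subst q_vandermonde[OF q a]) simp
  also have "\<dots> = 1" using A[of N] A[of "2 * N"] by (simp add: mult_2 power2_eq_square divide_simps)
  finally show ?thesis .
qed

end

section \<open>Rank distribution over a finite field\<close>

text \<open>The probability that a uniform M by b matrix over the field with 1/q elements has rank M - r. The first column is nonzero with probability 1 - q^M, and it then eliminates one row.\<close>

fun corank_prob :: "real \<Rightarrow> nat \<Rightarrow> nat \<Rightarrow> nat \<Rightarrow> real" where
  "corank_prob q M 0 r = (if r = M then 1 else 0)"
| "corank_prob q M (Suc b) r = (1 - q ^ M) * corank_prob q (M - 1) b r + q ^ M * corank_prob q M b r"

lemma corank_prob_less: "M < r \<Longrightarrow> corank_prob q M b r = 0"
  by (induction b arbitrary: M) auto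

lemma corank_prob_eq_0: "b < t \<Longrightarrow> corank_prob q (r + t) b r = 0"
proof (induction b arbitrary: t)
  case (Suc b)
  then obtain t' where "t = Suc t'" "b < t'" by (cases t) auto
  then show ?case using Suc.IH[of t'] Suc.IH[of t] Suc.prems by simp
qed auto

text \<open>Here t is the rank. Both terms of the recurrence share a common factor, and what remains
  is 1 - q^(b+1) = (1 - q^t) + q^t * (1 - q^(b+1-t)).\<close>

lemma corank_prob_eq:
  assumes q: "0 < q" "q < 1" and "t \<le> b"
  shows "corank_prob q (r + t) b r =
           q ^ (r * (b - t)) * q_falling q (r + t) t * qpoch q q b / (qpoch q q t * qpoch q q (b - t))"
  using \<open>t \<le> b\<close>
proof (induction b arbitrary: t)
  case (Suc b)
  have posq: "qpoch q q n \<noteq> 0" for n using qpoch_pos[OF q q, of n] by simp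
  have n1: "1 - q ^ Suc z \<noteq> 0" for z
    using q power_Suc_less_one[of q z] by auto
  have Q: "qpoch q q (Suc n) = qpoch q q n * (1 - q ^ Suc n)" for n by (simp add: qpoch_Suc)
  show ?case
  proof (cases t)
    case 0
    have "(1 - q ^ r) * corank_prob q (r - 1) b r = 0"
      by (cases r) (auto simp: corank_prob_less)
    then show ?thesis using Suc.IH[of 0] posq by (simp add: 0 power_add)
  next
    case (Suc t')
    then have t': "t' \<le> b" using Suc.prems by simp
    have IH1: "corank_prob q (r + t') b r =
           q ^ (r * (b - t')) * q_falling q (r + t') t' * qpoch q q b / (qpoch q q t' * qpoch q q (b - t'))"
      using Suc.IH[OF t'] .
    have f: "(1 - q ^ (r + t)) * q_falling q (r + t') t' = q_falling q (r + t) t"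
      using q_falling_Suc_Suc[of q "r + t'" t'] by (simp add: Suc)
    \<comment> \<open>For t' = b all \<open>Suc b\<close> columns must be pivots, so the second term
      of the recurrence vanishes; its closed form, with the truncated b - t, is valid only in the
      other case.\<close>
    show ?thesis
    proof (cases "t' = b")
      case True
      then have "corank_prob q (r + t) b r = 0" using corank_prob_eq_0[of b t] Suc by simp
      then show ?thesis using IH1 posq f by (simp add: Suc True mult_ac)
    next
      case False
      then have lt: "t \<le> b" and e: "b - t' = Suc (b - t)" using t' Suc by auto
      have IH2: "corank_prob q (r + t) b r =
           q ^ (r * (b - t)) * q_falling q (r + t) t * qpoch q q b / (qpoch q q t * qpoch q q (b - t))"
        using Suc.IH[OF lt] .
      have "q ^ (b - t') * q ^ Suc t' = q ^ Suc b" using t' by (simp flip: power_add power_Suc)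
      then have pw: "q ^ (Suc (b - t)) * q ^ t = q ^ Suc b" by (simp add: e Suc)
      have "corank_prob q (r + t) (Suc b) r = (1 - q ^ (r + t)) * corank_prob q (r + t') b r + q ^ (r + t) * corank_prob q (r + t) b r"
        by (simp add: Suc)
      also have "\<dots> = q ^ (r * Suc (b - t)) * q_falling q (r + t) t * qpoch q q b *
         (1 / (qpoch q q t' * qpoch q q (Suc (b - t))) + q ^ t / (qpoch q q t * qpoch q q (b - t)))"
      proof -
        have "(1 - q ^ (r + t)) * corank_prob q (r + t') b r =
          q ^ (r * Suc (b - t)) * q_falling q (r + t) t * qpoch q q b / (qpoch q q t' * qpoch q q (Suc (b - t)))"
          unfolding IH1 f[symmetric] e by (simp add: mult_ac)
        then show ?thesis
          unfolding IH2 by (simp add: distrib_left power_add mult_ac)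
      qed
      also have "1 / (qpoch q q t' * qpoch q q (Suc (b - t))) + q ^ t / (qpoch q q t * qpoch q q (b - t))
        = (1 - q ^ Suc b) / (qpoch q q t * qpoch q q (Suc (b - t)))"
        unfolding pw[symmetric] Suc Q using n1[of t'] n1[of "b - Suc t'"] posq
        by (simp add: divide_simps) (simp add: algebra_simps)
      finally show ?thesis using e Suc by (simp add: Q mult_ac)
    qed
  qed
qed auto

text \<open>For a square matrix the exponent r * (b - t) becomes r^2, and for s = 0 the parameter
  p^(-1-s) is 1/p itself, so the two families of q-Pochhammer symbols in \<open>Pker\<close>
  coincide.\<close>

lemma corank_prob_Pker:
  assumes p: "prime p"
  shows "corank_prob (1 / real p) M M r = Pker p 0 M r"
proof (cases "r \<le> M")
  case True
  define q where "q = 1 / real p"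
  have q: "0 < q" "q < 1"
    using prime_gt_1_nat[OF p] by (auto simp: q_def)
  have posq: "qpoch q q n \<noteq> 0" for n using qpoch_pos[OF q q, of n] by simp
  define t where "t = M - r"
  have M: "M = r + t" "M - t = r" "t \<le> M" using True by (auto simp: t_def)
  have a: "real p powr (- 1 - 0) = q" using prime_gt_0_nat[OF p] by (simp add: q_def powr_minus_divide)
  have "corank_prob q M M r = q ^ (r * r) * q_falling q M t * qpoch q q M / (qpoch q q t * qpoch q q r)"
    using corank_prob_eq[OF q M(3), of r] M by simp
  also have "q_falling q M t = qpoch q q M / qpoch q q r"
    using q_falling_qpoch[OF q M(3)] M by simp
  also have "q ^ (r * r) = real p powr (- ((real r)\<^sup>2) - 0 * real r)"
    using prime_gt_0_nat[OF p] 
    by (simp add: q_def powr_minus powr_realpow power_one_over inverse_eq_divide power2_eq_square flip: of_nat_mult)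
  finally show ?thesis using True M posq
    unfolding Pker_def a q_def[symmetric] by (simp add: t_def[symmetric] mult_ac)
qed (simp add: Pker_def corank_prob_less)

section \<open>Counting matrices modulo a prime power\<close>

text \<open>Row vectors modulo p^j that kill all columns in C. A repeated column imposes nothing
  new, so the columns may be kept as a set, on which elimination acts by taking images; the row
  index set I is arbitrary so that a row can be deleted.\<close>

definition left_ker :: "nat \<Rightarrow> nat \<Rightarrow> nat set \<Rightarrow> (nat \<Rightarrow> int) set \<Rightarrow> (nat \<Rightarrow> int) set" where
  "left_ker p j I C = {y \<in> I \<rightarrow>\<^sub>E {0..<int p ^ j}. \<forall>c\<in>C. int p ^ j dvd (\<Sum>i\<in>I. y i * c i)}"

text \<open>\<open>r i\<close> stands for the number of Smith exponents greater than i. Prescribing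
  the kernel size for every j \<le> n, not only for j = n, fixes each \<open>r i\<close> with i < n
  separately.\<close>

definition ker_type :: "nat \<Rightarrow> nat \<Rightarrow> nat set \<Rightarrow> (nat \<Rightarrow> int) set \<Rightarrow> (nat \<Rightarrow> nat) \<Rightarrow> bool" where
  "ker_type p n I C r \<longleftrightarrow> (\<forall>j\<le>n. card (left_ker p j I C) = p ^ (\<Sum>i<j. r i))"

text \<open>Only g = 1 (arbitrary columns) and g = p (columns divisible by p) are used, with m a power of p.\<close>

definition colset :: "nat set \<Rightarrow> int \<Rightarrow> int \<Rightarrow> (nat \<Rightarrow> int) set" where
  "colset I m g = I \<rightarrow>\<^sub>E {x \<in> {0..<m}. g dvd x}"

text \<open>Here c' is an inverse of c i modulo m: a multiple of c is subtracted from d to clear its entry i, which is then dropped.\<close>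

definition eliminate :: "nat set \<Rightarrow> int \<Rightarrow> (nat \<Rightarrow> int) \<Rightarrow> int \<Rightarrow> nat \<Rightarrow> (nat \<Rightarrow> int) \<Rightarrow> (nat \<Rightarrow> int)" where
  "eliminate I m c c' i d = (\<lambda>l\<in>I - {i}. (d l - d i * c' * c l) mod m)"

lemma finite_colset [simp, intro]: "finite I \<Longrightarrow> finite (colset I m g)"
  unfolding colset_def by (intro finite_PiE) (auto intro: finite_subset[of _ "{0..<m}"])

lemma finite_left_ker [simp, intro]: "finite I \<Longrightarrow> finite (left_ker p j I C)"
  by (rule finite_subset[of _ "I \<rightarrow>\<^sub>E {0..<int p ^ j}"]) (auto simp: left_ker_def intro!: finite_PiE)

lemma card_multiples:
  assumes "(0::int) < g" "0 \<le> k"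
  shows "card {x \<in> {0..<g * k}. g dvd x} = nat k"
proof -
  have "{x \<in> {0..<g * k}. g dvd x} = (*) g ` {0..<k}"
  proof safe
    fix x assume "x \<in> {0..<g * k}" "g dvd x"
    then show "x \<in> (*) g ` {0..<k}"
      using assms by (intro image_eqI[of _ _ "x div g"]) (auto simp: pos_imp_zdiv_nonneg_iff elim!: dvdE)
  next
    fix x assume "x \<in> {0..<k}"
    then show "g * x \<in> {0..<g * k}" "g dvd g * x"
      using assms by auto
  qed
  moreover have "inj_on ((*) g) {0..<k}" using assms by (auto simp: inj_on_def)
  ultimately show ?thesis by (simp add: card_image)
qed

lemma card_colset:
  assumes "finite I" "(0::int) < g" "0 \<le> k"
  shows "card (colset I (g * k) g) = nat k ^ card I"
  unfolding colset_def by (subst card_PiE[OF assms(1)]) (simp only: card_multiples[OF assms(2,3)] prod_constant)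

lemma left_ker_0: "finite I \<Longrightarrow> card (left_ker p 0 I C) = 1"
proof -
  assume "finite I"
  have "left_ker p 0 I C = I \<rightarrow>\<^sub>E {0..<1}" by (simp add: left_ker_def)
  then show ?thesis by (simp add: card_PiE \<open>finite I\<close>)
qed

section \<open>Left kernels under scaling and elimination\<close>

lemma left_ker_cong:
  assumes "\<And>c. c \<in> C \<Longrightarrow> \<exists>d\<in>D. \<forall>i\<in>I. [c i = d i] (mod int p ^ j)"
    and "\<And>d. d \<in> D \<Longrightarrow> \<exists>c\<in>C. \<forall>i\<in>I. [c i = d i] (mod int p ^ j)"
  shows "left_ker p j I C = left_ker p j I D"
proof -
  have dvd: "int p ^ j dvd (\<Sum>i\<in>I. y i * c i) \<longleftrightarrow> int p ^ j dvd (\<Sum>i\<in>I. y i * d i)"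
    if "\<forall>i\<in>I. [c i = d i] (mod int p ^ j)" for y c d :: "nat \<Rightarrow> int"
    by (rule cong_dvd_iff, intro cong_sum cong_mult cong_refl) (use that in blast)
  have "(\<forall>c\<in>C. int p ^ j dvd (\<Sum>i\<in>I. y i * c i)) = (\<forall>d\<in>D. int p ^ j dvd (\<Sum>i\<in>I. y i * d i))" for y
  proof (intro iffI ballI)
    fix d assume *: "\<forall>c\<in>C. int p ^ j dvd (\<Sum>i\<in>I. y i * c i)" "d \<in> D"
    then obtain c where "c \<in> C" "\<forall>i\<in>I. [c i = d i] (mod int p ^ j)" using assms(2) by blast
    then show "int p ^ j dvd (\<Sum>i\<in>I. y i * d i)" using * dvd[of c d y] by blast
  next
    fix c assume *: "\<forall>d\<in>D. int p ^ j dvd (\<Sum>i\<in>I. y i * d i)" "c \<in> C"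
    then obtain d where "d \<in> D" "\<forall>i\<in>I. [c i = d i] (mod int p ^ j)" using assms(1) by blast
    then show "int p ^ j dvd (\<Sum>i\<in>I. y i * c i)" using * dvd[of c d y] by blast
  qed
  then show ?thesis unfolding left_ker_def by (simp only:)
qed

text \<open>After multiplication of the columns by p, the condition modulo p^(j+1) sees only y
  modulo p^j. Splitting each entry of y into remainder and quotient by p^j gives a kernel vector
  modulo p^j and one free digit per row.\<close>

lemma card_left_ker_scale:
  assumes "finite I" "p > 0"
  shows "card (left_ker p (Suc j) I ((\<lambda>c. \<lambda>i\<in>I. int p * c i) ` C)) = p ^ card I * card (left_ker p j I C)"
proof -
  let ?m = "int p ^ j"
  have m: "?m > 0" using assms by simp
  have key: "int p ^ Suc j dvd (\<Sum>i\<in>I. y i * (int p * c i)) \<longleftrightarrow> ?m dvd (\<Sum>i\<in>I. z i * c i)"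
    if "\<And>i. i \<in> I \<Longrightarrow> [y i = z i] (mod ?m)" for y z c :: "nat \<Rightarrow> int"
  proof -
    have "(\<Sum>i\<in>I. y i * (int p * c i)) = int p * (\<Sum>i\<in>I. y i * c i)"
      by (simp add: sum_distrib_left mult_ac)
    then have "int p ^ Suc j dvd (\<Sum>i\<in>I. y i * (int p * c i)) \<longleftrightarrow> ?m dvd (\<Sum>i\<in>I. y i * c i)"
      using assms by simp
    also have "\<dots> \<longleftrightarrow> ?m dvd (\<Sum>i\<in>I. z i * c i)"
      by (intro cong_dvd_iff cong_sum cong_mult) (auto simp: that)
    finally show ?thesis .
  qed
  have int_div_less: "a div ?m < int p" if "a < int p * ?m" for a
  proof (rule ccontr)
    assume "\<not> a div ?m < int p"
    then have "?m * int p \<le> ?m * (a div ?m)" using m by (intro mult_left_mono) auto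
    then show False
      using mult_div_mod_eq[of ?m a] pos_mod_sign[OF m, of a] that by (simp add: mult.commute)
  qed
  have "bij_betw (\<lambda>y. (\<lambda>i\<in>I. y i mod ?m, \<lambda>i\<in>I. y i div ?m))
     (left_ker p (Suc j) I ((\<lambda>c. \<lambda>i\<in>I. int p * c i) ` C))
     (left_ker p j I C \<times> (I \<rightarrow>\<^sub>E {0..<int p}))"
  proof (rule bij_betw_byWitness[where f' = "\<lambda>(y, z). \<lambda>i\<in>I. y i + ?m * z i"], goal_cases)
    case 1
    show ?case by (auto simp: left_ker_def PiE_def extensional_def fun_eq_iff)
  next
    case 2
    show ?case using m by (auto simp: left_ker_def PiE_def Pi_def extensional_def fun_eq_iff)
  next
    case 3
    show ?case
    proof (intro image_subsetI SigmaI)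
      fix y assume y: "y \<in> left_ker p (Suc j) I ((\<lambda>c. \<lambda>i\<in>I. int p * c i) ` C)"
      then show "(\<lambda>i\<in>I. y i div ?m) \<in> I \<rightarrow>\<^sub>E {0..<int p}"
        using m int_div_less by (auto simp: left_ker_def PiE_def Pi_def pos_imp_zdiv_nonneg_iff)
      have "?m dvd (\<Sum>i\<in>I. (\<lambda>i\<in>I. y i mod ?m) i * c i)" if "c \<in> C" for c
      proof -
        have "int p ^ Suc j dvd (\<Sum>i\<in>I. y i * (\<lambda>i\<in>I. int p * c i) i)"
          using y that unfolding left_ker_def by blast
        then have "int p ^ Suc j dvd (\<Sum>i\<in>I. y i * (int p * c i))"
          by (simp cong: sum.cong)
        then show ?thesis by (subst (asm) key[of y "\<lambda>i\<in>I. y i mod ?m"]) auto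
      qed
      then show "(\<lambda>i\<in>I. y i mod ?m) \<in> left_ker p j I C"
        using m unfolding left_ker_def by auto
    qed
  next
    case 4
    show ?case
    proof clarify
      fix y z assume y: "y \<in> left_ker p j I C" and z: "z \<in> I \<rightarrow>\<^sub>E {0..<int p}"
      have range: "0 \<le> y i + ?m * z i \<and> y i + ?m * z i < int p ^ Suc j" if "i \<in> I" for i
      proof -
        have *: "0 \<le> y i" "y i < ?m" "0 \<le> z i" "z i + 1 \<le> int p"
          using y z that by (auto simp: left_ker_def PiE_def Pi_def)
        have "?m * (z i + 1) \<le> ?m * int p"
          using * m by (intro mult_left_mono) auto
        then show ?thesis using * m by (auto simp: algebra_simps)
      qed
      have "int p ^ Suc j dvd (\<Sum>i\<in>I. (\<lambda>i\<in>I. y i + ?m * z i) i * (\<lambda>i\<in>I. int p * c i) i)" if "c \<in> C" for c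
      proof -
        have "?m dvd (\<Sum>i\<in>I. y i * c i)" using y that unfolding left_ker_def by blast
        then have "int p ^ Suc j dvd (\<Sum>i\<in>I. (y i + ?m * z i) * (int p * c i))"
          by (subst key[of "\<lambda>i. y i + ?m * z i" y]) (auto simp: cong_def)
        then show ?thesis by (simp cong: sum.cong)
      qed
      moreover have "(\<lambda>i\<in>I. y i + ?m * z i) \<in> I \<rightarrow>\<^sub>E {0..<int p ^ Suc j}"
        using range by (simp del: power_Suc)
      ultimately show "(\<lambda>i\<in>I. y i + ?m * z i) \<in> left_ker p (Suc j) I ((\<lambda>c. \<lambda>i\<in>I. int p * c i) ` C)"
        unfolding left_ker_def by blast
    qed
  qed
  then have "card (left_ker p (Suc j) I ((\<lambda>c. \<lambda>i\<in>I. int p * c i) ` C)) = card (left_ker p j I C \<times> (I \<rightarrow>\<^sub>E {0..<int p}))"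
    by (rule bij_betw_same_card)
  also have "\<dots> = p ^ card I * card (left_ker p j I C)"
    by (simp add: card_cartesian_product card_PiE \<open>finite I\<close>)
  finally show ?thesis .
qed

text \<open>The pivot column expresses y i through the other entries of y, and inserting this into
  the condition for a column d yields the condition for the eliminated d. The inverse c' modulo p^n
  serves for all j \<le> n at once.\<close>

lemma card_left_ker_pivot:
  assumes "finite I" "p > 0" and i: "i \<in> I" and c': "[c i * c' = 1] (mod int p ^ n)" and "j \<le> n"
  shows "card (left_ker p j I (insert c C)) = card (left_ker p j (I - {i}) (eliminate I (int p ^ n) c c' i ` C))"
proof -
  let ?m = "int p ^ j"
  let ?J = "I - {i}"
  let ?e = "eliminate I (int p ^ n) c c' i"
  have m: "?m > 0" using assms by simp
  have mn: "?m dvd int p ^ n" using \<open>j \<le> n\<close> by (simp add: le_imp_power_dvd)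
  have c'm: "[c i * c' = 1] (mod ?m)" using c' mn by (rule cong_dvd_modulus)
  have split: "(\<Sum>l\<in>I. f l) = f i + (\<Sum>l\<in>?J. f l)" for f :: "nat \<Rightarrow> int"
    using assms by (simp add: sum.remove)
  have iff1: "?m dvd y * c i + S \<longleftrightarrow> [y = - c' * S] (mod ?m)" for y S
  proof
    assume "?m dvd y * c i + S"
    then have "[c' * (y * c i + S) = 0] (mod ?m)" by (simp add: cong_0_iff)
    moreover have "[c' * (y * c i + S) = y * 1 + c' * S] (mod ?m)"
      using cong_add[OF cong_mult[OF cong_refl[of y] c'm] cong_refl[of "c' * S"]]
      by (simp add: algebra_simps)
    ultimately have "[y + c' * S = 0] (mod ?m)" by (simp add: cong_def)
    then show "[y = - c' * S] (mod ?m)" by (simp add: cong_iff_dvd_diff)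
  next
    assume "[y = - c' * S] (mod ?m)"
    then have "[y * c i + S = - c' * S * c i + S] (mod ?m)"
      by (intro cong_add cong_mult) auto
    moreover have "[- c' * S * c i + S = - S * 1 + S] (mod ?m)"
      using cong_add[OF cong_mult[OF cong_refl[of "-S"] c'm] cong_refl[of S]] by (simp add: algebra_simps)
    ultimately have "[y * c i + S = 0] (mod ?m)" by (simp add: cong_def)
    then show "?m dvd y * c i + S" by (simp add: cong_0_iff)
  qed
  have iff2: "?m dvd (\<Sum>l\<in>I. y l * d l) \<longleftrightarrow> ?m dvd (\<Sum>l\<in>?J. y l * ?e d l)"
    if "[y i = - c' * (\<Sum>l\<in>?J. y l * c l)] (mod ?m)" for y d
  proof -
    have "[(\<Sum>l\<in>?J. y l * ?e d l) = (\<Sum>l\<in>?J. y l * (d l - d i * c' * c l))] (mod ?m)"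
    proof (intro cong_sum cong_mult cong_refl)
      fix l assume "l \<in> ?J"
      then have "?e d l = (d l - d i * c' * c l) mod int p ^ n" by (simp add: eliminate_def)
      then have "[?e d l = d l - d i * c' * c l] (mod int p ^ n)" by (simp add: cong_def)
      then show "[?e d l = d l - d i * c' * c l] (mod ?m)" using mn by (rule cong_dvd_modulus)
    qed
    also have "(\<Sum>l\<in>?J. y l * (d l - d i * c' * c l)) = (- c' * (\<Sum>l\<in>?J. y l * c l)) * d i + (\<Sum>l\<in>?J. y l * d l)"
      by (simp add: right_diff_distrib sum_subtractf sum_distrib_left sum_distrib_right sum_negf mult_ac)
    also have "[\<dots> = y i * d i + (\<Sum>l\<in>?J. y l * d l)] (mod ?m)"
      using that by (intro cong_add cong_mult cong_refl) (rule cong_sym)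
    also have "y i * d i + (\<Sum>l\<in>?J. y l * d l) = (\<Sum>l\<in>I. y l * d l)" by (rule split[symmetric])
    finally show ?thesis by (intro cong_dvd_iff[symmetric])
  qed
  have "bij_betw (\<lambda>y. restrict y ?J) (left_ker p j I (insert c C)) (left_ker p j ?J (?e ` C))"
  proof (rule bij_betw_byWitness[where f' = "\<lambda>z. z(i := (- c' * (\<Sum>l\<in>?J. z l * c l)) mod ?m)"], goal_cases)
    case 1
    show ?case
    proof
      fix y assume y: "y \<in> left_ker p j I (insert c C)"
      then have "?m dvd y i * c i + (\<Sum>l\<in>?J. y l * c l)"
        using split[of "\<lambda>l. y l * c l"] by (simp add: left_ker_def)
      then have "[y i = - c' * (\<Sum>l\<in>?J. y l * c l)] (mod ?m)" by (simp only: iff1)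
      moreover have "0 \<le> y i" "y i < ?m" using y i by (auto simp: left_ker_def)
      ultimately have *: "(- c' * (\<Sum>l\<in>?J. y l * c l)) mod ?m = y i" by (simp add: cong_def)
      have **: "(\<Sum>l\<in>?J. (restrict y ?J) l * c l) = (\<Sum>l\<in>?J. y l * c l)" by (intro sum.cong) auto
      show "(restrict y ?J)(i := (- c' * (\<Sum>l\<in>?J. restrict y ?J l * c l)) mod ?m) = y"
        unfolding ** * using y by (auto simp: left_ker_def PiE_def extensional_def fun_eq_iff)
    qed
  next
    case 2
    show ?case by (auto simp: left_ker_def PiE_def extensional_def fun_eq_iff)
  next
    case 3
    show ?case
    proof clarify
      fix y assume y: "y \<in> left_ker p j I (insert c C)"
      then have "?m dvd y i * c i + (\<Sum>l\<in>?J. y l * c l)"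
        using split[of "\<lambda>l. y l * c l"] by (simp add: left_ker_def)
      then have *: "[y i = - c' * (\<Sum>l\<in>?J. y l * c l)] (mod ?m)" by (simp only: iff1)
      have "?m dvd (\<Sum>l\<in>?J. restrict y ?J l * ?e d l)" if "d \<in> C" for d
      proof -
        have "?m dvd (\<Sum>l\<in>?J. y l * ?e d l)"
          using y that by (subst iff2[OF *, symmetric]) (auto simp: left_ker_def)
        moreover have "(\<Sum>l\<in>?J. restrict y ?J l * ?e d l) = (\<Sum>l\<in>?J. y l * ?e d l)"
          by (intro sum.cong) auto
        ultimately show ?thesis by simp
      qed
      then show "restrict y ?J \<in> left_ker p j ?J (?e ` C)"
        using y by (auto simp: left_ker_def)
    qed
  next
    case 4
    show ?case
    proof clarify
      fix z assume z: "z \<in> left_ker p j ?J (?e ` C)"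
      define y where "y = z(i := (- c' * (\<Sum>l\<in>?J. z l * c l)) mod ?m)"
      have yz: "(\<Sum>l\<in>?J. y l * f l) = (\<Sum>l\<in>?J. z l * f l)" for f
        by (intro sum.cong) (auto simp: y_def)
      have "y i = (- c' * (\<Sum>l\<in>?J. z l * c l)) mod ?m" by (simp add: y_def)
      then have *: "[y i = - c' * (\<Sum>l\<in>?J. y l * c l)] (mod ?m)"
        by (simp add: yz cong_def)
      then have "?m dvd (\<Sum>l\<in>I. y l * c l)" unfolding split[of "\<lambda>l. y l * c l"] iff1 .
      moreover have "?m dvd (\<Sum>l\<in>I. y l * d l)" if "d \<in> C" for d
        using z that by (subst iff2[OF *], subst yz) (auto simp: left_ker_def)
      moreover have "y \<in> I \<rightarrow>\<^sub>E {0..<?m}"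
        using z m i by (auto simp: left_ker_def y_def PiE_def Pi_def extensional_def)
      ultimately show "y \<in> left_ker p j I (insert c C)"
        by (auto simp: left_ker_def)
    qed
  qed
  then show ?thesis by (rule bij_betw_same_card)
qed

lemma ker_type_pivot:
  assumes "finite I" "p > 0" "i \<in> I" "[c i * c' = 1] (mod int p ^ n)"
  shows "ker_type p n I (insert c C) r \<longleftrightarrow> ker_type p n (I - {i}) (eliminate I (int p ^ n) c c' i ` C) r"
  unfolding ker_type_def using card_left_ker_pivot[of I p i c c' n _ C, OF assms] by auto

text \<open>Modulo p every vector is in the kernel, which forces r 0 = card I; this same factor p ^
  card I cancels from all later kernel sizes by \<open>card_left_ker_scale\<close>, leaving the
  shifted sequence.\<close>

lemma ker_type_scale:
  assumes "finite I" "p > 1"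
  shows "ker_type p (Suc n) I ((\<lambda>c. \<lambda>i\<in>I. int p * c i) ` C) r \<longleftrightarrow>
           r 0 = card I \<and> ker_type p n I C (r \<circ> Suc)"
proof -
  let ?C = "(\<lambda>c. \<lambda>i\<in>I. int p * c i) ` C"
  have s: "card (left_ker p (Suc j) I ?C) = p ^ (\<Sum>i<Suc j. r i) \<longleftrightarrow>
        card (left_ker p j I C) = p ^ (\<Sum>i<j. (r \<circ> Suc) i)" if "r 0 = card I" for j
    using assms that by (simp only: card_left_ker_scale sum.lessThan_Suc_shift power_add) auto
  have 0: "r 0 = card I" if "ker_type p (Suc n) I ?C r"
  proof -
    have "card (left_ker p (Suc 0) I ?C) = p ^ (\<Sum>i<Suc 0. r i)"
      using that unfolding ker_type_def by blast
    then show ?thesis using assms by (simp add: card_left_ker_scale left_ker_0)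
  qed
  show ?thesis
  proof (intro iffI conjI)
    assume k: "ker_type p (Suc n) I ?C r"
    show r0: "r 0 = card I" using 0[OF k] .
    show "ker_type p n I C (r \<circ> Suc)"
      unfolding ker_type_def
    proof safe
      fix j assume "j \<le> n"
      then have "card (left_ker p (Suc j) I ?C) = p ^ (\<Sum>i<Suc j. r i)"
        using k unfolding ker_type_def by blast
      then show "card (left_ker p j I C) = p ^ (\<Sum>i<j. (r \<circ> Suc) i)" using s[OF r0] by blast
    qed
  next
    assume *: "r 0 = card I \<and> ker_type p n I C (r \<circ> Suc)"
    show "ker_type p (Suc n) I ?C r"
      unfolding ker_type_def
    proof safe
      fix j assume "j \<le> Suc n"
      then show "card (left_ker p j I ?C) = p ^ (\<Sum>i<j. r i)"
      proof (cases j)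
        case (Suc j')
        then show ?thesis unfolding Suc using * \<open>j \<le> Suc n\<close> Suc by (subst s) (auto simp: ker_type_def)
      qed (simp add: left_ker_0 assms)
    qed
  qed
qed

section \<open>Elimination as a map with fibers of constant size\<close>

lemma eliminate_colset:
  assumes "d \<in> colset I m g" "i \<in> I" "g dvd m" "m > 0"
  shows "eliminate I m c c' i d \<in> colset (I - {i}) m g"
proof -
  have "g dvd d l" if "l \<in> I" for l using assms that by (auto simp: colset_def)
  then show ?thesis using assms(2-4) unfolding eliminate_def colset_def
    by (auto intro!: dvd_mod dvd_diff)
qed

text \<open>The amount subtracted from d l depends on d only through d i, so d is recovered from its
  image together with the entry d i, which is free. If g divides d i, the corrections are divisible
  by g as well, so columns divisible by p form a class of their own.\<close>

lemma card_eliminate_fiber: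
  assumes e: "e \<in> colset (I - {i}) m g" and i: "i \<in> I" and g: "g dvd m" and m: "m > 0"
  shows "card {d \<in> colset I m g. eliminate I m c c' i d = e} = card {x \<in> {0..<m}. g dvd x}"
proof (rule bij_betw_same_card[where f = "\<lambda>d. d i"],
    rule bij_betw_byWitness[where f' = "\<lambda>x. \<lambda>l\<in>I. if l = i then x else (e l + x * c' * c l) mod m"], goal_cases)
  case 1
  show ?case
  proof (safe, rule ext)
    fix d l assume d: "d \<in> colset I m g" and "e = eliminate I m c c' i d"
    then show "(\<lambda>l\<in>I. if l = i then d i else (eliminate I m c c' i d l + d i * c' * c l) mod m) l = d l"
    proof (cases "l \<in> I \<and> l \<noteq> i")
      case True
      then have "0 \<le> d l" "d l < m" using d by (auto simp: colset_def)
      then show ?thesis using True by (simp add: eliminate_def mod_simps)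
    qed (use d in \<open>auto simp: colset_def PiE_def extensional_def\<close>)
  qed
next
  case 2
  show ?case using i by simp
next
  case 3
  show ?case using i by (auto simp: colset_def)
next
  case 4
  show ?case
  proof (intro image_subsetI CollectI conjI)
    fix x assume x: "x \<in> {x \<in> {0..<m}. g dvd x}"
    have "g dvd e l" if "l \<in> I" "l \<noteq> i" for l using e that by (auto simp: colset_def)
    then show "(\<lambda>l\<in>I. if l = i then x else (e l + x * c' * c l) mod m) \<in> colset I m g"
      using x m g i by (auto simp: colset_def intro!: dvd_mod dvd_add)
  next
    fix x assume "x \<in> {x \<in> {0..<m}. g dvd x}"
    show "eliminate I m c c' i (\<lambda>l\<in>I. if l = i then x else (e l + x * c' * c l) mod m) = e"
    proof
      fix l
      show "eliminate I m c c' i (\<lambda>l\<in>I. if l = i then x else (e l + x * c' * c l) mod m) l = e l"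
      proof (cases "l \<in> I - {i}")
        case True
        then have "0 \<le> e l" "e l < m" using e by (auto simp: colset_def)
        then show ?thesis using True i by (simp add: eliminate_def mod_simps)
      next
        case False
        then have "e l = undefined" using e by (auto simp: colset_def PiE_def extensional_def)
        then show ?thesis using False by (auto simp: eliminate_def)
      qed
    qed
  qed
qed

lemma card_map_fiber:
  assumes "finite A" and K: "\<And>y. y \<in> B \<Longrightarrow> card {x \<in> A. f x = y} = K" and "set ys \<subseteq> B"
  shows "card {xs. set xs \<subseteq> A \<and> map f xs = ys} = K ^ length ys"
  using \<open>set ys \<subseteq> B\<close>
proof (induction ys)
  case Nil
  have "{xs. set xs \<subseteq> A \<and> map f xs = []} = {[]}" by auto
  then show ?case by simp
next
  case (Cons y ys)
  have "{xs. set xs \<subseteq> A \<and> map f xs = y # ys} =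
     (\<lambda>(x, xs). x # xs) ` ({x \<in> A. f x = y} \<times> {xs. set xs \<subseteq> A \<and> map f xs = ys})"
    by (auto simp: map_eq_Cons_conv image_iff)
  then have "card {xs. set xs \<subseteq> A \<and> map f xs = y # ys} =
     card ({x \<in> A. f x = y} \<times> {xs. set xs \<subseteq> A \<and> map f xs = ys})"
    by (simp add: card_image inj_on_def)
  then show ?case using Cons K by (simp add: card_cartesian_product)
qed

lemma card_fibers:
  assumes "finite A" "finite B" "\<And>x. x \<in> A \<Longrightarrow> f x \<in> B"
    and K: "\<And>y. y \<in> B \<Longrightarrow> card {x \<in> A. f x = y} = K"
  shows "card {x \<in> A. P (f x)} = K * card {y \<in> B. P y}"
proof -
  have "{x \<in> A. P (f x)} = (\<Union>y\<in>{y \<in> B. P y}. {x \<in> A. f x = y})"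
    using assms(3) by auto
  then have "card {x \<in> A. P (f x)} = (\<Sum>y\<in>{y \<in> B. P y}. card {x \<in> A. f x = y})"
    using assms(1,2) by (simp only:) (rule card_UN_disjoint, auto)
  then show ?thesis using K by simp
qed

definition lists_of :: "'a set \<Rightarrow> nat \<Rightarrow> 'a list set" where
  "lists_of A n = {xs. set xs \<subseteq> A \<and> length xs = n}"

lemma finite_lists_of [simp, intro]: "finite A \<Longrightarrow> finite (lists_of A n)"
  unfolding lists_of_def by (rule finite_lists_length_eq)

lemma lists_of_0 [simp]: "lists_of A 0 = {[]}"
  by (auto simp: lists_of_def)

lemma lists_of_image:
  fixes f :: "'a \<Rightarrow> 'b"
  shows "lists_of (f ` A) n = map f ` lists_of A n"
proof -
  have "lists_of A n = {xs \<in> lists A. length xs = n}" for A :: "'b set"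
    by (auto simp: lists_of_def)
  moreover have "lists_of A n = {xs \<in> lists A. length xs = n}" for A :: "'a set"
    by (auto simp: lists_of_def)
  ultimately show ?thesis by (auto simp: lists_image)
qed

lemma lists_of_Suc: "lists_of A (Suc n) = (\<lambda>(x, xs). x # xs) ` (A \<times> lists_of A n)"
  by (auto simp: lists_of_def length_Suc_conv image_iff)

text \<open>A pivot acts on all remaining columns independently, so the fiber of a whole list of
  columns is a product of fibers, of size K for one kind of column and K' for the other.\<close>

lemma card_lists_of_pair_fibers:
  fixes f :: "'a \<Rightarrow> 'b"
  assumes fin: "finite A" "finite A'" "finite B" "finite B'"
    and f: "\<And>x. x \<in> A \<Longrightarrow> f x \<in> B" "\<And>x. x \<in> A' \<Longrightarrow> f x \<in> B'"
    and K: "\<And>y. y \<in> B \<Longrightarrow> card {x \<in> A. f x = y} = K" "\<And>y. y \<in> B' \<Longrightarrow> card {x \<in> A'. f x = y} = K'"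
  shows "card {(xs, ys) \<in> lists_of A a \<times> lists_of A' b. P (f ` (set xs \<union> set ys))} =
         K ^ a * K' ^ b * card {(xs, ys) \<in> lists_of B a \<times> lists_of B' b. P (set xs \<union> set ys)}"
proof -
  let ?F = "\<lambda>(xs, ys). (map f xs, map f ys)"
  have "card {z \<in> lists_of A a \<times> lists_of A' b. (\<lambda>(xs, ys). P (set xs \<union> set ys)) (?F z)} =
         K ^ a * K' ^ b * card {z \<in> lists_of B a \<times> lists_of B' b. (\<lambda>(xs, ys). P (set xs \<union> set ys)) z}"
  proof (rule card_fibers)
    fix z assume z: "z \<in> lists_of B a \<times> lists_of B' b"
    obtain xs ys where xy: "z = (xs, ys)" by force
    have "{x \<in> lists_of A a \<times> lists_of A' b. ?F x = z} =
       {us. set us \<subseteq> A \<and> map f us = xs} \<times> {vs. set vs \<subseteq> A' \<and> map f vs = ys}"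
      using z by (auto simp: lists_of_def xy)
    then show "card {x \<in> lists_of A a \<times> lists_of A' b. ?F x = z} = K ^ a * K' ^ b"
      using card_map_fiber[where ys = xs, OF fin(1) K(1)] card_map_fiber[where ys = ys, OF fin(2) K(2)] z
      by (simp add: card_cartesian_product lists_of_def xy)
  next
    fix z assume "z \<in> lists_of A a \<times> lists_of A' b"
    then show "?F z \<in> lists_of B a \<times> lists_of B' b"
      using f unfolding lists_of_def by fastforce
  qed (use fin in auto)
  then show ?thesis by (simp add: case_prod_beta' image_Un mem_Times_iff)
qed

section \<open>Counting by exposing one column at a time\<close>

text \<open>The state of the column-by-column elimination: the columns in C have been exposed, a further columns are divisible by p, and b columns are unrestricted.\<close>

definition count_type :: "nat \<Rightarrow> nat set \<Rightarrow> nat \<Rightarrow> nat \<Rightarrow> nat \<Rightarrow> (nat \<Rightarrow> int) set \<Rightarrow> (nat \<Rightarrow> nat) \<Rightarrow> nat" where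
  "count_type p I n a b C r = card {(cs, ds) \<in> lists_of (colset I (int p ^ n) (int p)) a \<times> lists_of (colset I (int p ^ n) 1) b.
      ker_type p n I (C \<union> (set cs \<union> set ds)) r}"

lemma count_type_Suc_free:
  assumes "finite I"
  shows "count_type p I n a (Suc b) {} r = (\<Sum>c\<in>colset I (int p ^ n) 1. count_type p I n a b {c} r)"
proof -
  let ?P = "colset I (int p ^ n) (int p)" and ?V = "colset I (int p ^ n) 1"
  have "{(cs, ds) \<in> lists_of ?P a \<times> lists_of ?V (Suc b). ker_type p n I ({} \<union> (set cs \<union> set ds)) r} =
     (\<lambda>(c, cs, ds). (cs, c # ds)) ` (SIGMA c:?V. {(cs, ds) \<in> lists_of ?P a \<times> lists_of ?V b.
      ker_type p n I ({c} \<union> (set cs \<union> set ds)) r})"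
    by (fastforce simp: lists_of_Suc image_iff)
  then have "count_type p I n a (Suc b) {} r = card (SIGMA c:?V. {(cs, ds) \<in> lists_of ?P a \<times> lists_of ?V b.
      ker_type p n I ({c} \<union> (set cs \<union> set ds)) r})"
    unfolding count_type_def by (simp only:) (subst card_image, auto simp: inj_on_def)
  also have "\<dots> = (\<Sum>c\<in>?V. count_type p I n a b {c} r)"
    unfolding count_type_def using assms
    by (intro card_SigmaI ballI finite_subset[OF _ finite_cartesian_product[of "lists_of ?P a" "lists_of ?V b"]]) auto
  finally show ?thesis .
qed

text \<open>Read from right to left: the part of \<open>count_type_Suc_free\<close> in which the
  exposed column has no unit entry is the count for a state with one more divisible column. This is
  how a column is set aside.\<close>

lemma count_type_Suc_divisible:
  assumes "finite I"
  shows "count_type p I n (Suc a) b {} r = (\<Sum>c\<in>colset I (int p ^ n) (int p). count_type p I n a b {c} r)"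
proof -
  let ?P = "colset I (int p ^ n) (int p)" and ?V = "colset I (int p ^ n) 1"
  have "{(cs, ds) \<in> lists_of ?P (Suc a) \<times> lists_of ?V b. ker_type p n I ({} \<union> (set cs \<union> set ds)) r} =
     (\<lambda>(c, cs, ds). (c # cs, ds)) ` (SIGMA c:?P. {(cs, ds) \<in> lists_of ?P a \<times> lists_of ?V b.
      ker_type p n I ({c} \<union> (set cs \<union> set ds)) r})"
    by (fastforce simp: lists_of_Suc image_iff)
  then have "count_type p I n (Suc a) b {} r = card (SIGMA c:?P. {(cs, ds) \<in> lists_of ?P a \<times> lists_of ?V b.
      ker_type p n I ({c} \<union> (set cs \<union> set ds)) r})"
    unfolding count_type_def by (simp only:) (subst card_image, auto simp: inj_on_def)
  also have "\<dots> = (\<Sum>c\<in>?P. count_type p I n a b {c} r)"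
    unfolding count_type_def using assms
    by (intro card_SigmaI ballI finite_subset[OF _ finite_cartesian_product[of "lists_of ?P a" "lists_of ?V b"]]) auto
  finally show ?thesis .
qed

text \<open>The powers are the fiber sizes of the elimination: p^n multiples of p modulo p^(n+1) for
  each divisible column, and all p^(n+1) residues for each free one.\<close>

lemma count_type_pivot:
  assumes "finite I" "prime p" "i \<in> I" "\<not> int p dvd c i"
  shows "count_type p I (Suc n) a b {c} r =
    (p ^ n) ^ a * (p ^ Suc n) ^ b * count_type p (I - {i}) (Suc n) a b {} r"
proof -
  let ?m = "int p ^ Suc n"
  have p0: "p > 0" using prime_gt_0_nat[OF \<open>prime p\<close>] .
  have "coprime (c i) ?m"
    using assms by (metis coprime_commute coprime_power_right_iff prime_imp_coprime prime_nat_int_transfer)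
  then obtain c' where c': "[c i * c' = 1] (mod ?m)" using cong_solve_coprime_int by blast
  have "count_type p I (Suc n) a b {c} r =
    card {(xs, ys) \<in> lists_of (colset I ?m (int p)) a \<times> lists_of (colset I ?m 1) b.
      ker_type p (Suc n) (I - {i}) (eliminate I ?m c c' i ` (set xs \<union> set ys)) r}"
    unfolding count_type_def using ker_type_pivot[of I p i c c' "Suc n", OF assms(1) p0 assms(3) c'] by simp
  also have "\<dots> = (p ^ n) ^ a * (p ^ Suc n) ^ b *
     card {(xs, ys) \<in> lists_of (colset (I - {i}) ?m (int p)) a \<times> lists_of (colset (I - {i}) ?m 1) b.
      ker_type p (Suc n) (I - {i}) (set xs \<union> set ys) r}"
  proof (rule card_lists_of_pair_fibers)
    show "card {x \<in> colset I ?m (int p). eliminate I ?m c c' i x = y} = p ^ n"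
      if "y \<in> colset (I - {i}) ?m (int p)" for y
      using card_eliminate_fiber[OF that assms(3)] card_multiples[of "int p" "int p ^ n"] p0
      by (simp add: nat_power_eq)
    show "card {x \<in> colset I ?m 1. eliminate I ?m c c' i x = y} = p ^ Suc n"
      if "y \<in> colset (I - {i}) ?m 1" for y
      using card_eliminate_fiber[OF that assms(3)] card_multiples[of 1 ?m] p0
      by (simp add: nat_power_eq nat_mult_distrib)
  qed (use assms p0 in \<open>auto intro: eliminate_colset\<close>)
  finally show ?thesis by (simp add: count_type_def)
qed

text \<open>Division by p is a bijection from divisible columns modulo p^(n+1) to arbitrary columns
  modulo p^n, so the a divisible columns become a free ones at the next level.\<close>

lemma count_type_divisible:
  assumes "finite I" "prime p"
  shows "count_type p I (Suc n) a 0 {} r =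
    (if r 0 = card I then count_type p I n 0 a {} (r \<circ> Suc) else 0)"
proof -
  let ?f = "\<lambda>c. \<lambda>i\<in>I. int p * c i"
  let ?V = "colset I (int p ^ n) 1"
  have p: "p > 1" using prime_gt_1_nat[OF \<open>prime p\<close>] .
  have inj: "inj_on ?f ?V"
  proof (rule inj_onI)
    fix c d assume *: "c \<in> ?V" "d \<in> ?V" "?f c = ?f d"
    have e: "?f c i = ?f d i" for i by (simp only: *(3))
    have "c i = d i" for i
      using p *(1,2) e[of i] by (cases "i \<in> I") (auto simp: colset_def PiE_def extensional_def)
    then show "c = d" ..
  qed
  have img: "colset I (int p ^ Suc n) (int p) = ?f ` ?V"
  proof safe
    fix c assume c: "c \<in> colset I (int p ^ Suc n) (int p)"
    have "\<exists>x. c i = int p * x \<and> 0 \<le> x \<and> x < int p ^ n" if "i \<in> I" for i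
    proof -
      have "0 \<le> c i" "c i < int p * int p ^ n" "int p dvd c i" using c that by (auto simp: colset_def)
      then show ?thesis using p by (auto elim!: dvdE simp: zero_le_mult_iff)
    qed
    then obtain d where d: "\<And>i. i \<in> I \<Longrightarrow> c i = int p * d i \<and> 0 \<le> d i \<and> d i < int p ^ n" by metis
    then have "c = ?f (restrict d I)" using c by (auto simp: colset_def fun_eq_iff PiE_def extensional_def)
    moreover have "restrict d I \<in> ?V" using d by (auto simp: colset_def)
    ultimately show "c \<in> ?f ` ?V" by blast
  next
    fix c assume "c \<in> ?V"
    then show "?f c \<in> colset I (int p ^ Suc n) (int p)"
      using p by (auto simp: colset_def PiE_def Pi_def)
  qed
  have lists: "lists_of (?f ` ?V) a = map ?f ` lists_of ?V a"
    by (rule lists_of_image)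
  have "count_type p I (Suc n) a 0 {} r =
     card {cs \<in> map ?f ` lists_of ?V a. ker_type p (Suc n) I (set cs) r}"
    unfolding count_type_def img lists
    by (rule bij_betw_same_card[of fst]) (auto simp: bij_betw_def inj_on_def image_iff)
  also have "{cs \<in> map ?f ` lists_of ?V a. ker_type p (Suc n) I (set cs) r} =
     map ?f ` {cs \<in> lists_of ?V a. ker_type p (Suc n) I (?f ` set cs) r}"
    by auto
  also have "card \<dots> = card {cs \<in> lists_of ?V a. ker_type p (Suc n) I (?f ` set cs) r}"
    by (rule card_image, rule inj_onI, rule map_inj_on, assumption, rule inj_on_subset[OF inj])
      (auto simp: lists_of_def)
  also have "\<dots> = card {cs \<in> lists_of ?V a. r 0 = card I \<and> ker_type p n I (set cs) (r \<circ> Suc)}"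
    using ker_type_scale[OF assms(1) p] by simp
  also have "\<dots> = (if r 0 = card I then card {cs \<in> lists_of ?V a. ker_type p n I (set cs) (r \<circ> Suc)} else 0)"
    by auto
  also have "card {cs \<in> lists_of ?V a. ker_type p n I (set cs) (r \<circ> Suc)} = count_type p I n 0 a {} (r \<circ> Suc)"
    unfolding count_type_def
    by (rule bij_betw_same_card[of "Pair []"]) (auto simp: bij_betw_def inj_on_def image_iff)
  finally show ?thesis .
qed

text \<open>The argument M occurs twice in \<open>corank_prob\<close> because each level starts with
  a square matrix: the r 0 columns set aside face the r 0 rows that no pivot has removed.\<close>

fun type_prob :: "real \<Rightarrow> nat \<Rightarrow> nat \<Rightarrow> (nat \<Rightarrow> nat) \<Rightarrow> real" where
  "type_prob q 0 M r = 1"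
| "type_prob q (Suc n) M r = corank_prob q M M (r 0) * type_prob q n (r 0) (r \<circ> Suc)"

lemma type_prob_eq:
  "type_prob q n M r = (\<Prod>i<n. corank_prob q (case i of 0 \<Rightarrow> M | Suc j \<Rightarrow> r j) (case i of 0 \<Rightarrow> M | Suc j \<Rightarrow> r j) (r i))"
proof (induction n arbitrary: M r)
  case (Suc n)
  show ?case
    unfolding prod.lessThan_Suc_shift type_prob.simps Suc
    by (intro arg_cong2[of _ _ _ _ "(*)"] prod.cong) (auto split: nat.split)
qed auto

lemma card_non_multiples:
  assumes "finite I" "p > 0"
  shows "card (colset I (int p ^ Suc n) 1 - colset I (int p ^ Suc n) (int p)) = (p ^ Suc n) ^ card I - (p ^ n) ^ card I"
proof -
  have "card (colset I (int p ^ Suc n) 1) = (p ^ Suc n) ^ card I"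
    using card_colset[OF assms(1), of 1 "int p ^ Suc n"] by (simp add: nat_power_eq nat_mult_distrib)
  moreover have "card (colset I (int p ^ Suc n) (int p)) = (p ^ n) ^ card I"
    using card_colset[OF assms(1), of "int p" "int p ^ n"] assms by (simp add: nat_power_eq)
  moreover have "colset I (int p ^ Suc n) (int p) \<subseteq> colset I (int p ^ Suc n) 1"
    unfolding colset_def by (rule PiE_mono) auto
  ultimately show ?thesis using assms by (simp add: card_Diff_subset)
qed

text \<open>The passage from n to n + 1, by an inner induction on the free columns. The invariant a
  + b = card I persists because a pivot removes one row and one column, while setting aside keeps
  the total. The exponent of p counts base p digits: n free ones per entry of a divisible column, n
  + 1 per entry of a free column.\<close>

lemma count_type_eq_aux:
  assumes p: "prime p"
    and IH: "\<And>I r. finite I \<Longrightarrow> real (count_type p I n 0 (card I) {} r) =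
      real p ^ (n * card I * card I) * type_prob (1 / real p) n (card I) r"
  shows "finite I \<Longrightarrow> a + b = card I \<Longrightarrow> real (count_type p I (Suc n) a b {} r) =
      real p ^ (n * card I * a + Suc n * card I * b) *
        (corank_prob (1 / real p) (card I) b (r 0) * type_prob (1 / real p) n (r 0) (r \<circ> Suc))"
proof (induction b arbitrary: I a)
  case 0
  then show ?case using IH[of I "r \<circ> Suc"] by (simp add: count_type_divisible p comp_def)
next
  case (Suc b)
  define M where "M = card I"
  define T where "T = type_prob (1 / real p) n (r 0) (r \<circ> Suc)"
  define E where "E = n * M * a + Suc n * M * b"
  let ?q = "1 / real p"
  let ?V = "colset I (int p ^ Suc n) 1" and ?P = "colset I (int p ^ Suc n) (int p)"
  have p0: "p > 0" using prime_gt_0_nat[OF p] .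
  have "M > 0" "I \<noteq> {}" using Suc.prems unfolding M_def by (auto simp: card_gt_0_iff)
  have sub: "?P \<subseteq> ?V" unfolding colset_def by (rule PiE_mono) auto
  have piv: "real (count_type p I (Suc n) a b {c} r) = real p ^ E * corank_prob ?q (M - 1) b (r 0) * T"
    if "c \<in> ?V - ?P" for c
  proof -
    have "\<exists>i\<in>I. \<not> int p dvd c i"
      using that by (auto simp: colset_def PiE_iff)
    then obtain i where i: "i \<in> I" "\<not> int p dvd c i" by blast
    have c: "card (I - {i}) = M - 1" using i Suc.prems by (simp add: M_def)
    have "real (count_type p I (Suc n) a b {c} r) =
      real p ^ (n * a + Suc n * b) * real (count_type p (I - {i}) (Suc n) a b {} r)"
      by (subst count_type_pivot[of I p i c, OF Suc.prems(1) p i]) (simp add: power_add power_mult power_mult_distrib)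
    also have "real (count_type p (I - {i}) (Suc n) a b {} r) =
      real p ^ (n * (M - 1) * a + Suc n * (M - 1) * b) * (corank_prob ?q (M - 1) b (r 0) * T)"
      using Suc.IH[of "I - {i}" a] Suc.prems i by (simp only: c T_def) (simp add: M_def comp_def)
    also have "real p ^ (n * a + Suc n * b) * (real p ^ (n * (M - 1) * a + Suc n * (M - 1) * b) * (corank_prob ?q (M - 1) b (r 0) * T))
       = real p ^ (n * a + Suc n * b + (n * (M - 1) * a + Suc n * (M - 1) * b)) * corank_prob ?q (M - 1) b (r 0) * T"
      by (simp only: power_add mult_ac)
    also have "n * a + Suc n * b + (n * (M - 1) * a + Suc n * (M - 1) * b) = E"
      using \<open>M > 0\<close> by (cases M) (simp_all add: E_def algebra_simps)
    finally show ?thesis .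
  qed
  \<comment> \<open>The first free column either has a unit entry or is divisible by p; these two
    sums become the two terms in the recurrence of \<open>corank_prob\<close>.\<close>
  have "real (count_type p I (Suc n) a (Suc b) {} r) =
     (\<Sum>c\<in>?V - ?P. real (count_type p I (Suc n) a b {c} r)) + (\<Sum>c\<in>?P. real (count_type p I (Suc n) a b {c} r))"
    unfolding count_type_Suc_free[OF Suc.prems(1)] of_nat_sum
    using sub Suc.prems(1) by (intro sum.subset_diff) auto
  also have "(\<Sum>c\<in>?V - ?P. real (count_type p I (Suc n) a b {c} r)) =
     real (card (?V - ?P)) * (real p ^ E * corank_prob ?q (M - 1) b (r 0) * T)"
    using piv by simp
  also have "real (card (?V - ?P)) = (real p ^ Suc n) ^ M * (1 - ?q ^ M)"
  proof -
    have "(p ^ n) ^ M \<le> (p ^ Suc n) ^ M" using p0 by (intro power_mono) auto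
    moreover have "real p ^ M * ?q ^ M = 1" using p0 by (simp add: power_one_over)
    ultimately show ?thesis unfolding card_non_multiples[OF Suc.prems(1) p0] M_def[symmetric]
      by (simp add: of_nat_diff power_mult_distrib right_diff_distrib)
  qed
  also have "(\<Sum>c\<in>?P. real (count_type p I (Suc n) a b {c} r)) = real (count_type p I (Suc n) (Suc a) b {} r)"
    unfolding count_type_Suc_divisible[OF Suc.prems(1)] by simp
  also have "\<dots> = real p ^ (n * M * Suc a + Suc n * M * b) * (corank_prob ?q M b (r 0) * T)"
    using Suc.IH[of I "Suc a"] Suc.prems by (simp add: M_def T_def comp_def)
  also have "n * M * Suc a + Suc n * M * b = n * M + E" by (simp add: E_def)
  \<comment> \<open>A divisible column has one free digit fewer in each of its M entries, which is
    the probability q^M of the second alternative.\<close>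
  also have "real p ^ (n * M + E) = real p ^ (n * M + M + E) * ?q ^ M"
    using p0 by (simp add: power_add power_one_over)
  also have "(real p ^ Suc n) ^ M = real p ^ (n * M + M)"
    by (simp add: power_add power_mult_distrib power_mult)
  finally have "real (count_type p I (Suc n) a (Suc b) {} r) =
     real p ^ (n * M + M + E) * (((1 - ?q ^ M) * corank_prob ?q (M - 1) b (r 0) + ?q ^ M * corank_prob ?q M b (r 0)) * T)"
    by (simp add: power_add algebra_simps)
  moreover have "n * M + M + E = n * M * a + Suc n * M * Suc b" by (simp add: E_def algebra_simps)
  ultimately show ?case
    unfolding T_def M_def[symmetric] corank_prob.simps by (simp only:)
qed

lemma count_type_eq:
  assumes p: "prime p" and "finite I"
  shows "real (count_type p I n 0 (card I) {} r) =
      real p ^ (n * card I * card I) * type_prob (1 / real p) n (card I) r"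
  using \<open>finite I\<close>
proof (induction n arbitrary: I r)
  case 0
  have "card (lists_of (colset I 1 1) (card I)) = 1"
    using card_lists_length_eq[OF finite_colset[OF 0], of 1 1 "card I"] card_colset[OF 0, of 1 1]
    by (simp add: lists_of_def)
  moreover have "ker_type p 0 I C r" for C using 0 by (simp add: ker_type_def left_ker_0)
  moreover have "{(cs, ds) \<in> lists_of (colset I 1 (int p)) 0 \<times> lists_of (colset I 1 1) (card I). True} =
      Pair [] ` lists_of (colset I 1 1) (card I)" by auto
  ultimately show ?case by (simp add: count_type_def card_image inj_on_def)
next
  case (Suc n)
  show ?case
    using count_type_eq_aux[OF p Suc.IH, of I 0 "card I" r] Suc.prems by simp
qed

definition column_set :: "nat \<Rightarrow> (nat \<times> nat \<Rightarrow> int) \<Rightarrow> (nat \<Rightarrow> int) set" where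
  "column_set N X = (\<lambda>j i. X (i, j)) ` {..<N}"

lemma ker_type_cong:
  assumes "\<And>j. j \<le> n \<Longrightarrow> left_ker p j I C = left_ker p j I D"
  shows "ker_type p n I C r = ker_type p n I D r"
  using assms unfolding ker_type_def by simp

lemma left_ker_restrict: "left_ker p j I ((\<lambda>c. restrict c I) ` C) = left_ker p j I C"
  by (simp add: left_ker_def cong: sum.cong)

lemma left_ker_column_set_cong:
  assumes "\<And>i j. i < N \<Longrightarrow> j < N \<Longrightarrow> [X (i, j) = Y (i, j)] (mod int p ^ n)"
  shows "left_ker p n {..<N} (column_set N X) = left_ker p n {..<N} (column_set N Y)"
  using assms by (intro left_ker_cong) (auto simp: column_set_def)

text \<open>A matrix is the list of its columns, hence the initial state of the count with no
  divisible and N free columns.\<close>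

lemma card_matrices_ker_type:
  assumes p: "prime p"
  shows "real (card {X \<in> {..<N} \<times> {..<N} \<rightarrow>\<^sub>E {0..<int p ^ n}. ker_type p n {..<N} (column_set N X) r}) =
    real p ^ (n * N * N) * type_prob (1 / real p) n N r"
proof -
  let ?m = "int p ^ n"
  let ?V = "colset {..<N} ?m 1"
  let ?col = "\<lambda>X j. \<lambda>i\<in>{..<N}. (X (i, j) :: int)"
  let ?F = "\<lambda>X. ([] :: (nat \<Rightarrow> int) list, map (?col X) [0..<N])"
  let ?M = "{..<N} \<times> {..<N} \<rightarrow>\<^sub>E {0..<?m}"
  have kt: "ker_type p n {..<N} (column_set N X) r \<longleftrightarrow> ker_type p n {..<N} (set (map (?col X) [0..<N])) r" for X
  proof (rule ker_type_cong)
    fix j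
    have "set (map (?col X) [0..<N]) = (\<lambda>c. restrict c {..<N}) ` column_set N X"
      by (auto simp: column_set_def)
    then show "left_ker p j {..<N} (column_set N X) = left_ker p j {..<N} (set (map (?col X) [0..<N]))"
      by (simp only: left_ker_restrict)
  qed
  have "bij_betw ?F {X \<in> ?M. ker_type p n {..<N} (column_set N X) r}
    {(cs, ds) \<in> lists_of (colset {..<N} ?m (int p)) 0 \<times> lists_of ?V N. ker_type p n {..<N} (set cs \<union> set ds) r}"
    unfolding bij_betw_def
  proof
    show "inj_on ?F {X \<in> ?M. ker_type p n {..<N} (column_set N X) r}"
    proof (rule inj_onI)
      fix X Y assume X: "X \<in> {X \<in> ?M. ker_type p n {..<N} (column_set N X) r}"
        and Y: "Y \<in> {X \<in> ?M. ker_type p n {..<N} (column_set N X) r}" and e: "?F X = ?F Y"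
      have "X (i, j) = Y (i, j)" for i j
      proof (cases "i < N \<and> j < N")
        case True
        then have "?col X j = ?col Y j" using e by auto
        then have "?col X j i = ?col Y j i" by (rule fun_cong)
        then show ?thesis using True by simp
      qed (use X Y in \<open>auto simp: PiE_def extensional_def\<close>)
      then show "X = Y" by auto
    qed
    show "?F ` {X \<in> ?M. ker_type p n {..<N} (column_set N X) r} =
     {(cs, ds) \<in> lists_of (colset {..<N} ?m (int p)) 0 \<times> lists_of ?V N. ker_type p n {..<N} (set cs \<union> set ds) r}"
    proof (intro equalityI subsetI)
      fix z assume "z \<in> ?F ` {X \<in> ?M. ker_type p n {..<N} (column_set N X) r}"
      then obtain X where X: "X \<in> ?M" "ker_type p n {..<N} (column_set N X) r" "z = ?F X" by blast
      have "?col X j \<in> ?V" if "j < N" for j using X(1) that by (auto simp: colset_def PiE_iff)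
      then have "map (?col X) [0..<N] \<in> lists_of ?V N" by (auto simp: lists_of_def)
      then show "z \<in> {(cs, ds) \<in> lists_of (colset {..<N} ?m (int p)) 0 \<times> lists_of ?V N. ker_type p n {..<N} (set cs \<union> set ds) r}"
        using X(2) unfolding X(3) kt by simp
    next
      fix z assume "z \<in> {(cs, ds) \<in> lists_of (colset {..<N} ?m (int p)) 0 \<times> lists_of ?V N. ker_type p n {..<N} (set cs \<union> set ds) r}"
      then obtain ds where z: "z = ([], ds)" and ds: "ds \<in> lists_of ?V N" "ker_type p n {..<N} (set ds) r"
        by auto
      have len: "length ds = N" and V: "\<And>j. j < N \<Longrightarrow> ds ! j \<in> ?V" using ds(1) by (auto simp: lists_of_def)
      define X where "X = (\<lambda>(i, j)\<in>{..<N} \<times> {..<N}. (ds ! j) i)"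
      have "?col X j = ds ! j" if "j < N" for j
        using V[OF that] that by (auto simp: X_def colset_def fun_eq_iff PiE_def extensional_def)
      then have ds_eq: "map (?col X) [0..<N] = ds" using len by (intro nth_equalityI) auto
      then have "ker_type p n {..<N} (column_set N X) r" unfolding kt using ds(2) by simp
      moreover have "X \<in> ?M" using V by (auto simp: X_def colset_def PiE_iff)
      ultimately show "z \<in> ?F ` {X \<in> ?M. ker_type p n {..<N} (column_set N X) r}" unfolding z
        using ds_eq by blast
    qed
  qed
  then have "card {X \<in> ?M. ker_type p n {..<N} (column_set N X) r} = count_type p {..<N} n 0 N {} r"
    unfolding count_type_def by (simp add: bij_betw_same_card)
  then show ?thesis using count_type_eq[OF p, of "{..<N}" n r] by simp
qed

section \<open>Smith normal form modulo a prime power\<close>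

type_synonym imat = "nat \<times> nat \<Rightarrow> int"

definition mprod :: "nat \<Rightarrow> imat \<Rightarrow> imat \<Rightarrow> imat" where
  "mprod N A B = (\<lambda>(i, j). \<Sum>l<N. A (i, l) * B (l, j))"

definition mcong :: "int \<Rightarrow> nat \<Rightarrow> imat \<Rightarrow> imat \<Rightarrow> bool" where
  "mcong q N A B \<longleftrightarrow> (\<forall>i<N. \<forall>j<N. [A (i, j) = B (i, j)] (mod q))"

definition mone :: imat where
  "mone = (\<lambda>(i, j). if i = j then 1 else 0)"

definition mtr :: "imat \<Rightarrow> imat" where
  "mtr A = (\<lambda>(i, j). A (j, i))"

definition mdiag :: "nat \<Rightarrow> (nat \<Rightarrow> nat) \<Rightarrow> imat" where
  "mdiag p l = (\<lambda>(i, j). if i = j then int p ^ l i else 0)"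

definition minverses :: "int \<Rightarrow> nat \<Rightarrow> imat \<Rightarrow> imat \<Rightarrow> bool" where
  "minverses q N U U' \<longleftrightarrow> mcong q N (mprod N U U') mone \<and> mcong q N (mprod N U' U) mone"

definition mequiv :: "int \<Rightarrow> nat \<Rightarrow> imat \<Rightarrow> imat \<Rightarrow> bool" where
  "mequiv q N X Y \<longleftrightarrow> (\<exists>U U' V V'. minverses q N U U' \<and> minverses q N V V' \<and>
     mcong q N X (mprod N (mprod N U Y) V))"

lemma mcong_refl [simp]: "mcong q N A A"
  by (simp add: mcong_def)

lemma mcong_sym: "mcong q N A B \<Longrightarrow> mcong q N B A"
  by (simp add: mcong_def cong_sym)

lemma mcong_trans [trans]: "mcong q N A B \<Longrightarrow> mcong q N B C \<Longrightarrow> mcong q N A C"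
  unfolding mcong_def by (blast intro: cong_trans)

lemma mcong_mprod: "mcong q N A A' \<Longrightarrow> mcong q N B B' \<Longrightarrow> mcong q N (mprod N A B) (mprod N A' B')"
  unfolding mcong_def mprod_def by (auto intro!: cong_sum cong_mult)

lemma mcong_dvd: "mcong q N A B \<Longrightarrow> q' dvd q \<Longrightarrow> mcong q' N A B"
  unfolding mcong_def by (blast intro: cong_dvd_modulus)

lemma mprod_assoc: "mprod N (mprod N A B) C = mprod N A (mprod N B C)"
proof -
  have "(\<Sum>l<N. (\<Sum>k<N. A (i, k) * B (k, l)) * C (l, j)) = (\<Sum>k<N. A (i, k) * (\<Sum>l<N. B (k, l) * C (l, j)))" for i j
    unfolding sum_distrib_left sum_distrib_right by (subst sum.swap) (simp add: mult_ac)
  then show ?thesis by (simp add: mprod_def)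
qed

lemma mprod_one:
  "mcong q N (mprod N mone A) A" "mcong q N (mprod N A mone) A"
  by (auto simp: mcong_def mprod_def mone_def if_distrib[of "\<lambda>x. x * _"] if_distrib[of "\<lambda>x. _ * x"]
      sum.delta sum.delta' cong: if_cong)

lemma mtr_mtr [simp]: "mtr (mtr A) = A"
  by (simp add: mtr_def)

lemma mtr_mprod: "mtr (mprod N A B) = mprod N (mtr B) (mtr A)"
  by (simp add: mtr_def mprod_def mult.commute)

lemma mtr_mone [simp]: "mtr mone = mone"
  by (auto simp: mtr_def mone_def)

lemma mcong_mtr [simp]: "mcong q N (mtr A) (mtr B) \<longleftrightarrow> mcong q N A B"
  by (auto simp: mcong_def mtr_def)

lemma minverses_mtr: "minverses q N U U' \<Longrightarrow> minverses q N (mtr U) (mtr U')"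
proof -
  assume *: "minverses q N U U'"
  have "mcong q N (mtr A) mone \<longleftrightarrow> mcong q N A mone" for A
    using mcong_mtr[of q N A mone] by simp
  then show ?thesis using * unfolding minverses_def mtr_mprod[symmetric] by blast
qed

lemma minverses_sym: "minverses q N U U' \<Longrightarrow> minverses q N U' U"
  by (simp add: minverses_def)

lemma minverses_mone: "minverses q N mone mone"
  by (simp add: minverses_def mprod_one)

lemma minverses_mprod:
  assumes "minverses q N U U'" "minverses q N V V'"
  shows "minverses q N (mprod N U V) (mprod N V' U')"
proof -
  have *: "mcong q N (mprod N (mprod N A B) (mprod N B' A')) mone"
    if "mcong q N (mprod N A A') mone" "mcong q N (mprod N B B') mone" for A B A' B'
  proof -
    have eq: "mprod N (mprod N A B) (mprod N B' A') = mprod N (mprod N A (mprod N B B')) A'"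
      by (simp add: mprod_assoc)
    have "mcong q N (mprod N (mprod N A (mprod N B B')) A') (mprod N (mprod N A mone) A')"
      by (intro mcong_mprod mcong_refl that)
    also have "mcong q N \<dots> (mprod N A A')"
      by (intro mcong_mprod mcong_refl mprod_one)
    also note that(1)
    finally show ?thesis unfolding eq .
  qed
  show ?thesis using assms * unfolding minverses_def by blast
qed

lemma mequiv_refl: "mcong q N X Y \<Longrightarrow> mequiv q N X Y"
proof -
  assume *: "mcong q N X Y"
  have "mcong q N (mprod N (mprod N mone Y) mone) Y"
    using mprod_one mcong_trans by blast
  then have "mcong q N X (mprod N (mprod N mone Y) mone)" using * mcong_sym mcong_trans by blast
  then show ?thesis unfolding mequiv_def using minverses_mone by blast
qed

lemma mequiv_trans [trans]:
  assumes "mequiv q N X Y" "mequiv q N Y Z"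
  shows "mequiv q N X Z"
proof -
  obtain U U' V V' where 1: "minverses q N U U'" "minverses q N V V'" "mcong q N X (mprod N (mprod N U Y) V)"
    using assms(1) unfolding mequiv_def by blast
  obtain A A' B B' where 2: "minverses q N A A'" "minverses q N B B'" "mcong q N Y (mprod N (mprod N A Z) B)"
    using assms(2) unfolding mequiv_def by blast
  note 1(3)
  also have "mcong q N (mprod N (mprod N U Y) V) (mprod N (mprod N U (mprod N (mprod N A Z) B)) V)"
    by (intro mcong_mprod mcong_refl 2)
  also have "\<dots> = mprod N (mprod N (mprod N U A) Z) (mprod N B V)" by (simp add: mprod_assoc)
  finally show ?thesis
    unfolding mequiv_def using minverses_mprod[OF 1(1) 2(1)] minverses_mprod[OF 2(2) 1(2)] by blast
qed

lemma mequiv_mtr: "mequiv q N X Y \<Longrightarrow> mequiv q N (mtr X) (mtr Y)"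
proof -
  assume "mequiv q N X Y"
  then obtain U U' V V' where 1: "minverses q N U U'" "minverses q N V V'" "mcong q N X (mprod N (mprod N U Y) V)"
    unfolding mequiv_def by blast
  then have "mcong q N (mtr X) (mtr (mprod N (mprod N U Y) V))" by simp
  then have "mcong q N (mtr X) (mprod N (mprod N (mtr V) (mtr Y)) (mtr U))"
    by (simp add: mtr_mprod mprod_assoc)
  then show ?thesis unfolding mequiv_def using 1 minverses_mtr by blast
qed

lemma mequiv_left:
  assumes "minverses q N U U'"
  shows "mequiv q N X (mprod N U' X)"
proof -
  have "mcong q N (mprod N (mprod N U (mprod N U' X)) mone) (mprod N (mprod N (mprod N U U') X) mone)"
    by (simp add: mprod_assoc)
  also have "mcong q N \<dots> (mprod N (mprod N U U') X)" by (rule mprod_one)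
  also have "mcong q N \<dots> (mprod N mone X)"
    using assms unfolding minverses_def by (intro mcong_mprod mcong_refl) auto
  also have "mcong q N \<dots> X" by (rule mprod_one)
  finally show ?thesis unfolding mequiv_def using assms minverses_mone mcong_sym by blast
qed

text \<open>One matrix adds multiples of row s to all rows at once. Because of c s = 0, row s itself
  is unchanged, so adding and subtracting are mutually inverse.\<close>

lemma mequiv_row_add:
  assumes "s < N" "c s = 0"
  shows "mequiv q N X (\<lambda>(i, j). X (i, j) + c i * X (s, j))"
proof -
  define E where "E e = (\<lambda>(i, j). (if i = j then 1 else 0) + (if j = s then e * c i else 0))" for e :: int
  have E: "mprod N (E e) A (i, j) = A (i, j) + e * c i * A (s, j)" if "i < N" for e A i j
    using that assms(1) by (simp add: E_def mprod_def distrib_right sum.distrib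
        if_distrib[of "\<lambda>x. x * _"] sum.delta sum.delta' cong: if_cong)
  have "minverses q N (E (-1)) (E 1)"
    unfolding minverses_def mcong_def using assms by (auto simp: E) (auto simp: E_def mone_def)
  then have "mequiv q N X (mprod N (E 1) X)" by (rule mequiv_left)
  moreover have "mcong q N (mprod N (E 1) X) (\<lambda>(i, j). X (i, j) + c i * X (s, j))"
    by (simp add: mcong_def E)
  ultimately show ?thesis using mequiv_refl mequiv_trans by blast
qed

text \<open>Row a is moved to position s and multiplied by u' in a single step, so that the unit
  part of a pivot is removed together with the swap. The plain swap is the case u = u' = 1.\<close>

lemma mequiv_row_swap:
  assumes "s < N" "a < N" and u: "[u * u' = 1] (mod q)"
  shows "mequiv q N X (\<lambda>(i, j). (if i = s then u' else 1) * X (Transposition.transpose s a i, j))"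
proof -
  let ?t = "Transposition.transpose s a"
  define A where "A f = (\<lambda>(i, j). if j = ?t i then f i else 0 :: int)" for f :: "nat \<Rightarrow> int"
  have t: "?t i < N" if "i < N" for i using that assms by (auto simp: Transposition.transpose_def)
  have A: "mprod N (A f) B (i, j) = f i * B (?t i, j)" if "i < N" for f B i j
    using t[OF that] by (simp add: A_def mprod_def if_distrib[of "\<lambda>x. x * _"] sum.delta sum.delta' cong: if_cong)
  have AA: "mprod N (A f) (A g) (i, j) = (if i = j then f i * g (?t i) else 0)" if "i < N" for f g i j
    unfolding A[OF that] by (simp add: A_def)
  have "minverses q N (A (\<lambda>i. if ?t i = s then u else 1)) (A (\<lambda>i. if i = s then u' else 1))"
    unfolding minverses_def mcong_def using u by (simp add: AA mone_def mult.commute)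
  then have "mequiv q N X (mprod N (A (\<lambda>i. if i = s then u' else 1)) X)" by (rule mequiv_left)
  moreover have "mcong q N (mprod N (A (\<lambda>i. if i = s then u' else 1)) X) (\<lambda>(i, j). (if i = s then u' else 1) * X (?t i, j))"
    by (simp add: mcong_def A)
  ultimately show ?thesis using mequiv_refl mequiv_trans by blast
qed

text \<open>The last clause serves twice: the pivot p^m divides every entry that has to be cleared,
  and all later exponents are at least m, which makes the exponents weakly increasing.\<close>

definition partial_snf :: "nat \<Rightarrow> nat \<Rightarrow> nat \<Rightarrow> nat \<Rightarrow> nat \<Rightarrow> (nat \<Rightarrow> nat) \<Rightarrow> imat \<Rightarrow> bool" where
  "partial_snf p n N s m l Y \<longleftrightarrow>
     (\<forall>i<N. \<forall>j<N. (i < s \<or> j < s) \<longrightarrow> i \<noteq> j \<longrightarrow> [Y (i, j) = 0] (mod int p ^ n)) \<and>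
     (\<forall>i<s. [Y (i, i) = int p ^ l i] (mod int p ^ n)) \<and>
     (\<forall>i<N. \<forall>j<N. s \<le> i \<longrightarrow> s \<le> j \<longrightarrow> int p ^ m dvd Y (i, j))"

lemma partial_snf_mtr: "partial_snf p n N s m l Y \<Longrightarrow> partial_snf p n N s m l (mtr Y)"
  unfolding partial_snf_def mtr_def by auto

text \<open>Rows are cleared by applying this to the transpose. That row s stays unchanged is then
  essential: in the transposed matrix it is the column cleared before, which remains zero.\<close>

lemma clear_column:
  assumes Y: "partial_snf p n N s m l Y" and s: "s < N" and piv: "[Y (s, s) = int p ^ m] (mod int p ^ n)"
  obtains Y' where "mequiv (int p ^ n) N Y Y'" "partial_snf p n N s m l Y'"
    "\<And>j. Y' (s, j) = Y (s, j)" "\<And>i. s < i \<Longrightarrow> i < N \<Longrightarrow> [Y' (i, s) = 0] (mod int p ^ n)"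
proof -
  define c where "c i = (if s < i then - (Y (i, s) div int p ^ m) else 0)" for i
  define Y' where "Y' = (\<lambda>(i, j). Y (i, j) + c i * Y (s, j))"
  have c0: "c i = 0" if "i \<le> s" for i using that by (simp add: c_def)
  show ?thesis
  proof
    show "mequiv (int p ^ n) N Y Y'"
      unfolding Y'_def by (rule mequiv_row_add[OF s]) (simp add: c0)
    show "Y' (s, j) = Y (s, j)" for j by (simp add: Y'_def c0)
    show "[Y' (i, s) = 0] (mod int p ^ n)" if "s < i" "i < N" for i
    proof -
      have "int p ^ m dvd Y (i, s)" using Y that s unfolding partial_snf_def by auto
      then have "Y (i, s) + c i * int p ^ m = 0" using that by (simp add: c_def)
      moreover have "[Y' (i, s) = Y (i, s) + c i * int p ^ m] (mod int p ^ n)"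
        using piv by (simp add: Y'_def cong_add cong_scalar_left)
      ultimately show ?thesis by simp
    qed
    show "partial_snf p n N s m l Y'"
      unfolding partial_snf_def
    proof (intro conjI allI impI)
      fix i j assume ij: "i < N" "j < N" "i < s \<or> j < s" "i \<noteq> j"
      then have 1: "[Y (i, j) = 0] (mod int p ^ n)" using Y unfolding partial_snf_def by blast
      show "[Y' (i, j) = 0] (mod int p ^ n)"
      proof (cases "i \<le> s")
        case False
        then have "j < s" using ij by auto
        then have "[Y (s, j) = 0] (mod int p ^ n)" using Y s unfolding partial_snf_def by auto
        then have "[Y (i, j) + c i * Y (s, j) = 0 + c i * 0] (mod int p ^ n)"
          using 1 by (intro cong_add cong_mult) auto
        then show ?thesis by (simp add: Y'_def)
      qed (use 1 in \<open>simp add: Y'_def c0\<close>)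
    next
      fix i assume "i < s"
      then show "[Y' (i, i) = int p ^ l i] (mod int p ^ n)"
        using Y s unfolding partial_snf_def by (simp add: Y'_def c0)
    next
      fix i j assume "i < N" "j < N" "s \<le> i" "s \<le> j"
      then have "int p ^ m dvd Y (i, j)" "int p ^ m dvd Y (s, j)"
        using Y s unfolding partial_snf_def by auto
      then show "int p ^ m dvd Y' (i, j)" by (simp add: Y'_def)
    qed
  qed
qed

lemma mequiv_col_swap:
  assumes "s < N" "b < N"
  shows "mequiv q N X (\<lambda>(i, j). X (i, Transposition.transpose s b j))"
  using mequiv_mtr[OF mequiv_row_swap[OF assms, of 1 1 q "mtr X"]]
  by (simp add: mtr_def case_prod_beta' cong: if_cong)

lemma partial_snf_swap:
  assumes Y: "partial_snf p n N s m l Y" and "s < N" "a < N" "s \<le> a"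
  shows "partial_snf p n N s m l (\<lambda>(i, j). (if i = s then u' else 1) * Y (Transposition.transpose s a i, j))"
  unfolding partial_snf_def
proof (intro conjI allI impI)
  fix i j assume ij: "i < N" "j < N" "i < s \<or> j < s" "i \<noteq> j"
  let ?i = "Transposition.transpose s a i"
  have "?i < N" "?i < s \<or> j < s" "?i \<noteq> j" using ij assms by (auto simp: Transposition.transpose_def)
  then have "[Y (?i, j) = 0] (mod int p ^ n)" using Y ij unfolding partial_snf_def by blast
  then have "[(if i = s then u' else 1) * Y (?i, j) = (if i = s then u' else 1) * 0] (mod int p ^ n)"
    by (intro cong_mult cong_refl)
  then show "[(\<lambda>(i, j). (if i = s then u' else 1) * Y (Transposition.transpose s a i, j)) (i, j) = 0] (mod int p ^ n)" by simp
next
  fix i assume "i < s"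
  then show "[(\<lambda>(i, j). (if i = s then u' else 1) * Y (Transposition.transpose s a i, j)) (i, i) = int p ^ l i] (mod int p ^ n)"
    using Y assms unfolding partial_snf_def by (auto simp: Transposition.transpose_def)
next
  fix i j assume ij: "i < N" "j < N" "s \<le> i" "s \<le> j"
  then have "Transposition.transpose s a i < N" "s \<le> Transposition.transpose s a i" using assms by (auto simp: Transposition.transpose_def)
  then show "int p ^ m dvd (\<lambda>(i, j). (if i = s then u' else 1) * Y (Transposition.transpose s a i, j)) (i, j)"
    using Y ij unfolding partial_snf_def by simp
qed

lemma snf_step:
  assumes p: "prime p" and Y: "partial_snf p n N s m l Y" and s: "s < N" and m: "m \<le> n"
  obtains Y' m' where "mequiv (int p ^ n) N Y Y'" "m \<le> m'" "m' \<le> n" "partial_snf p n N (Suc s) m' (l(s := m')) Y'"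
proof -
  let ?q = "int p ^ n"
  \<comment> \<open>Valuations in the remaining block are capped at n, so D has a maximum even if
    the block vanishes modulo p^n; in that case p^n, which is 0 modulo p^n, serves as the
    pivot.\<close>
  define D where "D = {t. t \<le> n \<and> (\<forall>i<N. \<forall>j<N. s \<le> i \<longrightarrow> s \<le> j \<longrightarrow> int p ^ t dvd Y (i, j))}"
  have "finite D" by (rule finite_subset[of _ "{..n}"]) (auto simp: D_def)
  have "m \<in> D" using Y m by (auto simp: D_def partial_snf_def)
  define m' where "m' = Max D"
  have m': "m' \<in> D" "m \<le> m'" using \<open>finite D\<close> \<open>m \<in> D\<close> unfolding m'_def by (auto intro: Max_in)
  have Ym': "partial_snf p n N s m' l Y"
    using Y m' unfolding partial_snf_def D_def by auto
  show ?thesis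
  proof (cases "m' = n")
    case True
    have zero: "[Y (i, j) = 0] (mod ?q)" if "i < N" "j < N" "s \<le> i" "s \<le> j" for i j
      using Ym' that by (auto simp: partial_snf_def True cong_0_iff)
    have "partial_snf p n N (Suc s) m' (l(s := m')) Y"
      unfolding partial_snf_def
    proof (intro conjI allI impI)
      fix i j assume "i < N" "j < N" "i < Suc s \<or> j < Suc s" "i \<noteq> j"
      then show "[Y (i, j) = 0] (mod ?q)"
        using zero[of i j] Y unfolding partial_snf_def by (metis not_less)
    next
      fix i assume "i < Suc s"
      show "[Y (i, i) = int p ^ (l(s := m')) i] (mod ?q)"
      proof (cases "i = s")
        case True
        have "[int p ^ m' = 0] (mod ?q)" using \<open>m' = n\<close> by (simp add: cong_0_iff)
        then show ?thesis using zero[of s s] s True by (simp add: cong_def)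
      next
        case False
        then show ?thesis using \<open>i < Suc s\<close> Y unfolding partial_snf_def by auto
      qed
    next
      fix i j assume "i < N" "j < N" "Suc s \<le> i" "Suc s \<le> j"
      then show "int p ^ m' dvd Y (i, j)" using Ym' unfolding partial_snf_def by auto
    qed
    then show ?thesis using that[OF mequiv_refl[OF mcong_refl]] m' True by auto
  next
    case False
    then have lt: "m' < n" using m' by (auto simp: D_def)
    \<comment> \<open>Maximality provides an entry of valuation exactly m'; its unit part u is
      invertible modulo p^n.\<close>
    have "Suc m' \<notin> D" using Max_ge[OF \<open>finite D\<close>, of "Suc m'"] unfolding m'_def by auto
    then obtain a b where ab: "a < N" "b < N" "s \<le> a" "s \<le> b" "\<not> int p ^ Suc m' dvd Y (a, b)"
      using lt unfolding D_def by auto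
    have "int p ^ m' dvd Y (a, b)" using Ym' ab unfolding partial_snf_def by blast
    then obtain u where u: "Y (a, b) = int p ^ m' * u" by blast
    then have "\<not> int p dvd u" using ab by (auto simp: mult.commute)
    then have "coprime u ?q"
      using p by (metis coprime_commute coprime_power_right_iff prime_imp_coprime prime_nat_int_transfer)
    then obtain u' where u': "[u * u' = 1] (mod ?q)" using cong_solve_coprime_int by blast
    define Y1 where "Y1 = (\<lambda>(i, j). (if i = s then u' else 1) * Y (Transposition.transpose s a i, j))"
    define Y2 where "Y2 = (\<lambda>(i, j). Y1 (i, Transposition.transpose s b j))"
    have e1: "mequiv ?q N Y Y1" unfolding Y1_def using s ab u' by (intro mequiv_row_swap) auto
    have e2: "mequiv ?q N Y1 Y2" unfolding Y2_def using s ab by (intro mequiv_col_swap) auto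
    have s1: "partial_snf p n N s m' l Y1" unfolding Y1_def using s ab by (intro partial_snf_swap Ym') auto
    have "Y2 = mtr (\<lambda>(i, j). (if i = s then 1 else 1) * mtr Y1 (Transposition.transpose s b i, j))"
      by (auto simp: Y2_def mtr_def)
    then have s2: "partial_snf p n N s m' l Y2"
      using partial_snf_mtr[OF partial_snf_swap[OF partial_snf_mtr[OF s1] s ab(2) ab(4), of 1]] by simp
    have "Y2 (s, s) = int p ^ m' * (u * u')" by (simp add: Y2_def Y1_def u)
    then have piv: "[Y2 (s, s) = int p ^ m'] (mod ?q)"
      using cong_mult[OF cong_refl[of "int p ^ m'"] u'] by simp
    obtain Y3 where Y3: "mequiv ?q N Y2 Y3" "partial_snf p n N s m' l Y3"
      "\<And>j. Y3 (s, j) = Y2 (s, j)" "\<And>i. s < i \<Longrightarrow> i < N \<Longrightarrow> [Y3 (i, s) = 0] (mod ?q)"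
      using clear_column[OF s2 s piv] by blast
    have "[mtr Y3 (s, s) = int p ^ m'] (mod ?q)" using piv Y3(3) by (simp add: mtr_def)
    then obtain Z where Z: "mequiv ?q N (mtr Y3) Z" "partial_snf p n N s m' l Z"
      "\<And>j. Z (s, j) = mtr Y3 (s, j)" "\<And>i. s < i \<Longrightarrow> i < N \<Longrightarrow> [Z (i, s) = 0] (mod ?q)"
      using clear_column[OF partial_snf_mtr[OF Y3(2)] s] by blast
    have eZ: "mequiv ?q N Y3 (mtr Z)" using mequiv_mtr[OF Z(1)] by simp
    have row: "[Z (s, j) = 0] (mod ?q)" if "s < j" "j < N" for j
      using Y3(4) that by (simp add: Z(3) mtr_def)
    have "partial_snf p n N (Suc s) m' (l(s := m')) Z"
      unfolding partial_snf_def
    proof (intro conjI allI impI)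
      fix i j assume ij: "i < N" "j < N" "i < Suc s \<or> j < Suc s" "i \<noteq> j"
      show "[Z (i, j) = 0] (mod ?q)"
      proof (cases "i < s \<or> j < s")
        case True
        then show ?thesis using Z(2) ij unfolding partial_snf_def by blast
      next
        case False
        then have "i = s \<and> s < j \<or> j = s \<and> s < i" using ij by auto
        then show ?thesis using ij row[of j] Z(4)[of i] by auto
      qed
    next
      fix i assume "i < Suc s"
      then show "[Z (i, i) = int p ^ (l(s := m')) i] (mod ?q)"
      proof (cases "i = s")
        case True
        then show ?thesis using piv by (simp add: Z(3) Y3(3) mtr_def)
      next
        case False
        then show ?thesis using Z(2) \<open>i < Suc s\<close> unfolding partial_snf_def by simp
      qed
    next
      fix i j assume "i < N" "j < N" "Suc s \<le> i" "Suc s \<le> j"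
      then show "int p ^ m' dvd Z (i, j)" using Z(2) unfolding partial_snf_def by auto
    qed
    then have "partial_snf p n N (Suc s) m' (l(s := m')) (mtr Z)" by (rule partial_snf_mtr)
    moreover have "mequiv ?q N Y (mtr Z)"
      by (rule mequiv_trans[OF mequiv_trans[OF e1 e2] mequiv_trans[OF Y3(1) eZ]])
    ultimately show ?thesis by (intro that[of "mtr Z" m'] m'(2) less_imp_le[OF lt])
  qed
qed

lemma snf_mod_prime_power:
  assumes p: "prime p"
  obtains l where "mequiv (int p ^ n) N X (mdiag p l)" "\<And>i. i < N \<Longrightarrow> l i \<le> n"
    "\<And>i j. i \<le> j \<Longrightarrow> j < N \<Longrightarrow> l i \<le> l j"
proof -
  have "\<exists>Y l m. mequiv (int p ^ n) N X Y \<and> m \<le> n \<and> (\<forall>i<s. l i \<le> m) \<and> (\<forall>j<s. \<forall>i\<le>j. l i \<le> l j) \<and>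
     partial_snf p n N s m l Y" if "s \<le> N" for s
    using that
  proof (induction s)
    case 0
    have "mequiv (int p ^ n) N X X" by (simp add: mequiv_refl)
    moreover have "partial_snf p n N 0 0 (\<lambda>_. 0) X" by (simp add: partial_snf_def)
    ultimately show ?case by blast
  next
    case (Suc s)
    then obtain Y l m where Y: "mequiv (int p ^ n) N X Y" "m \<le> n" "\<forall>i<s. l i \<le> m" "\<forall>j<s. \<forall>i\<le>j. l i \<le> l j"
     "partial_snf p n N s m l Y" by auto
    obtain Y' m' where Y': "mequiv (int p ^ n) N Y Y'" "m \<le> m'" "m' \<le> n" "partial_snf p n N (Suc s) m' (l(s := m')) Y'"
      using snf_step[OF p Y(5) _ Y(2)] Suc.prems by auto
    have le: "l i \<le> m'" if "i < s" for i using Y(3) Y'(2) that order_trans by blast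
    have "\<forall>i<Suc s. (l(s := m')) i \<le> m'" using le by (auto simp: less_Suc_eq)
    moreover have "\<forall>j<Suc s. \<forall>i\<le>j. (l(s := m')) i \<le> (l(s := m')) j"
      using le Y(4) by (auto simp: less_Suc_eq)
    ultimately show ?case using mequiv_trans[OF Y(1) Y'(1)] Y'(3,4) by blast
  qed
  from this[of N] obtain Y l m where Y: "mequiv (int p ^ n) N X Y" "m \<le> n" "\<forall>i<N. l i \<le> m" "\<forall>j<N. \<forall>i\<le>j. l i \<le> l j"
     "partial_snf p n N N m l Y" by auto
  have "mcong (int p ^ n) N Y (mdiag p l)"
    using Y(5) unfolding partial_snf_def mcong_def mdiag_def by auto
  then have "mequiv (int p ^ n) N X (mdiag p l)" using Y(1) mequiv_refl mequiv_trans by blast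
  moreover have "l i \<le> n" if "i < N" for i using Y(2,3) that order_trans by blast
  ultimately show ?thesis using that Y(4) by blast
qed

section \<open>Smith normal form over the p-adic integers\<close>

definition vecmul :: "nat \<Rightarrow> (nat \<Rightarrow> int) \<Rightarrow> imat \<Rightarrow> (nat \<Rightarrow> int)" where
  "vecmul N y A = (\<lambda>j. \<Sum>i<N. y i * A (i, j))"

definition vcong :: "int \<Rightarrow> nat \<Rightarrow> (nat \<Rightarrow> int) \<Rightarrow> (nat \<Rightarrow> int) \<Rightarrow> bool" where
  "vcong q N y z \<longleftrightarrow> (\<forall>i<N. [y i = z i] (mod q))"

lemma vcong_trans [trans]: "vcong q N x y \<Longrightarrow> vcong q N y z \<Longrightarrow> vcong q N x z"
  unfolding vcong_def by (blast intro: cong_trans)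

lemma vcong_sym: "vcong q N x y \<Longrightarrow> vcong q N y x"
  unfolding vcong_def by (blast intro: cong_sym)

lemma vcong_refl [simp]: "vcong q N x x"
  by (simp add: vcong_def)

lemma vcong_vecmul: "vcong q N y z \<Longrightarrow> mcong q N A B \<Longrightarrow> vcong q N (vecmul N y A) (vecmul N z B)"
  unfolding vcong_def mcong_def vecmul_def by (auto intro!: cong_sum cong_mult)

lemma vecmul_mprod: "vecmul N y (mprod N A B) = vecmul N (vecmul N y A) B"
proof
  fix j
  have "(\<Sum>i<N. y i * (\<Sum>l<N. A (i, l) * B (l, j))) = (\<Sum>l<N. (\<Sum>i<N. y i * A (i, l)) * B (l, j))"
    unfolding sum_distrib_left sum_distrib_right by (subst sum.swap) (simp add: mult_ac)
  then show "vecmul N y (mprod N A B) j = vecmul N (vecmul N y A) B j"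
    by (simp add: vecmul_def mprod_def)
qed

lemma vecmul_mone: "vcong q N (vecmul N y mone) y"
  by (auto simp: vcong_def vecmul_def mone_def if_distrib[of "\<lambda>x. _ * x"] sum.delta sum.delta' cong: if_cong)

lemma vecmul_minverses:
  assumes "minverses q N U U'"
  shows "vcong q N (vecmul N (vecmul N y U) U') y"
proof -
  have "vcong q N (vecmul N y (mprod N U U')) (vecmul N y mone)"
    using assms unfolding minverses_def by (intro vcong_vecmul) auto
  also note vecmul_mone
  finally show ?thesis by (simp add: vecmul_mprod)
qed

lemma vecmul_zero: "vcong q N (vecmul N (\<lambda>_. 0) A) (\<lambda>_. 0)"
  by (simp add: vcong_def vecmul_def)

lemma left_ker_column_set:
  "left_ker p n {..<N} (column_set N X) =
     {y \<in> {..<N} \<rightarrow>\<^sub>E {0..<int p ^ n}. vcong (int p ^ n) N (vecmul N y X) (\<lambda>_. 0)}"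
  by (auto simp: left_ker_def column_set_def vcong_def vecmul_def cong_0_iff)

lemma vcong_zero_mequiv:
  assumes U: "minverses q N U U'" and V: "minverses q N V V'" and X: "mcong q N X (mprod N (mprod N U Y) V)"
  shows "vcong q N (vecmul N y X) (\<lambda>_. 0) \<longleftrightarrow> vcong q N (vecmul N (vecmul N y U) Y) (\<lambda>_. 0)"
proof -
  let ?z = "vecmul N (vecmul N y U) Y"
  have e: "vcong q N (vecmul N y X) (vecmul N ?z V)"
    using vcong_vecmul[OF vcong_refl X, of y] by (simp add: vecmul_mprod)
  show ?thesis
  proof
    assume "vcong q N (vecmul N y X) (\<lambda>_. 0)"
    then have 0: "vcong q N (vecmul N ?z V) (\<lambda>_. 0)" using e vcong_sym vcong_trans by blast
    have "vcong q N ?z (vecmul N (vecmul N ?z V) V')"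
      by (rule vcong_sym[OF vecmul_minverses[OF V]])
    also have "vcong q N \<dots> (vecmul N (\<lambda>_. 0) V')" using 0 by (intro vcong_vecmul) auto
    also note vecmul_zero
    finally show "vcong q N ?z (\<lambda>_. 0)" .
  next
    assume 0: "vcong q N ?z (\<lambda>_. 0)"
    note e
    also have "vcong q N (vecmul N ?z V) (vecmul N (\<lambda>_. 0) V)" using 0 by (intro vcong_vecmul) auto
    also note vecmul_zero
    finally show "vcong q N (vecmul N y X) (\<lambda>_. 0)" .
  qed
qed

text \<open>The map y \<mapsto> y U, reduced modulo p^n, carries one kernel onto the other, with
  inverse given by U'. The right factor V is invertible and does not affect whether a product
  vanishes.\<close>

lemma card_left_ker_mequiv:
  assumes "mequiv (int p ^ n) N X Y" and p: "p > 0"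
  shows "card (left_ker p n {..<N} (column_set N X)) = card (left_ker p n {..<N} (column_set N Y))"
proof -
  let ?q = "int p ^ n"
  have q: "?q > 0" using p by simp
  obtain U U' V V' where U: "minverses ?q N U U'" and V: "minverses ?q N V V'"
    and X: "mcong ?q N X (mprod N (mprod N U Y) V)"
    using assms(1) unfolding mequiv_def by blast
  note Z = vcong_zero_mequiv[OF U V X]
  let ?f = "\<lambda>A y. \<lambda>i\<in>{..<N}. vecmul N y A i mod ?q"
  have f: "vcong ?q N (?f A y) (vecmul N y A)" for A y by (auto simp: vcong_def cong_def)
  have fE: "?f A y \<in> {..<N} \<rightarrow>\<^sub>E {0..<?q}" for A y using q by auto
  have ff: "?f B (?f A y) = y" if "minverses ?q N A B" "y \<in> {..<N} \<rightarrow>\<^sub>E {0..<?q}" for A B y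
  proof -
    have "vcong ?q N (?f B (?f A y)) (vecmul N (?f A y) B)" by (rule f)
    also have "vcong ?q N \<dots> (vecmul N (vecmul N y A) B)" by (intro vcong_vecmul f mcong_refl)
    also have "vcong ?q N \<dots> y" by (rule vecmul_minverses[OF that(1)])
    finally have c: "[?f B (?f A y) i = y i] (mod ?q)" if "i < N" for i
      using that unfolding vcong_def by blast
    show ?thesis
    proof (rule PiE_ext[OF fE that(2)])
      fix i assume "i \<in> {..<N}"
      then show "?f B (?f A y) i = y i"
        using c[of i] fE[of "?f A y" B] that(2) by (intro cong_less_imp_eq_int[of _ ?q]) (auto simp: PiE_iff)
    qed
  qed
  have k: "vcong ?q N (vecmul N (?f U y) Y) (\<lambda>_. 0) \<longleftrightarrow> vcong ?q N (vecmul N y X) (\<lambda>_. 0)" for y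
  proof -
    have "vcong ?q N (?f U y) (vecmul N y U)" by (rule f)
    then have "vcong ?q N (vecmul N (?f U y) Y) (vecmul N (vecmul N y U) Y)"
      by (rule vcong_vecmul) simp
    then show ?thesis unfolding Z using vcong_sym vcong_trans by blast
  qed
  have "bij_betw (?f U) (left_ker p n {..<N} (column_set N X)) (left_ker p n {..<N} (column_set N Y))"
    unfolding left_ker_column_set
  proof (rule bij_betw_byWitness[where f' = "?f U'"], goal_cases)
    case 1
    then show ?case using ff[OF U] by blast
  next
    case 2
    then show ?case using ff[OF minverses_sym[OF U]] by blast
  next
    case 3
    show ?case using k fE by blast
  next
    case 4
    show ?case
    proof (intro image_subsetI CollectI conjI fE)
      fix y assume "y \<in> {y \<in> {..<N} \<rightarrow>\<^sub>E {0..<?q}. vcong ?q N (vecmul N y Y) (\<lambda>_. 0)}"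
      then show "vcong ?q N (vecmul N (?f U' y) X) (\<lambda>_. 0)"
        using k[of "?f U' y"] ff[OF minverses_sym[OF U], of y] by auto
    qed
  qed
  then show ?thesis by (rule bij_betw_same_card)
qed

text \<open>The conditions decouple: y i has to be divisible by p ^ (n - l i), which leaves p ^ l i
  residues modulo p^n.\<close>

lemma card_left_ker_mdiag:
  assumes l: "\<And>i. i < N \<Longrightarrow> l i \<le> n" and p: "p > 0"
  shows "card (left_ker p n {..<N} (column_set N (mdiag p l))) = p ^ (\<Sum>i<N. l i)"
proof -
  let ?S = "\<lambda>i. {x \<in> {0..<int p ^ n}. int p ^ n dvd x * int p ^ l i}"
  have "vecmul N y (mdiag p l) j = y j * int p ^ l j" if "j < N" for y j
    using that by (simp add: vecmul_def mdiag_def if_distrib[of "\<lambda>x. _ * x"] cong: if_cong)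
  then have "left_ker p n {..<N} (column_set N (mdiag p l)) = Pi\<^sub>E {..<N} ?S"
    unfolding left_ker_column_set by (auto simp: vcong_def cong_0_iff PiE_iff extensional_def)
  moreover have "card (?S i) = p ^ l i" if "i < N" for i
  proof -
    have e: "int p ^ n = int p ^ (n - l i) * int p ^ l i" using l[OF that] by (simp flip: power_add)
    have "?S i = {x \<in> {0..<int p ^ (n - l i) * int p ^ l i}. int p ^ (n - l i) dvd x}"
      unfolding e using p by simp
    then show ?thesis using card_multiples[of "int p ^ (n - l i)" "int p ^ l i"] p
      by (simp add: nat_power_eq)
  qed
  ultimately show ?thesis by (simp add: card_PiE power_sum)
qed

section \<open>Inverse limits of finite sets\<close>

fun descend :: "(nat \<Rightarrow> 'a \<Rightarrow> 'a) \<Rightarrow> nat \<Rightarrow> nat \<Rightarrow> 'a \<Rightarrow> 'a" where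
  "descend f n 0 x = x"
| "descend f n (Suc m) x = f n (descend f (Suc n) m x)"

lemma descend_Suc_right: "descend f n (Suc m) x = descend f n m (f (n + m) x)"
  by (induction m arbitrary: n) auto

text \<open>If every x in S failed at some stage, no x in S would survive the maximum of these
  finitely many stages.\<close>

lemma finite_antimono_choice:
  assumes "finite S" and ex: "\<And>m::nat. \<exists>x\<in>S. P m x" and anti: "\<And>m x. P (Suc m) x \<Longrightarrow> P m x"
  shows "\<exists>x\<in>S. \<forall>m. P m x"
proof (rule ccontr)
  assume "\<not> ?thesis"
  then obtain g where g: "\<And>x. x \<in> S \<Longrightarrow> \<not> P (g x) x" by metis
  obtain x where x: "x \<in> S" "P (Max (insert 0 (g ` S))) x" using ex by blast
  have "P (a + b) x \<Longrightarrow> P a x" for a b by (induction b) (auto dest: anti)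
  moreover have "g x \<le> Max (insert 0 (g ` S))" using x \<open>finite S\<close> by auto
  ultimately have "P (g x) x" using x(2) by (metis le_Suc_ex)
  then show False using g x by blast
qed

text \<open>Koenig's lemma. \<open>G n x\<close> says that x is the image of elements at every
  higher level. By \<open>finite_antimono_choice\<close> some x at level 0 has this property, and
  every such x has a preimage at the next level that has it too.\<close>

lemma inverse_limit_nonempty:
  fixes T :: "nat \<Rightarrow> 'a set"
  assumes fin: "\<And>n. finite (T n)" and ne: "\<And>n. T n \<noteq> {}"
    and f: "\<And>n x. x \<in> T (Suc n) \<Longrightarrow> f n x \<in> T n"
  obtains x where "\<And>n. x n \<in> T n" "\<And>n. f n (x (Suc n)) = x n"
proof -
  define G where "G n x \<longleftrightarrow> x \<in> T n \<and> (\<forall>m. \<exists>y\<in>T (n + m). descend f n m y = x)" for n x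
  have desc: "y \<in> T (n + m) \<Longrightarrow> descend f n m y \<in> T n" for n m y
    by (induction m arbitrary: n) (auto intro: f)
  have anti: "\<exists>y\<in>T (n + Suc m). descend f n (Suc m) y = x \<Longrightarrow> \<exists>y\<in>T (n + m). descend f n m y = x" for n m x
    unfolding descend_Suc_right using f by auto
  have "\<exists>x\<in>T 0. \<forall>m. \<exists>y\<in>T (0 + m). descend f 0 m y = x"
  proof (rule finite_antimono_choice[OF fin])
    fix m show "\<exists>x\<in>T 0. \<exists>y\<in>T (0 + m). descend f 0 m y = x"
      using ne[of "0 + m"] desc[of _ 0 m] by blast
  qed (rule anti)
  then have base: "\<exists>x. G 0 x" by (auto simp: G_def)
  have step: "\<exists>x'. G (Suc n) x' \<and> f n x' = x" if Gx: "G n x" for n x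
  proof -
    have "\<exists>x'\<in>{x' \<in> T (Suc n). f n x' = x}. \<forall>m. \<exists>y\<in>T (Suc n + m). descend f (Suc n) m y = x'"
    proof (rule finite_antimono_choice)
      fix m
      obtain y where "y \<in> T (n + Suc m)" "descend f n (Suc m) y = x" using Gx unfolding G_def by blast
      then show "\<exists>x'\<in>{x' \<in> T (Suc n). f n x' = x}. \<exists>y\<in>T (Suc n + m). descend f (Suc n) m y = x'"
        using desc[of y "Suc n" m] by auto
    next
      show "\<exists>y\<in>T (Suc n + Suc m). descend f (Suc n) (Suc m) y = x' \<Longrightarrow> \<exists>y\<in>T (Suc n + m). descend f (Suc n) m y = x'" for m x'
        by (rule anti)
    qed (use fin in simp)
    then show ?thesis by (auto simp: G_def)
  qed
  obtain x where x: "\<And>n. G n (x n)" "\<And>n. f n (x (Suc n)) = x n"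
    using dependent_nat_choice[of G "\<lambda>n a b. f n b = a"] base step by metis
  show ?thesis using that[of x] x by (auto simp: G_def)
qed

definition mred :: "int \<Rightarrow> nat \<Rightarrow> imat \<Rightarrow> imat" where
  "mred q N A = (\<lambda>x\<in>{..<N} \<times> {..<N}. A x mod q)"

lemma mcong_mred: "mcong q N (mred q N A) A"
  by (auto simp: mcong_def mred_def)

lemma minverses_cong:
  assumes "minverses q N U U'" "mcong q N A U" "mcong q N A' U'"
  shows "minverses q N A A'"
  using assms mcong_mprod mcong_trans unfolding minverses_def by meson

lemma minverses_dvd: "minverses q N U U' \<Longrightarrow> q' dvd q \<Longrightarrow> minverses q' N U U'"
  unfolding minverses_def using mcong_dvd by blast

lemma mdiag_min: "mcong (int p ^ n) N (mdiag p (\<lambda>i. min (l i) n)) (mdiag p l)"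
proof -
  have "[int p ^ min k n = int p ^ k] (mod int p ^ n)" for k
    by (cases "k \<le> n") (auto simp: min_def cong_def mod_0_imp_dvd le_imp_power_dvd dvd_imp_mod_0)
  then show ?thesis by (simp add: mcong_def mdiag_def)
qed

text \<open>By compactness: the Smith factorizations modulo p^n form an inverse system of finite nonempty sets. The exponent n modulo p^n stands for every exponent that is at least n, infinity included.\<close>

lemma padic_snf:
  assumes p: "prime p" and X: "\<And>n. mcong (int p ^ n) N (X (Suc n)) (X n)"
  obtains U U' V V' :: "nat \<Rightarrow> imat" and l :: "nat \<Rightarrow> nat \<Rightarrow> nat" where
    "\<And>n. minverses (int p ^ n) N (U n) (U' n)" "\<And>n. minverses (int p ^ n) N (V n) (V' n)"
    "\<And>n. mcong (int p ^ n) N (X n) (mprod N (mprod N (U n) (mdiag p (l n))) (V n))"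
    "\<And>n. mcong (int p ^ n) N (U (Suc n)) (U n)" "\<And>n. mcong (int p ^ n) N (U' (Suc n)) (U' n)"
    "\<And>n. mcong (int p ^ n) N (V (Suc n)) (V n)" "\<And>n. mcong (int p ^ n) N (V' (Suc n)) (V' n)"
    "\<And>n i. i < N \<Longrightarrow> l n i = min (l (Suc n) i) n" "\<And>n i j. i \<le> j \<Longrightarrow> j < N \<Longrightarrow> l n i \<le> l n j"
proof -
  have p0: "p > 0" using prime_gt_0_nat[OF p] .
  define M where "M n = {..<N} \<times> {..<N} \<rightarrow>\<^sub>E {0..<int p ^ n}" for n
  have M: "mred (int p ^ n) N A \<in> M n" for n A using p0 by (auto simp: mred_def M_def)
  define good where "good n U U' V V' l \<longleftrightarrow> minverses (int p ^ n) N U U' \<and> minverses (int p ^ n) N V V' \<and>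
     mcong (int p ^ n) N (X n) (mprod N (mprod N U (mdiag p l)) V) \<and> (\<forall>j<N. \<forall>i\<le>j. l i \<le> l j)"
    for n U U' V V' and l :: "nat \<Rightarrow> nat"
  define T where "T n = {(U, U', V, V', l). U \<in> M n \<and> U' \<in> M n \<and> V \<in> M n \<and> V' \<in> M n \<and>
     l \<in> {..<N} \<rightarrow>\<^sub>E {..n} \<and> good n U U' V V' l}" for n
  define f where "f n = (\<lambda>(U, U', V, V', l). (mred (int p ^ n) N U, mred (int p ^ n) N U',
     mred (int p ^ n) N V, mred (int p ^ n) N V', \<lambda>i\<in>{..<N}. min (l i) n))" for n
  \<comment> \<open>Used twice: for factorizations found directly modulo p^n, to show that
    \<open>T n\<close> is nonempty, and for those modulo p^(n+1), to show that \<open>f n\<close> is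
    a transition map.\<close>
  have red: "f n (U, U', V, V', l) \<in> T n" if "good n U U' V V' l" for n U U' V V' l
  proof -
    let ?r = "mred (int p ^ n) N"
    let ?l = "\<lambda>i\<in>{..<N}. min (l i) n"
    have "minverses (int p ^ n) N (?r U) (?r U')" "minverses (int p ^ n) N (?r V) (?r V')"
      using that minverses_cong mcong_mred unfolding good_def by blast+
    moreover have "mcong (int p ^ n) N (X n) (mprod N (mprod N (?r U) (mdiag p ?l)) (?r V))"
    proof -
      have "mcong (int p ^ n) N (mdiag p ?l) (mdiag p (\<lambda>i. min (l i) n))" by (simp add: mcong_def mdiag_def)
      also note mdiag_min
      finally have "mcong (int p ^ n) N (mprod N (mprod N (?r U) (mdiag p ?l)) (?r V)) (mprod N (mprod N U (mdiag p l)) V)"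
        by (intro mcong_mprod mcong_mred)
      then show ?thesis using that mcong_sym mcong_trans unfolding good_def by blast
    qed
    moreover have "?l i \<le> ?l j" if "j < N" "i \<le> j" for i j
      using that \<open>good n U U' V V' l\<close> unfolding good_def by (auto simp: min_le_iff_disj)
    ultimately show ?thesis using M by (auto simp: T_def f_def good_def)
  qed
  have good_Suc: "good n U U' V V' l" if "good (Suc n) U U' V V' l" for n U U' V V' l
  proof -
    have d: "int p ^ n dvd int p ^ Suc n" by simp
    have "mcong (int p ^ n) N (X n) (mprod N (mprod N U (mdiag p l)) V)"
      using mcong_trans[OF mcong_sym[OF X]] mcong_dvd[OF _ d] that unfolding good_def by blast
    then show ?thesis using that minverses_dvd[OF _ d] unfolding good_def by blast
  qed
  have fin: "finite (T n)" for n
  proof (rule finite_subset)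
    show "T n \<subseteq> M n \<times> M n \<times> M n \<times> M n \<times> ({..<N} \<rightarrow>\<^sub>E {..n})" by (auto simp: T_def)
    show "finite (M n \<times> M n \<times> M n \<times> M n \<times> ({..<N} \<rightarrow>\<^sub>E {..n}))"
      unfolding M_def by (intro finite_cartesian_product finite_PiE) auto
  qed
  have ne: "T n \<noteq> {}" for n
  proof -
    obtain l where l: "mequiv (int p ^ n) N (X n) (mdiag p l)" "\<And>i. i < N \<Longrightarrow> l i \<le> n"
      "\<And>i j. i \<le> j \<Longrightarrow> j < N \<Longrightarrow> l i \<le> l j"
      by (rule snf_mod_prime_power[where n = n and N = N and X = "X n", OF p]) blast
    then obtain U U' V V' where "good n U U' V V' l" unfolding mequiv_def good_def by blast
    then have "f n (U, U', V, V', l) \<in> T n" by (rule red)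
    then show ?thesis by blast
  qed
  have fT: "f n x \<in> T n" if "x \<in> T (Suc n)" for n x
  proof -
    obtain U U' V V' l where x: "x = (U, U', V, V', l)" by (rule prod_cases5)
    then have "good (Suc n) U U' V V' l" using that by (simp add: T_def)
    then show ?thesis unfolding x by (rule red[OF good_Suc])
  qed
  obtain x where x: "\<And>n. x n \<in> T n" "\<And>n. f n (x (Suc n)) = x n"
    by (rule inverse_limit_nonempty[of T f, OF fin ne fT]) blast+
  define U where "U n = fst (x n)" for n
  define U' where "U' n = fst (snd (x n))" for n
  define V where "V n = fst (snd (snd (x n)))" for n
  define V' where "V' n = fst (snd (snd (snd (x n))))" for n
  define l where "l n = snd (snd (snd (snd (x n))))" for n
  have xn: "x n = (U n, U' n, V n, V' n, l n)" for n by (simp add: U_def U'_def V_def V'_def l_def)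
  have g: "good n (U n) (U' n) (V n) (V' n) (l n)" for n using x(1)[of n] by (simp add: T_def xn)
  have r: "mred (int p ^ n) N (U (Suc n)) = U n" "mred (int p ^ n) N (U' (Suc n)) = U' n"
    "mred (int p ^ n) N (V (Suc n)) = V n" "mred (int p ^ n) N (V' (Suc n)) = V' n"
    "(\<lambda>i\<in>{..<N}. min (l (Suc n) i) n) = l n" for n
    using x(2)[of n] by (simp_all add: f_def xn)
  have c: "mcong q N A (mred q N A)" for q A by (rule mcong_sym[OF mcong_mred])
  show ?thesis
  proof (rule that[of U U' V V' l])
    show "mcong (int p ^ n) N (U (Suc n)) (U n)" "mcong (int p ^ n) N (U' (Suc n)) (U' n)"
      "mcong (int p ^ n) N (V (Suc n)) (V n)" "mcong (int p ^ n) N (V' (Suc n)) (V' n)" for n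
      using c[of "int p ^ n" "U (Suc n)", unfolded r] c[of "int p ^ n" "U' (Suc n)", unfolded r]
        c[of "int p ^ n" "V (Suc n)", unfolded r] c[of "int p ^ n" "V' (Suc n)", unfolded r] by blast+
    show "l n i = min (l (Suc n) i) n" if "i < N" for n i using fun_cong[OF r(5)[of n], of i] that by simp
  qed (use g in \<open>auto simp: good_def\<close>)
qed

section \<open>Integral approximations of p-adic numbers\<close>

text \<open>For x in p^(-a) Z_p, this is the residue of p^a x modulo p^t; of_approx is the inverse operation.\<close>

definition approx :: "nat \<Rightarrow> nat \<Rightarrow> (int \<Rightarrow> rat) \<Rightarrow> nat \<Rightarrow> int" where
  "approx p a x t = \<lfloor>of_nat p ^ a * x (int t - int a)\<rfloor>"

definition of_approx :: "nat \<Rightarrow> nat \<Rightarrow> (nat \<Rightarrow> int) \<Rightarrow> (int \<Rightarrow> rat)" where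
  "of_approx p a X = (\<lambda>n. if n + int a \<le> 0 then 0
     else of_int (X (nat (n + int a)) mod int p ^ nat (n + int a)) / of_nat p ^ a)"

definition coherent :: "nat \<Rightarrow> (nat \<Rightarrow> int) \<Rightarrow> bool" where
  "coherent p X \<longleftrightarrow> (\<forall>t. [X (Suc t) = X t] (mod int p ^ t))"

lemma qmod_eqI:
  assumes "m > 0" "a - b = m * of_int z" "0 \<le> b" "b < m"
  shows "qmod a m = b"
proof -
  have "a / m = b / m + of_int z" using assms by (simp add: field_simps)
  moreover have "\<lfloor>b / m\<rfloor> = 0" using assms by (simp add: floor_eq_iff)
  ultimately have "\<lfloor>a / m\<rfloor> = z" by simp
  then show ?thesis using assms(2) by (simp add: qmod_def)
qed

lemma coherent_cong:
  assumes "coherent p X" "t \<le> t'"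
  shows "[X t' = X t] (mod int p ^ t)"
  using \<open>t \<le> t'\<close>
proof (induction t' rule: dec_induct)
  case (step t')
  have "[X (Suc t') = X t'] (mod int p ^ t')" using assms by (simp add: coherent_def)
  then have "[X (Suc t') = X t'] (mod int p ^ t)"
    by (rule cong_dvd_modulus) (simp add: le_imp_power_dvd step)
  then show ?case using step cong_trans by blast
qed simp

lemma coherent_add: "coherent p X \<Longrightarrow> coherent p Y \<Longrightarrow> coherent p (\<lambda>t. X t + Y t)"
  by (simp add: coherent_def cong_add)

lemma coherent_mult: "coherent p X \<Longrightarrow> coherent p Y \<Longrightarrow> coherent p (\<lambda>t. X t * Y t)"
  by (simp add: coherent_def cong_mult)

lemma coherent_sum: "(\<And>i. i \<in> A \<Longrightarrow> coherent p (X i)) \<Longrightarrow> coherent p (\<lambda>t. \<Sum>i\<in>A. X i t)"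
  by (simp add: coherent_def cong_sum)

text \<open>The lattice p^(-a) Mat(N, Z_p), as a component at level -a vanishes exactly on p^(-a)
  Z_p.\<close>

definition latm :: "nat \<Rightarrow> nat \<Rightarrow> nat \<Rightarrow> qpmat set" where
  "latm p N a = {Z \<in> QpMat p N. \<forall>i<N. \<forall>j<N. Z (i, j) (- int a) = 0}"

definition amat :: "nat \<Rightarrow> nat \<Rightarrow> qpmat \<Rightarrow> nat \<Rightarrow> imat" where
  "amat p a Z t = (\<lambda>x. approx p a (Z x) t)"

definition of_amat :: "nat \<Rightarrow> nat \<Rightarrow> nat \<Rightarrow> (nat \<Rightarrow> imat) \<Rightarrow> qpmat" where
  "of_amat p N a X = (\<lambda>(i, j). if i < N \<and> j < N then of_approx p a (\<lambda>t. X t (i, j)) else pzero)"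

definition mcoherent :: "nat \<Rightarrow> nat \<Rightarrow> (nat \<Rightarrow> imat) \<Rightarrow> bool" where
  "mcoherent p N X \<longleftrightarrow> (\<forall>t. mcong (int p ^ t) N (X (Suc t)) (X t))"

text \<open>The valuation of p^(m - k), truncated at t.\<close>

definition exps :: "nat \<Rightarrow> zinf \<Rightarrow> nat \<Rightarrow> nat" where
  "exps m k t = (case k of NegInf \<Rightarrow> t | Fin a \<Rightarrow> min t (nat (int m - a)))"

lemma mcoherentD: "mcoherent p N X \<Longrightarrow> i < N \<Longrightarrow> j < N \<Longrightarrow> coherent p (\<lambda>t. X t (i, j))"
  by (auto simp: mcoherent_def coherent_def mcong_def)

lemma latmD:
  assumes "Z \<in> latm p N a" "i < N" "j < N"
  shows "Z (i, j) \<in> Qp p" "Z (i, j) (- int a) = 0"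
  using assms by (auto simp: latm_def QpMat_def)

lemma latm_QpMat: "Z \<in> latm p N a \<Longrightarrow> Z \<in> QpMat p N"
  by (simp add: latm_def)

lemma ZpMat_eq: "ZpMat p N = latm p N 0"
  by (auto simp: ZpMat_def latm_def inZp_def)

lemma mcoherent_mprod: "mcoherent p N X \<Longrightarrow> mcoherent p N Y \<Longrightarrow> mcoherent p N (\<lambda>t. mprod N (X t) (Y t))"
  unfolding mcoherent_def by (blast intro: mcong_mprod)

text \<open>A common refinement of \<open>vseq\<close>, \<open>useq\<close> and the coranks: all of
  them are values of this counting function, at negative levels, at nonnegative levels, and counted
  downwards from m.\<close>

definition cnt :: "zinf list \<Rightarrow> int \<Rightarrow> nat" where
  "cnt k z = card {j. j < length k \<and> zle (k ! j) (Fin z)}"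

text \<open>Equivalently, the diagonal matrix belonging to k lies in p^(-m) Mat(N, Z_p).\<close>

definition bounded_by :: "nat \<Rightarrow> zinf list \<Rightarrow> bool" where
  "bounded_by m k \<longleftrightarrow> (\<forall>i<length k. zle (k ! i) (Fin (int m)))"

text \<open>The relation under the description operator in \<open>Sing\<close>, used as such until
  existence and uniqueness are known.\<close>

definition factors :: "nat \<Rightarrow> nat \<Rightarrow> zinf list \<Rightarrow> qpmat \<Rightarrow> bool" where
  "factors p N k Z \<longleftrightarrow> k \<in> Delta N \<and>
      (\<exists>B C. B \<in> GLZp p N \<and> C \<in> GLZp p N \<and> Z = mmul p N (mmul p N B (diagm p N k)) C)"

lemma exps_Suc:
  "zle k (Fin (int m)) \<Longrightarrow> exps m k (Suc n) = exps m k n + (if zle k (Fin (int m - int n - 1)) then 1 else 0)"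
  by (cases k) (auto simp: exps_def min_def)

text \<open>Passage to the conjugate partition: raising the truncation level from n to n + 1
  lengthens exactly those exponents m - k_j that exceed n, that is, those with k_j \<le> m - n -
  1.\<close>

lemma sum_exps:
  assumes "bounded_by m k"
  shows "(\<Sum>i<length k. exps m (k ! i) n) = (\<Sum>i<n. cnt k (int m - int i - 1))"
proof (induction n)
  case 0
  show ?case by (auto simp: exps_def split: zinf.split)
next
  case (Suc n)
  have "(\<Sum>i<length k. exps m (k ! i) (Suc n)) =
      (\<Sum>i<length k. exps m (k ! i) n + (if zle (k ! i) (Fin (int m - int n - 1)) then 1 else 0))"
    using assms by (intro sum.cong) (auto simp: bounded_by_def exps_Suc)
  also have "\<dots> = (\<Sum>i<length k. exps m (k ! i) n) + cnt k (int m - int n - 1)"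
  proof -
    have "{..<length k} \<inter> {i. zle (k ! i) (Fin (int m - int n - 1))} =
      {j. j < length k \<and> zle (k ! j) (Fin (int m - int n - 1))}" by auto
    then show ?thesis by (simp add: sum.distrib sum.If_cases cnt_def)
  qed
  finally show ?case using Suc by simp
qed

lemma zle_trans: "zle a b \<Longrightarrow> zle b c \<Longrightarrow> zle a c"
  by (cases a; cases b; cases c) auto

lemma zle_refl: "zle a a"
  by (cases a) auto

lemma Delta_antimono:
  assumes "k \<in> Delta N" "i \<le> j" "j < N"
  shows "zle (k ! j) (k ! i)"
proof (cases "i = j")
  case False
  then show ?thesis using assms by (auto simp: Delta_def sorted_wrt_iff_nth_less)
qed (simp add: zle_refl)

lemma zinf_eqI: "(\<And>z. zle a (Fin z) \<longleftrightarrow> zle b (Fin z)) \<Longrightarrow> a = b"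
proof (cases a; cases b)
  fix x assume *: "\<And>z. zle a (Fin z) \<longleftrightarrow> zle b (Fin z)" "a = NegInf" "b = Fin x"
  then show "a = b" using *(1)[of "x - 1"] by simp
next
  fix x assume *: "\<And>z. zle a (Fin z) \<longleftrightarrow> zle b (Fin z)" "a = Fin x" "b = NegInf"
  then show "a = b" using *(1)[of "x - 1"] by simp
next
  fix x y assume *: "\<And>z. zle a (Fin z) \<longleftrightarrow> zle b (Fin z)" "a = Fin x" "b = Fin y"
  then have "x \<le> y" "y \<le> x" using *(1)[of x] *(1)[of y] by auto
  then show "a = b" using * by simp
qed simp

text \<open>As k is weakly decreasing, the entries \<le> z form a final segment, and its length
  tells whether it contains position i. Hence the counts determine k.\<close>

lemma zle_nth_iff_cnt:
  assumes k: "k \<in> Delta N" and i: "i < N"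
  shows "zle (k ! i) (Fin z) \<longleftrightarrow> N - i \<le> cnt k z"
proof
  have len: "length k = N" using k by (simp add: Delta_def)
  {
    assume "zle (k ! i) (Fin z)"
    then have "{i..<N} \<subseteq> {j. j < length k \<and> zle (k ! j) (Fin z)}"
      using Delta_antimono[OF k] zle_trans len by fastforce
    from card_mono[OF _ this] show "N - i \<le> cnt k z" by (simp add: cnt_def)
  }
  assume *: "N - i \<le> cnt k z"
  show "zle (k ! i) (Fin z)"
  proof (rule ccontr)
    assume n: "\<not> zle (k ! i) (Fin z)"
    have "{j. j < length k \<and> zle (k ! j) (Fin z)} \<subseteq> {Suc i..<N}"
    proof safe
      fix j assume j: "j < length k" "zle (k ! j) (Fin z)"
      then have "\<not> j \<le> i" using n zle_trans[OF Delta_antimono[OF k, of j i]] i by blast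
      then show "j \<in> {Suc i..<N}" using j len by simp
    qed
    from card_mono[OF _ this] have "cnt k z \<le> N - Suc i" by (simp add: cnt_def)
    then show False using * i by linarith
  qed
qed

lemma Delta_eqI:
  assumes "k \<in> Delta N" "k' \<in> Delta N" "\<And>z. cnt k z = cnt k' z"
  shows "k = k'"
proof (rule nth_equalityI)
  fix i assume "i < length k"
  then have "i < N" using assms by (simp add: Delta_def)
  then show "k ! i = k' ! i" using zle_nth_iff_cnt[OF assms(1)] zle_nth_iff_cnt[OF assms(2)] assms(3)
    by (intro zinf_eqI) simp
qed (use assms in \<open>simp add: Delta_def\<close>)

lemma ex_bounded_by: "\<exists>m. bounded_by m k"
proof -
  define m where "m = nat (Max (insert 0 ((\<lambda>x. case x of NegInf \<Rightarrow> 0 | Fin a \<Rightarrow> a) ` set k)))"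
  have "zle (k ! i) (Fin (int m))" if "i < length k" for i
  proof -
    let ?f = "\<lambda>x. case x of NegInf \<Rightarrow> 0 | Fin a \<Rightarrow> a"
    have "?f (k ! i) \<le> Max (insert 0 (?f ` set k))" using that by (intro Max_ge) auto
    then show ?thesis by (cases "k ! i") (auto simp: m_def)
  qed
  then show ?thesis unfolding bounded_by_def by blast
qed

lemma bounded_by_mono: "bounded_by m k \<Longrightarrow> m \<le> m' \<Longrightarrow> bounded_by m' k"
  unfolding bounded_by_def using zle_trans by (metis of_nat_mono zle.simps(3))

lemma cnt_eq_length:
  assumes "bounded_by m k" "int m \<le> z"
  shows "cnt k z = length k"
proof -
  have "zle (k ! j) (Fin z)" if "j < length k" for j
    using assms that unfolding bounded_by_def by (meson zle.simps(3) zle_trans)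
  then have "{j. j < length k \<and> zle (k ! j) (Fin z)} = {..<length k}" by auto
  then show ?thesis by (simp add: cnt_def)
qed

text \<open>A sequence compatible with truncation consists of the truncations of one natural number
  or of infinity. The infinite case later yields the singular number \<open>NegInf\<close>.\<close>

lemma min_sequence:
  fixes f :: "nat \<Rightarrow> nat"
  assumes f: "\<And>n. f n = min (f (Suc n)) n"
  shows "(\<forall>n. f n = n) \<or> (\<exists>L. \<forall>n. f n = min n L)"
proof (cases "\<forall>n. f n = n")
  case False
  then obtain a where a: "f a \<noteq> a" by blast
  have le: "f n \<le> n" for n using f[of n] by simp
  have down: "f n = min (f (n + d)) n" for n d
  proof (induction d)
    case 0
    show ?case using le[of n] by simp
  next
    case (Suc d)
    then show ?case using f[of "n + d"] by simp
  qed
  have "f n = min n (f a)" for n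
  proof (cases "n \<le> a")
    case True
    then show ?thesis using down[of n "a - n"] by simp
  next
    case False
    have "f a < a" using a le[of a] by simp
    then show ?thesis using down[of a "n - a"] False by simp
  qed
  then show ?thesis by blast
qed blast

abbreviation uniform_digit :: "nat \<Rightarrow> nat measure" where
  "uniform_digit p \<equiv> uniform_count_measure {0..<p}"

abbreviation int_matrices :: "nat \<Rightarrow> nat \<Rightarrow> nat \<Rightarrow> imat set" where
  "int_matrices p N n \<equiv> {..<N} \<times> {..<N} \<rightarrow>\<^sub>E {0..<int p ^ n}"

abbreviation residue_class :: "nat \<Rightarrow> nat \<Rightarrow> nat \<Rightarrow> nat \<Rightarrow> imat \<Rightarrow> qpmat set" where
  "residue_class p N m n A \<equiv> {Z \<in> QpMat p N. \<forall>x\<in>{..<N} \<times> {..<N}. amat p m Z n x = A x}"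

abbreviation lattice_event :: "nat \<Rightarrow> nat \<Rightarrow> nat \<Rightarrow> nat \<Rightarrow> (nat \<Rightarrow> nat) \<Rightarrow> qpmat set" where
  "lattice_event p N m n r \<equiv> {Z \<in> latm p N m. ker_type p n {..<N} (column_set N (amat p m Z n)) r}"

text \<open>The Smith exponents of p^m Z are the m - k_j, and m - k_j > i means k_j \<le> m - i - 1;
  hence the shift by one.\<close>

abbreviation coranks :: "nat \<Rightarrow> zinf list \<Rightarrow> nat \<Rightarrow> nat" where
  "coranks m k i \<equiv> cnt k (int m - int i - 1)"

abbreviation chain_weight :: "nat \<Rightarrow> real \<Rightarrow> nat \<Rightarrow> zinf list \<Rightarrow> nat \<Rightarrow> real" where
  "chain_weight p s N k n \<equiv> piN p s N (vseq k 0) * (\<Prod>i<n. Pker p s (useq k i) (useq k (i + 1)))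
           * (\<Prod>i<n. Pker p 0 (vseq k i) (vseq k (i + 1)))"

abbreviation digit_space :: "nat \<Rightarrow> nat \<Rightarrow> (nat \<times> nat \<times> nat \<Rightarrow> nat) measure" where
  "digit_space p N \<equiv> PiM ({..<N} \<times> {..<N} \<times> UNIV) (\<lambda>_. uniform_digit p)"

section \<open>Measurability of entries and base p digits\<close>

lemma space_MatSp [simp]: "space (MatSp p N) = QpMat p N"
  by (auto simp: MatSp_def space_restrict_space space_PiM)

lemma measurable_MatSp_entry [measurable]: "(\<lambda>Z. Z x n) \<in> measurable (MatSp p N) (count_space UNIV)"
proof -
  have "(\<lambda>Z. Z x) \<in> measurable (PiM UNIV (\<lambda>_::nat \<times> nat. PiM UNIV (\<lambda>_::int. count_space (UNIV :: rat set)))) (PiM UNIV (\<lambda>_::int. count_space (UNIV :: rat set)))"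
    by (rule measurable_component_singleton) simp
  moreover have "(\<lambda>y. y n) \<in> measurable (PiM UNIV (\<lambda>_::int. count_space (UNIV :: rat set))) (count_space UNIV)"
    by (rule measurable_component_singleton) simp
  ultimately have "(\<lambda>Z. Z x n) \<in> measurable (PiM UNIV (\<lambda>_::nat \<times> nat. PiM UNIV (\<lambda>_::int. count_space (UNIV :: rat set)))) (count_space UNIV)"
    by (rule measurable_compose)
  then show ?thesis
    unfolding MatSp_def by (rule measurable_restrict_space1)
qed

lemma measurable_MatSp_I:
  assumes "\<And>d. d \<in> space M \<Longrightarrow> f d \<in> QpMat p N"
    and "\<And>x n. (\<lambda>d. f d x n) \<in> measurable M (count_space UNIV)"
  shows "f \<in> measurable M (MatSp p N)"
  unfolding MatSp_def
proof (rule measurable_restrict_space2)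
  show "f \<in> space M \<rightarrow> QpMat p N" using assms by auto
  have "(\<lambda>d n. f d x n) \<in> measurable M (PiM UNIV (\<lambda>_::int. count_space (UNIV :: rat set)))" for x
    by (rule measurable_PiM_single') (use assms in auto)
  then have "(\<lambda>d x. f d x) \<in> measurable M (PiM UNIV (\<lambda>_::nat \<times> nat. PiM UNIV (\<lambda>_::int. count_space (UNIV :: rat set))))"
    by (intro measurable_PiM_single') (auto simp: space_PiM)
  then show "f \<in> measurable M (PiM UNIV (\<lambda>_::nat \<times> nat. PiM UNIV (\<lambda>_::int. count_space (UNIV :: rat set))))" .
qed

lemma measurable_count_space_sum:
  fixes f :: "'i \<Rightarrow> 'a \<Rightarrow> 'b::{countable, comm_monoid_add}"
  assumes "\<And>i. i \<in> A \<Longrightarrow> f i \<in> measurable M (count_space UNIV)"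
  shows "(\<lambda>x. \<Sum>i\<in>A. f i x) \<in> measurable M (count_space UNIV)"
  using assms by (induction A rule: infinite_finite_induct) auto

lemma digit_sum_less:
  assumes "\<And>t. t < n \<Longrightarrow> d t < p"
  shows "(\<Sum>t<n. int (d t) * int p ^ t) < int p ^ n"
  using assms
proof (induction n)
  case (Suc n)
  have "int (d n) + 1 \<le> int p" using Suc.prems[of n] by simp
  then have "int p ^ n * (int (d n) + 1) \<le> int p ^ n * int p" by (intro mult_left_mono) auto
  then show ?case using Suc by (simp add: algebra_simps)
qed simp

text \<open>Base p expansion, phrased as an equivalence for arbitrary digit sequences, so that the
  event of having a given residue becomes a cylinder in the digit space.\<close>

lemma digits_exist:
  assumes "0 \<le> a" "a < int p ^ n"
  obtains e where "\<And>t. t < n \<Longrightarrow> e t < p"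
    "\<And>d. (\<And>t. t < n \<Longrightarrow> d t < p) \<Longrightarrow> (\<Sum>t<n. int (d t) * int p ^ t) = a \<longleftrightarrow> (\<forall>t<n. d t = e t)"
  using assms
proof (induction n arbitrary: a thesis)
  case 0
  then show ?case by (intro 0(1)[of "\<lambda>_. 0"]) auto
next
  case (Suc n)
  have p: "p > 0" using Suc.prems(2,3) by (cases p) auto
  let ?m = "int p ^ n"
  have m: "?m > 0" using p by simp
  obtain e where e: "\<And>t. t < n \<Longrightarrow> e t < p"
    "\<And>d. (\<And>t. t < n \<Longrightarrow> d t < p) \<Longrightarrow> (\<Sum>t<n. int (d t) * int p ^ t) = a mod ?m \<longleftrightarrow> (\<forall>t<n. d t = e t)"
    using Suc.IH[of "a mod ?m"] m by auto
  have 0: "0 \<le> a div ?m" using Suc.prems(2) m by (simp add: pos_imp_zdiv_nonneg_iff)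
  have lt: "a div ?m < int p"
  proof (rule ccontr)
    assume "\<not> a div ?m < int p"
    then have "?m * int p \<le> ?m * (a div ?m)" using m by (intro mult_left_mono) auto
    also have "\<dots> \<le> a" using mult_div_mod_eq[of ?m a] pos_mod_sign[OF m, of a] by linarith
    finally show False using Suc.prems(3) by (simp add: mult.commute)
  qed
  define e' where "e' = e(n := nat (a div ?m))"
  show ?case
  proof (rule Suc.prems(1))
    show "e' t < p" if "t < Suc n" for t using that e(1) 0 lt by (auto simp: e'_def less_Suc_eq nat_less_iff)
    fix d :: "nat \<Rightarrow> nat" assume d: "\<And>t. t < Suc n \<Longrightarrow> d t < p"
    let ?S = "\<Sum>t<n. int (d t) * int p ^ t"
    have S: "0 \<le> ?S" "?S < ?m" using d by (auto intro!: sum_nonneg digit_sum_less)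
    have "?S + int (d n) * ?m = a \<longleftrightarrow> ?S = a mod ?m \<and> int (d n) = a div ?m"
    proof
      assume a: "?S + int (d n) * ?m = a"
      show "?S = a mod ?m \<and> int (d n) = a div ?m"
        using S m unfolding a[symmetric] by simp
    next
      assume "?S = a mod ?m \<and> int (d n) = a div ?m"
      then show "?S + int (d n) * ?m = a" using mod_mult_div_eq[of a ?m] by (simp add: mult.commute)
    qed
    also have "int (d n) = a div ?m \<longleftrightarrow> d n = e' n" using 0 by (auto simp: e'_def)
    also have "?S = a mod ?m \<longleftrightarrow> (\<forall>t<n. d t = e' t)" using e(2)[of d] d by (auto simp: e'_def)
    finally show "(\<Sum>t<Suc n. int (d t) * int p ^ t) = a \<longleftrightarrow> (\<forall>t<Suc n. d t = e' t)"
      by (auto simp: less_Suc_eq)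
  qed
qed

definition shift_digits :: "nat \<Rightarrow> (nat \<times> nat \<times> nat \<Rightarrow> nat) \<Rightarrow> nat \<times> nat \<times> nat \<Rightarrow> nat" where
  "shift_digits N d = (\<lambda>y\<in>{..<N} \<times> {..<N} \<times> UNIV. case y of (i, j, t) \<Rightarrow> d (i, j, Suc t))"

text \<open>These digit sequences describe the sublattice p^(-m) Mat(N, Z_p) of p^(-m-1) Mat(N, Z_p), and shifting the digits identifies it with the former lattice.\<close>

definition leading_zero :: "nat \<Rightarrow> nat \<Rightarrow> (nat \<times> nat \<times> nat \<Rightarrow> nat) set" where
  "leading_zero p N = {d \<in> space (digit_space p N). \<forall>y\<in>{..<N} \<times> {..<N} \<times> {0}. d y \<in> {0}}"

section \<open>Arithmetic of Q_p through integer residues\<close>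

context
  fixes p :: nat
  assumes p: "prime p"
begin

lemmas p_gt_1 = prime_gt_1_nat[OF p]
lemmas p_gt_0 = prime_gt_0_nat[OF p]

lemma Qp_diff:
  assumes x: "x \<in> Qp p" and "n \<le> n'"
  obtains z :: int where "x n' - x n = of_nat p powi n * of_int z"
proof -
  have "\<exists>z::int. x n' - x n = of_nat p powi n * of_int z"
    using \<open>n \<le> n'\<close>
  proof (induction n' rule: int_ge_induct)
    case base
    show ?case by (intro exI[of _ 0]) simp
  next
    case (step i)
    then obtain z :: int where z: "x i - x n = of_nat p powi n * of_int z" by blast
    define F where "F = \<lfloor>x (i + 1) / of_nat p powi i\<rfloor>"
    have "qmod (x (i + 1)) (of_nat p powi i) = x i" using x by (simp add: Qp_def)
    then have "x (i + 1) - x i = of_nat p powi i * of_int F"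
      by (simp add: qmod_def F_def)
    also have "(of_nat p :: rat) powi i = of_nat p powi n * of_nat p ^ nat (i - n)"
      using step(1) p_gt_0 by (simp flip: power_int_add power_int_of_nat)
    finally have "x (i + 1) - x n = of_nat p powi n * of_int (z + int p ^ nat (i - n) * F)"
      using z by (simp add: algebra_simps)
    then show ?case by blast
  qed
  then show ?thesis using that by blast
qed

lemma Qp_range: "x \<in> Qp p \<Longrightarrow> 0 \<le> x n" "x \<in> Qp p \<Longrightarrow> x n < of_nat p powi n"
  by (auto simp: Qp_def)

text \<open>x n is a multiple of p^n and lies between 0 (inclusive) and p^n (exclusive).\<close>

lemma Qp_zero_below:
  assumes x: "x \<in> Qp p" and "x n' = 0" "n \<le> n'"
  shows "x n = 0"
proof -
  obtain z :: int where z: "x n' - x n = of_nat p powi n * of_int z" using Qp_diff[OF x \<open>n \<le> n'\<close>] .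
  let ?m = "of_nat p powi n :: rat"
  have m: "?m > 0" using p_gt_0 by simp
  have e: "x n = ?m * of_int (- z)" using z assms(2) by simp
  have "0 \<le> ?m * of_int (- z)" "?m * of_int (- z) < ?m * 1"
    using Qp_range[OF x, of n] unfolding e by simp_all
  then have "0 \<le> (of_int (- z) :: rat)" "of_int (- z) < (1::rat)"
    using m by (simp_all only: mult_less_cancel_left_pos zero_le_mult_iff) (use m in auto)
  then have "- z = 0" by linarith
  then show ?thesis using e by simp
qed

lemma Qp_integral:
  assumes x: "x \<in> Qp p" and a: "x (- int a) = 0"
  obtains z :: int where "of_nat p ^ a * x n = of_int z"
proof (cases "- int a \<le> n")
  case True
  obtain z :: int where "x n - x (- int a) = of_nat p powi (- int a) * of_int z" using Qp_diff[OF x True] .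
  then have "of_nat p ^ a * x n = of_int z" using a p_gt_0 by (simp add: power_int_minus field_simps)
  then show ?thesis using that by blast
next
  case False
  then have "x n = 0" using Qp_zero_below[OF x a] by simp
  then show ?thesis using that[of 0] by simp
qed

lemma approx_eq:
  assumes "x \<in> Qp p" "x (- int a) = 0"
  shows "of_int (approx p a x t) = of_nat p ^ a * x (int t - int a)"
  using Qp_integral[OF assms] unfolding approx_def by (metis floor_of_int)

lemma approx_range:
  assumes x: "x \<in> Qp p" and a: "x (- int a) = 0"
  shows "0 \<le> approx p a x t" "approx p a x t < int p ^ t"
proof -
  have "0 \<le> of_nat p ^ a * x (int t - int a)" using Qp_range[OF x] by simp
  then show "0 \<le> approx p a x t" by (simp add: approx_def)
  have "of_nat p ^ a * x (int t - int a) < of_nat p ^ a * of_nat p powi (int t - int a)"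
    using Qp_range(2)[OF x] p_gt_0 by (intro mult_strict_left_mono) auto
  also have "\<dots> = (of_nat p :: rat) ^ t"
    using p_gt_0 by (simp add: power_int_diff)
  finally have "(of_int (approx p a x t) :: rat) < of_int (int p ^ t)"
    by (simp add: approx_eq[OF assms])
  then show "approx p a x t < int p ^ t" by (simp only: of_int_less_iff)
qed

lemma coherent_approx:
  assumes x: "x \<in> Qp p" and a: "x (- int a) = 0"
  shows "coherent p (approx p a x)"
  unfolding coherent_def
proof
  fix t
  obtain z :: int where z: "x (int (Suc t) - int a) - x (int t - int a) = of_nat p powi (int t - int a) * of_int z"
    using Qp_diff[OF x, of "int t - int a" "int (Suc t) - int a"] by auto
  have "(of_int (approx p a x (Suc t) - approx p a x t) :: rat) =
      of_nat p ^ a * (x (int (Suc t) - int a) - x (int t - int a))"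
    by (simp only: of_int_diff approx_eq[OF assms] right_diff_distrib)
  also have "\<dots> = of_int (int p ^ t * z)" unfolding z using p_gt_0 by (simp add: power_int_diff)
  finally have "approx p a x (Suc t) - approx p a x t = int p ^ t * z" by (simp only: of_int_eq_iff)
  then show "[approx p a x (Suc t) = approx p a x t] (mod int p ^ t)"
    by (simp add: cong_iff_dvd_diff)
qed

lemma of_approx_Qp:
  assumes X: "coherent p X"
  shows "of_approx p a X \<in> Qp p"
proof -
  let ?x = "of_approx p a X"
  have "?x n \<in> Zinvp p" for n
  proof (cases "n + int a \<le> 0")
    case True
    then show ?thesis unfolding Zinvp_def of_approx_def by (auto intro!: exI[of _ 0])
  qed (auto simp: Zinvp_def of_approx_def)
  moreover have range: "0 \<le> ?x n \<and> ?x n < of_nat p powi n" for n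
  proof (cases "n + int a \<le> 0")
    case True
    then show ?thesis using p_gt_0 by (simp add: of_approx_def)
  next
    case False
    define t where "t = nat (n + int a)"
    have n: "n = int t - int a" using False by (simp add: t_def)
    have "X t mod int p ^ t < int p ^ t" using p_gt_0 by simp
    then have "(of_int (X t mod int p ^ t) :: rat) < of_nat p ^ t" by (metis of_int_less_iff of_int_of_nat_eq of_int_power)
    moreover have "(0::rat) \<le> of_int (X t mod int p ^ t)" using p_gt_0 by simp
    ultimately show ?thesis using False p_gt_0
      by (simp add: of_approx_def t_def[symmetric] n power_int_diff divide_strict_right_mono)
  qed
  moreover have "qmod (?x (n + 1)) (of_nat p powi n) = ?x n" for n
  proof -
    \<comment> \<open>At n = -a the residue at n comes from the zero branch of
      \<open>of_approx\<close>, while the one at n + 1 does not; this boundary is treated on its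
      own.\<close>
    consider "n + 1 + int a \<le> 0" | "n = - int a" | "n + int a > 0" by linarith
    then show ?thesis
    proof cases
      case 1
      then show ?thesis by (simp add: of_approx_def qmod_def)
    next
      case 2
      show ?thesis
      proof (rule qmod_eqI)
        show "?x (n + 1) - ?x n = of_nat p powi n * of_int (X 1 mod int p)"
          unfolding 2 using p_gt_0 by (simp add: of_approx_def power_int_minus field_simps)
      qed (use range p_gt_0 in auto)
    next
      case 3
      define t where "t = nat (n + int a)"
      have n: "n = int t - int a" and e: "nat (n + 1 + int a) = Suc t" using 3 by (simp_all add: t_def)
      have "[X (Suc t) mod int p ^ Suc t = X t mod int p ^ t] (mod int p ^ t)"
      proof -
        have "[X (Suc t) mod int p ^ Suc t = X (Suc t)] (mod int p ^ Suc t)" by simp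
        then have "[X (Suc t) mod int p ^ Suc t = X (Suc t)] (mod int p ^ t)"
          by (rule cong_dvd_modulus) simp
        also have "[X (Suc t) = X t] (mod int p ^ t)" using X by (simp add: coherent_def)
        also have "[X t = X t mod int p ^ t] (mod int p ^ t)" by simp
        finally show ?thesis .
      qed
      then obtain z where z: "X (Suc t) mod int p ^ Suc t - X t mod int p ^ t = int p ^ t * z"
        by (auto simp: cong_iff_dvd_diff)
      show ?thesis
      proof (rule qmod_eqI)
        have "?x (n + 1) - ?x n = of_int (X (Suc t) mod int p ^ Suc t - X t mod int p ^ t) / of_nat p ^ a"
          using 3 by (simp add: of_approx_def e t_def[symmetric] diff_divide_distrib)
        then show "?x (n + 1) - ?x n = of_nat p powi n * of_int z"
          unfolding z using p_gt_0 by (simp add: n power_int_diff)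
      qed (use range p_gt_0 in auto)
    qed
  qed
  moreover have "\<exists>M. \<forall>n\<le>M. ?x n = 0"
    by (rule exI[of _ "- int a"]) (simp add: of_approx_def)
  ultimately show ?thesis by (simp add: Qp_def)
qed

lemma of_approx_zero [simp]: "of_approx p a X (- int a) = 0"
  by (simp add: of_approx_def)

lemma approx_of_approx:
  shows "approx p a (of_approx p a X) t = X t mod int p ^ t"
proof (cases "t = 0")
  case False
  then show ?thesis using p_gt_0 by (simp add: approx_def of_approx_def)
qed (simp add: approx_def of_approx_def)

lemma of_approx_approx:
  assumes x: "x \<in> Qp p" and a: "x (- int a) = 0"
  shows "of_approx p a (approx p a x) = x"
proof
  fix n
  show "of_approx p a (approx p a x) n = x n"
  proof (cases "n + int a \<le> 0")
    case True
    then show ?thesis using Qp_zero_below[OF x a, of n] by (simp add: of_approx_def)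
  next
    case False
    define t where "t = nat (n + int a)"
    have n: "n = int t - int a" using False by (simp add: t_def)
    have "of_approx p a (approx p a x) n = of_int (approx p a x t) / of_nat p ^ a"
      using False approx_range[OF assms, of t] by (simp add: of_approx_def t_def)
    then show ?thesis using p_gt_0 by (simp add: approx_eq[OF assms] n)
  qed
qed

lemma Qp_eqI:
  assumes "x \<in> Qp p" "x (- int a) = 0" "y \<in> Qp p" "y (- int a) = 0"
    and "\<And>t. [approx p a x t = approx p a y t] (mod int p ^ t)"
  shows "x = y"
proof -
  have "approx p a x t = approx p a y t" for t
    using assms(5)[of t] approx_range[OF assms(1,2), of t] approx_range[OF assms(3,4), of t]
    by (intro cong_less_imp_eq_int[of _ "int p ^ t"]) auto
  then have "approx p a x = approx p a y" by auto
  then show ?thesis using of_approx_approx assms(1-4) by metis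
qed

lemma padd_eq:
  assumes x: "x \<in> Qp p" and xa: "x (- int a) = 0" and y: "y \<in> Qp p" and ya: "y (- int a) = 0"
  shows "padd p x y = of_approx p a (\<lambda>t. approx p a x t + approx p a y t)"
proof
  fix n
  let ?z = "of_approx p a (\<lambda>t. approx p a x t + approx p a y t)"
  have z: "?z \<in> Qp p" by (intro of_approx_Qp coherent_add coherent_approx assms)
  show "padd p x y n = ?z n"
  proof (cases "n + int a \<le> 0")
    case True
    then show ?thesis using Qp_zero_below[OF x xa, of n] Qp_zero_below[OF y ya, of n]
      by (simp add: padd_def of_approx_def qmod_def)
  next
    case False
    define t where "t = nat (n + int a)"
    have n: "n = int t - int a" using False by (simp add: t_def)
    let ?s = "approx p a x t + approx p a y t"
    have s: "(of_int ?s :: rat) = of_int (?s mod int p ^ t) + of_int (int p ^ t * (?s div int p ^ t))"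
      by (simp only: of_int_add [symmetric] mod_mult_div_eq)
    have "x n + y n = of_int ?s / of_nat p ^ a"
      using p_gt_0 by (simp add: n approx_eq assms field_simps)
    also have "\<dots> = of_int (?s mod int p ^ t) / of_nat p ^ a + of_int (int p ^ t * (?s div int p ^ t)) / of_nat p ^ a"
      unfolding s by (rule add_divide_distrib)
    also have "of_int (?s mod int p ^ t) / of_nat p ^ a = ?z n"
      using False by (simp add: of_approx_def t_def)
    finally have "x n + y n - ?z n = of_nat p powi n * of_int (?s div int p ^ t)"
      using p_gt_0 by (simp add: n power_int_diff)
    then show ?thesis unfolding padd_def
      using Qp_range[OF z] p_gt_0 by (intro qmod_eqI) auto
  qed
qed

lemma nd_zero: "x \<in> Qp p \<Longrightarrow> x (- int (nd x)) = 0"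
proof -
  assume x: "x \<in> Qp p"
  then obtain M where M: "\<And>n. n \<le> M \<Longrightarrow> x n = 0" by (auto simp: Qp_def)
  have "x (- int (nat (- M))) = 0" by (rule M) simp
  then show ?thesis unfolding nd_def by (rule LeastI)
qed

lemma nd_le: "x (- int a) = 0 \<Longrightarrow> nd x \<le> a"
  unfolding nd_def by (rule Least_le)

text \<open>\<open>pmul\<close> evaluates both factors at a level that depends on their exact
  denominators, whereas the right-hand side uses the bounds a and b. The two agree because any
  sufficiently fine residues give the same product modulo p^n.\<close>

lemma pmul_eq:
  assumes x: "x \<in> Qp p" and xa: "x (- int a) = 0" and y: "y \<in> Qp p" and yb: "y (- int b) = 0"
  shows "pmul p x y = of_approx p (a + b) (\<lambda>t. approx p a x t * approx p b y t)"
proof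
  fix n
  let ?z = "of_approx p (a + b) (\<lambda>t. approx p a x t * approx p b y t)"
  have z: "?z \<in> Qp p" by (intro of_approx_Qp coherent_mult coherent_approx assms)
  define m where "m = n + int (nd x + nd y)"
  note ndx = nd_zero[OF x] and ndy = nd_zero[OF y]
  have nd: "nd x \<le> a" "nd y \<le> b" using nd_le xa yb by auto
  have mul: "pmul p x y n = qmod (x m * y m) (of_nat p powi n)"
    by (simp add: pmul_def m_def Let_def)
  show "pmul p x y n = ?z n"
  proof (cases "n + int (a + b) \<le> 0")
    case True
    obtain u v :: int where uv: "of_nat p ^ a * x m = of_int u" "of_nat p ^ b * y m = of_int v"
      using Qp_integral[OF x xa] Qp_integral[OF y yb] by metis
    define d where "d = nat (- (n + int (a + b)))"
    have n: "n = - int (a + b + d)" using True by (simp add: d_def)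
    have pn: "(of_nat p :: rat) powi n = inverse (of_nat p ^ (a + b + d))"
      unfolding n by (simp only: power_int_minus power_int_of_nat)
    have "x m * y m = of_nat p powi n * of_int (int p ^ d * u * v)"
      unfolding pn using uv[symmetric] p_gt_0 by (simp add: power_add field_simps)
    moreover have "?z n = 0" using True by (simp add: of_approx_def)
    ultimately show ?thesis unfolding mul using p_gt_0
      by (intro qmod_eqI[of _ _ _ "int p ^ d * u * v"]) auto
  next
    case False
    define t where "t = nat (n + int (a + b))"
    have n: "n = int t - int (a + b)" using False by (simp add: t_def)
    let ?n = "of_nat p powi n :: rat"
    define x' where "x' = x (int t - int a)"
    define y' where "y' = y (int t - int b)"
    \<comment> \<open>If u has denominator at most p^c, replacing w by another of its residues at a
      level at least n + c changes the product by a multiple of p^n. Exchanging the two factors one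
      after the other leads from level m to the levels t - a and t - b.\<close>
    have dvd: "\<exists>z::int. u i * (w j - w k) = ?n * of_int z"
      if u: "u \<in> Qp p" "u (- int c) = 0" and w: "w \<in> Qp p" and jk: "n + int c \<le> j" "n + int c \<le> k" for u w c i j k
    proof -
      obtain v1 :: int where v1: "of_nat p ^ c * u i = of_int v1" using Qp_integral[OF u] .
      obtain v2 v3 :: int where v: "w j - w (n + int c) = of_nat p powi (n + int c) * of_int v2"
        "w k - w (n + int c) = of_nat p powi (n + int c) * of_int v3"
        using Qp_diff[OF w jk(1)] Qp_diff[OF w jk(2)] by metis
      have "w j - w k = ?n * of_nat p ^ c * of_int (v2 - v3)"
        using v p_gt_0 by (simp add: power_int_add algebra_simps)
      then have "u i * (w j - w k) = (of_nat p ^ c * u i) * ?n * of_int (v2 - v3)" by simp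
      also have "\<dots> = ?n * of_int (v1 * (v2 - v3))" unfolding v1 by simp
      finally show ?thesis by blast
    qed
    have "\<exists>z::int. x m * (y m - y (int t - int b)) = ?n * of_int z"
      using nd by (intro dvd[OF x ndx y]) (auto simp: m_def n)
    moreover have "\<exists>z::int. y (int t - int b) * (x m - x (int t - int a)) = ?n * of_int z"
      using nd by (intro dvd[OF y ndy x]) (auto simp: m_def n)
    ultimately obtain z1 z2 :: int where z12: "x m * (y m - y') = ?n * of_int z1" "y' * (x m - x') = ?n * of_int z2"
      unfolding x'_def y'_def by blast
    let ?s = "approx p a x t * approx p b y t"
    have s: "(of_int ?s :: rat) = of_int (?s mod int p ^ t) + of_int (int p ^ t * (?s div int p ^ t))"
      by (simp only: of_int_add [symmetric] mod_mult_div_eq)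
    have "x' * y' = of_int ?s / of_nat p ^ (a + b)"
      using p_gt_0 by (simp add: x'_def y'_def approx_eq assms power_add)
    also have "\<dots> = of_int (?s mod int p ^ t) / of_nat p ^ (a + b) + of_int (int p ^ t * (?s div int p ^ t)) / of_nat p ^ (a + b)"
      unfolding s by (rule add_divide_distrib)
    also have "of_int (?s mod int p ^ t) / of_nat p ^ (a + b) = ?z n"
      using False by (simp add: of_approx_def t_def)
    finally have "x' * y' - ?z n = ?n * of_int (?s div int p ^ t)"
      using p_gt_0 by (simp add: n power_int_diff power_int_add power_add)
    then have "x m * y m - ?z n = ?n * of_int (z1 + z2 + ?s div int p ^ t)"
      using z12 by (simp add: algebra_simps)
    then show ?thesis unfolding mul
      using Qp_range[OF z] p_gt_0 by (intro qmod_eqI[of _ _ _ "z1 + z2 + ?s div int p ^ t"]) auto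
  qed
qed

lemma pzero_eq: "pzero = of_approx p a (\<lambda>_. 0)"
  by (auto simp: pzero_def of_approx_def)

lemma of_approx_cong:
  assumes "\<And>t. [X t = Y t] (mod int p ^ t)"
  shows "of_approx p a X = of_approx p a Y"
  using assms by (auto simp: of_approx_def cong_def)

lemma psum_eq:
  assumes "\<And>l. l < n \<Longrightarrow> f l = of_approx p a (X l)" "\<And>l. l < n \<Longrightarrow> coherent p (X l)"
  shows "psum p f n = of_approx p a (\<lambda>t. \<Sum>l<n. X l t)"
  using assms
proof (induction n)
  case 0
  show ?case by (simp add: pzero_eq[of a])
next
  case (Suc n)
  have IH: "psum p f n = of_approx p a (\<lambda>t. \<Sum>l<n. X l t)" using Suc by simp
  have c: "coherent p (\<lambda>t. \<Sum>l<n. X l t)" "coherent p (X n)" using Suc.prems(2) by (auto intro: coherent_sum)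
  have "psum p f (Suc n) = padd p (of_approx p a (\<lambda>t. \<Sum>l<n. X l t)) (of_approx p a (X n))"
    using Suc.prems(1) by (simp add: IH)
  also have "\<dots> = of_approx p a (\<lambda>t. (\<Sum>l<n. X l t) mod int p ^ t + X n t mod int p ^ t)"
    by (subst padd_eq[where a = a]) (auto intro!: of_approx_Qp c simp: approx_of_approx)
  also have "\<dots> = of_approx p a (\<lambda>t. \<Sum>l<Suc n. X l t)"
    by (rule of_approx_cong) (simp add: cong_def mod_simps)
  finally show ?case .
qed

section \<open>Matrices over Q_p as coherent integer matrices\<close>

lemma mcoherent_amat:
  assumes "Z \<in> latm p N a"
  shows "mcoherent p N (amat p a Z)"
proof -
  have "coherent p (approx p a (Z (i, j)))" if "i < N" "j < N" for i j
    by (intro coherent_approx latmD[OF assms] that)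
  then show ?thesis by (simp add: mcoherent_def amat_def mcong_def coherent_def)
qed

lemma of_amat_latm: "mcoherent p N X \<Longrightarrow> of_amat p N a X \<in> latm p N a"
  using mcoherentD of_approx_Qp by (auto simp: latm_def QpMat_def of_amat_def)

lemma amat_of_amat: "mcong (int p ^ t) N (amat p a (of_amat p N a X) t) (X t)"
  by (simp add: mcong_def amat_def of_amat_def approx_of_approx)

lemma latm_eqI:
  assumes Z: "Z \<in> latm p N a" and Y: "Y \<in> latm p N a" and c: "\<And>t. mcong (int p ^ t) N (amat p a Z t) (amat p a Y t)"
  shows "Z = Y"
proof
  fix x :: "nat \<times> nat"
  obtain i j where x: "x = (i, j)" by force
  show "Z x = Y x"
  proof (cases "i < N \<and> j < N")
    case True
    then have "[approx p a (Z x) t = approx p a (Y x) t] (mod int p ^ t)" for t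
      using c[of t] by (auto simp: mcong_def amat_def x)
    then show ?thesis using latmD[OF Z] latmD[OF Y] True by (intro Qp_eqI[of _ a]) (auto simp: x)
  next
    case False
    then show ?thesis using latm_QpMat[OF Z] latm_QpMat[OF Y] by (auto simp: QpMat_def x)
  qed
qed

text \<open>The bridge to integer matrices: representatives multiply and denominators add. It
  reduces matrix identities over Q_p to congruences modulo all p^t, which are compared by
  \<open>latm_eqI\<close>.\<close>

lemma mmul_eq:
  assumes A: "A \<in> latm p N a" and B: "B \<in> latm p N b"
  shows "mmul p N A B = of_amat p N (a + b) (\<lambda>t. mprod N (amat p a A t) (amat p b B t))"
proof (rule ext, clarify)
  fix i j
  show "mmul p N A B (i, j) = of_amat p N (a + b) (\<lambda>t. mprod N (amat p a A t) (amat p b B t)) (i, j)"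
  proof (cases "i < N \<and> j < N")
    case True
    have "psum p (\<lambda>l. pmul p (A (i, l)) (B (l, j))) N =
      of_approx p (a + b) (\<lambda>t. \<Sum>l<N. approx p a (A (i, l)) t * approx p b (B (l, j)) t)"
    proof (rule psum_eq)
      fix l assume l: "l < N"
      show "pmul p (A (i, l)) (B (l, j)) = of_approx p (a + b) (\<lambda>t. approx p a (A (i, l)) t * approx p b (B (l, j)) t)"
        using True l by (intro pmul_eq latmD[OF A] latmD[OF B]) auto
      show "coherent p (\<lambda>t. approx p a (A (i, l)) t * approx p b (B (l, j)) t)"
        using True l by (intro coherent_mult coherent_approx latmD[OF A] latmD[OF B]) auto
    qed
    then show ?thesis using True by (simp add: mmul_def of_amat_def mprod_def amat_def)
  qed (auto simp: mmul_def of_amat_def)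
qed

lemma mmul_latm:
  assumes "A \<in> latm p N a" "B \<in> latm p N b"
  shows "mmul p N A B \<in> latm p N (a + b)"
    "mcong (int p ^ t) N (amat p (a + b) (mmul p N A B) t) (mprod N (amat p a A t) (amat p b B t))"
  unfolding mmul_eq[OF assms]
  by (intro of_amat_latm mcoherent_mprod mcoherent_amat assms) (rule amat_of_amat)

lemma idm_eq: "idm N = of_amat p N 0 (\<lambda>_. mone)"
proof -
  have "pone n = of_approx p 0 (\<lambda>_. 1) n" for n
  proof (cases "n \<le> 0")
    case False
    have "1 mod int p ^ nat n = 1"
      using False p_gt_1 one_less_power[of "int p" "nat n"] by auto
    then show ?thesis using False by (auto simp: pone_def of_approx_def)
  qed (simp add: pone_def of_approx_def)
  then have "pone = of_approx p 0 (\<lambda>_. 1)" by auto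
  then show ?thesis using pzero_eq[of 0] by (auto simp: idm_def of_amat_def mone_def fun_eq_iff)
qed

lemma of_approx_power:
  "k \<le> int m \<Longrightarrow> ppow p (- k) = of_approx p m (\<lambda>t. int p ^ min t (nat (int m - k)))"
proof
  fix n assume k: "k \<le> int m"
  show "ppow p (- k) n = of_approx p m (\<lambda>t. int p ^ min t (nat (int m - k))) n"
  proof (cases "n + int m \<le> 0")
    case True
    then show ?thesis using k by (simp add: of_approx_def ppow_def)
  next
    case False
    define t where "t = nat (n + int m)"
    define e where "e = nat (int m - k)"
    have n: "n = int t - int m" and ke: "k = int m - int e" using False k by (simp_all add: t_def e_def)
    show ?thesis
    proof (cases "t \<le> e")
      case True
      then show ?thesis by (simp add: of_approx_def ppow_def n ke min_absorb1)
    next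
      case lt: False
      then have "int p ^ e < int p ^ t" using p_gt_1 by (intro power_strict_increasing) auto
      then have "int p ^ e mod int p ^ t = int p ^ e" by simp
      moreover have "(of_nat p :: rat) powi (int e - int m) = of_nat p ^ e / of_nat p ^ m"
        using p_gt_0 by (simp add: power_int_diff)
      ultimately show ?thesis using lt by (simp add: of_approx_def ppow_def n ke min_absorb2)
    qed
  qed
qed

section \<open>Singular numbers\<close>

lemma diagm_eq:
  assumes "bounded_by m k" "length k = N"
  shows "diagm p N k = of_amat p N m (\<lambda>t. mdiag p (\<lambda>i. exps m (k ! i) t))"
proof (rule ext, clarify)
  fix i j
  \<comment> \<open>At level t the power p^t is zero, so the zero entry belonging to
    \<open>NegInf\<close> fits the pattern of the finite entries, with exponent t at level
    t.\<close>
  have z: "pzero = of_approx p m (\<lambda>t. int p ^ t)"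
    unfolding pzero_eq[of m] by (rule of_approx_cong) (simp add: cong_def)
  show "diagm p N k (i, j) = of_amat p N m (\<lambda>t. mdiag p (\<lambda>i. exps m (k ! i) t)) (i, j)"
  proof (cases "i < N \<and> i = j")
    case True
    show ?thesis
    proof (cases "k ! i")
      case NegInf
      then show ?thesis using True z by (simp add: diagm_def of_amat_def mdiag_def exps_def)
    next
      case (Fin a)
      then have "a \<le> int m" using assms True by (auto simp: bounded_by_def dest: spec[of _ i])
      then show ?thesis using True Fin of_approx_power[of a m]
        by (simp add: diagm_def of_amat_def mdiag_def exps_def)
    qed
  next
    case False
    then show ?thesis by (auto simp: diagm_def of_amat_def mdiag_def pzero_eq[of m])
  qed
qed

text \<open>The exponent can change between levels t and t + 1 only while it is still truncated, and
  then both powers vanish modulo p^t.\<close>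

lemma exps_cong: "[int p ^ exps m k (Suc t) = int p ^ exps m k t] (mod int p ^ t)"
proof (cases "exps m k (Suc t) = exps m k t")
  case False
  then have "exps m k t = t" "exps m k (Suc t) = Suc t"
    by (auto simp: exps_def min_def split: zinf.splits if_splits)
  then show ?thesis by (simp add: cong_def)
qed simp

lemma mcoherent_mdiag: "mcoherent p N (\<lambda>t. mdiag p (\<lambda>i. exps m (k ! i) t))"
  by (simp add: mcoherent_def mcong_def mdiag_def exps_cong)

lemma diagm_latm:
  assumes "bounded_by m k" "length k = N"
  shows "diagm p N k \<in> latm p N m"
    "mcong (int p ^ t) N (amat p m (diagm p N k) t) (mdiag p (\<lambda>i. exps m (k ! i) t))"
  unfolding diagm_eq[OF assms]
  by (intro of_amat_latm mcoherent_mdiag) (rule amat_of_amat)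

lemma GLZp_minverses:
  assumes "B \<in> GLZp p N"
  obtains C where "B \<in> latm p N 0" "\<And>t. minverses (int p ^ t) N (amat p 0 B t) (amat p 0 C t)"
proof -
  obtain C where C: "B \<in> latm p N 0" "C \<in> latm p N 0" "mmul p N B C = idm N" "mmul p N C B = idm N"
    using assms unfolding GLZp_def ZpMat_eq by auto
  have one: "mcong (int p ^ t) N (amat p 0 (idm N) t) mone" for t
    unfolding idm_eq by (rule amat_of_amat)
  have "minverses (int p ^ t) N (amat p 0 B t) (amat p 0 C t)" for t
    using mcong_trans[OF mcong_sym[OF mmul_latm(2)[OF C(1,2), unfolded C(3) add_0]] one]
      mcong_trans[OF mcong_sym[OF mmul_latm(2)[OF C(2,1), unfolded C(4) add_0]] one]
    unfolding minverses_def by blast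
  then show ?thesis using that C by blast
qed

text \<open>The inverses at the individual levels have to be coherent too, in order to define a
  matrix over Z_p. This is why \<open>padic_snf\<close> carries U' and V' along in its inverse
  system.\<close>

lemma GLZpI:
  assumes "mcoherent p N U" "mcoherent p N U'" and inv: "\<And>t. minverses (int p ^ t) N (U t) (U' t)"
  shows "of_amat p N 0 U \<in> GLZp p N"
proof -
  have mul: "mmul p N (of_amat p N 0 X) (of_amat p N 0 Y) = idm N"
    if X: "mcoherent p N X" "mcoherent p N Y" "\<And>t. mcong (int p ^ t) N (mprod N (X t) (Y t)) mone" for X Y
  proof (rule latm_eqI)
    note l = of_amat_latm[OF X(1), of 0] of_amat_latm[OF X(2), of 0]
    show "mmul p N (of_amat p N 0 X) (of_amat p N 0 Y) \<in> latm p N 0"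
      using mmul_latm(1)[OF l] by simp
    have c: "mcoherent p N (\<lambda>_. mone)" by (simp add: mcoherent_def)
    show "idm N \<in> latm p N 0" unfolding idm_eq using c by (rule of_amat_latm)
    fix t
    have "mcong (int p ^ t) N (amat p 0 (mmul p N (of_amat p N 0 X) (of_amat p N 0 Y)) t)
       (mprod N (amat p 0 (of_amat p N 0 X) t) (amat p 0 (of_amat p N 0 Y) t))"
      using mmul_latm(2)[OF l, of t] by simp
    also have "mcong (int p ^ t) N \<dots> (mprod N (X t) (Y t))"
      by (intro mcong_mprod amat_of_amat)
    also note X(3)
    also have "mcong (int p ^ t) N mone (amat p 0 (idm N) t)"
      unfolding idm_eq by (intro mcong_sym[OF amat_of_amat])
    finally show "mcong (int p ^ t) N (amat p 0 (mmul p N (of_amat p N 0 X) (of_amat p N 0 Y)) t) (amat p 0 (idm N) t)" .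
  qed
  have "mmul p N (of_amat p N 0 U) (of_amat p N 0 U') = idm N" "mmul p N (of_amat p N 0 U') (of_amat p N 0 U) = idm N"
    using mul[OF assms(1,2)] mul[OF assms(2,1)] inv unfolding minverses_def by auto
  then show ?thesis unfolding GLZp_def ZpMat_eq using of_amat_latm assms(1,2) by blast
qed

section \<open>Existence and uniqueness of the singular numbers\<close>

lemma factors_mequiv:
  assumes f: "factors p N k Z" and b: "bounded_by m k"
  shows "Z \<in> latm p N m" "mequiv (int p ^ t) N (amat p m Z t) (mdiag p (\<lambda>i. exps m (k ! i) t))"
proof -
  obtain B C where BC: "k \<in> Delta N" "B \<in> GLZp p N" "C \<in> GLZp p N" "Z = mmul p N (mmul p N B (diagm p N k)) C"
    using f unfolding factors_def by blast
  have len: "length k = N" using BC(1) by (simp add: Delta_def)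
  note D = diagm_latm[OF b len]
  obtain B' where B: "B \<in> latm p N 0" "\<And>t. minverses (int p ^ t) N (amat p 0 B t) (amat p 0 B' t)"
    using GLZp_minverses[OF BC(2)] by blast
  obtain C' where C: "C \<in> latm p N 0" "\<And>t. minverses (int p ^ t) N (amat p 0 C t) (amat p 0 C' t)"
    using GLZp_minverses[OF BC(3)] by blast
  note BD = mmul_latm[OF B(1) D(1), unfolded add_0]
  note BDC = mmul_latm[OF BD(1) C(1), unfolded add_0_right]
  show "Z \<in> latm p N m" unfolding BC(4) by (rule BDC)
  have "mcong (int p ^ t) N (amat p m Z t) (mprod N (amat p m (mmul p N B (diagm p N k)) t) (amat p 0 C t))"
    unfolding BC(4) by (rule BDC)
  also have "mcong (int p ^ t) N \<dots> (mprod N (mprod N (amat p 0 B t) (amat p m (diagm p N k) t)) (amat p 0 C t))"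
    by (intro mcong_mprod mcong_refl BD(2))
  also have "mcong (int p ^ t) N \<dots> (mprod N (mprod N (amat p 0 B t) (mdiag p (\<lambda>i. exps m (k ! i) t))) (amat p 0 C t))"
    by (intro mcong_mprod mcong_refl D(2))
  finally show "mequiv (int p ^ t) N (amat p m Z t) (mdiag p (\<lambda>i. exps m (k ! i) t))"
    unfolding mequiv_def using B(2) C(2) by blast
qed

lemma factors_card_left_ker:
  assumes f: "factors p N k Z" and b: "bounded_by m k"
  shows "card (left_ker p n {..<N} (column_set N (amat p m Z n))) = p ^ (\<Sum>i<n. cnt k (int m - int i - 1))"
proof -
  have len: "length k = N" using f by (simp add: factors_def Delta_def)
  have "exps m (k ! i) n \<le> n" for i by (auto simp: exps_def split: zinf.split)
  then show ?thesis
    using card_left_ker_mequiv[OF factors_mequiv(2)[OF f b] p_gt_0] sum_exps[OF b, of n] len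
    by (simp add: card_left_ker_mdiag[OF _ p_gt_0])
qed

text \<open>Below level m the counts are differences of consecutive partial sums; from m on, all
  entries are counted.\<close>

lemma cnt_eqI:
  assumes k: "bounded_by m k" and k': "bounded_by m k'" and len: "length k = length k'"
    and e: "\<And>n. (\<Sum>i<n. cnt k (int m - int i - 1)) = (\<Sum>i<n. cnt k' (int m - int i - 1))"
  shows "cnt k z = cnt k' z"
proof (cases "int m \<le> z")
  case True
  then show ?thesis using cnt_eq_length[OF k] cnt_eq_length[OF k'] len by simp
next
  case False
  define n where "n = nat (int m - 1 - z)"
  have z: "z = int m - int n - 1" using False by (simp add: n_def)
  show ?thesis using e[of n] e[of "Suc n"] by (simp add: z)
qed

text \<open>Both factorizations are viewed in one lattice that contains them; the kernel sizes
  depend on Z alone and determine all counts.\<close>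

lemma factors_unique:
  assumes f: "factors p N k Z" and f': "factors p N k' Z"
  shows "k = k'"
proof -
  obtain a b where "bounded_by a k" "bounded_by b k'" using ex_bounded_by by meson
  then have m: "bounded_by (max a b) k" "bounded_by (max a b) k'"
    using bounded_by_mono max.cobounded1 max.cobounded2 by blast+
  have D: "k \<in> Delta N" "k' \<in> Delta N" using f f' by (auto simp: factors_def)
  have "(\<Sum>i<n. cnt k (int (max a b) - int i - 1)) = (\<Sum>i<n. cnt k' (int (max a b) - int i - 1))" for n
    using factors_card_left_ker[OF f m(1), of n] factors_card_left_ker[OF f' m(2), of n] p_gt_1 by simp
  then have "cnt k z = cnt k' z" for z
    using D by (intro cnt_eqI[OF m]) (auto simp: Delta_def)
  then show ?thesis by (rule Delta_eqI[OF D])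
qed

lemma exps_le_imp_zle:
  assumes "zle a (Fin (int m))" "zle b (Fin (int m))" "\<And>t. exps m a t \<le> exps m b t"
  shows "zle b a"
proof (cases a; cases b)
  fix x assume ab: "a = NegInf" "b = Fin x"
  \<comment> \<open>A level above the finite exponent tells it apart from the infinite one, whose
    truncations keep growing.\<close>
  then show ?thesis using assms(3)[of "Suc (nat (int m - x))"] by (simp add: exps_def)
next
  fix x y assume ab: "a = Fin x" "b = Fin y"
  then show ?thesis using assms(3)[of "Suc (nat (int m - x) + nat (int m - y))"] assms(1,2)
    by (auto simp: exps_def min_def split: if_splits)
qed auto

text \<open>The coherent Smith factorizations of the approximations glue to one over Z_p. A limiting
  exponent L becomes the singular number m - L, and an infinite one becomes \<open>NegInf\<close>;
  increasing exponents give a decreasing k.\<close>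

lemma factors_exists:
  assumes Z: "Z \<in> latm p N m"
  obtains k where "factors p N k Z" "bounded_by m k"
proof -
  have "mcong (int p ^ n) N (amat p m Z (Suc n)) (amat p m Z n)" for n
    using mcoherent_amat[OF Z] by (simp add: mcoherent_def)
  from padic_snf[OF p this]
  obtain U U' V V' l where inv: "\<And>n. minverses (int p ^ n) N (U n) (U' n)" "\<And>n. minverses (int p ^ n) N (V n) (V' n)"
    and fac: "\<And>n. mcong (int p ^ n) N (amat p m Z n) (mprod N (mprod N (U n) (mdiag p (l n))) (V n))"
    and coh: "\<And>n. mcong (int p ^ n) N (U (Suc n)) (U n)" "\<And>n. mcong (int p ^ n) N (U' (Suc n)) (U' n)"
    "\<And>n. mcong (int p ^ n) N (V (Suc n)) (V n)" "\<And>n. mcong (int p ^ n) N (V' (Suc n)) (V' n)"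
    and l: "\<And>n i. i < N \<Longrightarrow> l n i = min (l (Suc n) i) n" "\<And>n i j. i \<le> j \<Longrightarrow> j < N \<Longrightarrow> l n i \<le> l n j"
    by blast
  have "\<exists>x. zle x (Fin (int m)) \<and> (\<forall>n. l n i = exps m x n)" if "i < N" for i
    using min_sequence[of "\<lambda>n. l n i", OF l(1)[OF that]]
  proof
    assume "\<forall>n. l n i = n"
    then show ?thesis by (intro exI[of _ NegInf]) (simp add: exps_def)
  next
    assume "\<exists>L. \<forall>n. l n i = min n L"
    then obtain L where "\<forall>n. l n i = min n L" by blast
    then show ?thesis by (intro exI[of _ "Fin (int m - int L)"]) (simp add: exps_def)
  qed
  then obtain x where x: "\<And>i. i < N \<Longrightarrow> zle (x i) (Fin (int m))" "\<And>i n. i < N \<Longrightarrow> l n i = exps m (x i) n"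
    by metis
  define k where "k = map x [0..<N]"
  have len: "length k = N" by (simp add: k_def)
  have b: "bounded_by m k" using x by (simp add: bounded_by_def k_def)
  have "zle (k ! j) (k ! i)" if "i < j" "j < N" for i j
  proof (rule exps_le_imp_zle)
    show "zle (k ! i) (Fin (int m))" "zle (k ! j) (Fin (int m))" using x(1) that by (simp_all add: k_def)
    show "exps m (k ! i) t \<le> exps m (k ! j) t" for t
      using l(2)[of i j t] x(2)[of i t] x(2)[of j t] that by (simp add: k_def)
  qed
  then have Delta: "k \<in> Delta N" by (simp add: Delta_def len sorted_wrt_iff_nth_less)
  have cU: "mcoherent p N U" "mcoherent p N U'" "mcoherent p N V" "mcoherent p N V'"
    using coh by (auto simp: mcoherent_def)
  let ?B = "of_amat p N 0 U" and ?C = "of_amat p N 0 V"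
  have BC: "?B \<in> GLZp p N" "?C \<in> GLZp p N"
    using GLZpI[OF cU(1,2) inv(1)] GLZpI[OF cU(3,4) inv(2)] by auto
  note D = diagm_latm[OF b len]
  note BD = mmul_latm[OF of_amat_latm[OF cU(1), of 0] D(1), unfolded add_0]
  note BDC = mmul_latm[OF BD(1) of_amat_latm[OF cU(3), of 0], unfolded add_0_right]
  have "Z = mmul p N (mmul p N ?B (diagm p N k)) ?C"
  proof (rule latm_eqI[OF Z BDC(1)])
    fix t
    have ld: "mcong (int p ^ t) N (mdiag p (l t)) (amat p m (diagm p N k) t)"
    proof (rule mcong_trans[OF _ mcong_sym[OF D(2)]])
      show "mcong (int p ^ t) N (mdiag p (l t)) (mdiag p (\<lambda>i. exps m (k ! i) t))"
        using x(2) by (simp add: mcong_def mdiag_def k_def)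
    qed
    note fac[of t]
    also have "mcong (int p ^ t) N (mprod N (mprod N (U t) (mdiag p (l t))) (V t))
      (mprod N (mprod N (amat p 0 ?B t) (amat p m (diagm p N k) t)) (amat p 0 ?C t))"
      by (intro mcong_mprod ld mcong_sym[OF amat_of_amat])
    also have "mcong (int p ^ t) N \<dots> (mprod N (amat p m (mmul p N ?B (diagm p N k)) t) (amat p 0 ?C t))"
      by (intro mcong_mprod mcong_refl mcong_sym[OF BD(2)])
    also have "mcong (int p ^ t) N \<dots> (amat p m (mmul p N (mmul p N ?B (diagm p N k)) ?C) t)"
      by (rule mcong_sym[OF BDC(2)])
    finally show "mcong (int p ^ t) N (amat p m Z t) (amat p m (mmul p N (mmul p N ?B (diagm p N k)) ?C) t)" .
  qed
  then have "factors p N k Z" unfolding factors_def using BC Delta by blast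
  then show ?thesis using that b by blast
qed

lemma QpMat_latm:
  assumes Z: "Z \<in> QpMat p N"
  obtains m where "Z \<in> latm p N m"
proof -
  define m where "m = Max (insert 0 ((\<lambda>x. nd (Z x)) ` ({..<N} \<times> {..<N})))"
  have "Z (i, j) (- int m) = 0" if ij: "i < N" "j < N" for i j
  proof -
    have x: "Z (i, j) \<in> Qp p" using Z ij by (simp add: QpMat_def)
    have "nd (Z (i, j)) \<le> m" unfolding m_def using ij by (intro Max_ge) auto
    then show ?thesis using Qp_zero_below[OF x nd_zero[OF x]] by simp
  qed
  then show ?thesis using that[of m] Z by (simp add: latm_def)
qed

lemma Sing_eq_iff_factors:
  assumes "Z \<in> QpMat p N"
  shows "Sing p N Z = k \<longleftrightarrow> factors p N k Z"
proof -
  obtain m where "Z \<in> latm p N m" using QpMat_latm[OF assms] .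
  then obtain k' where k': "factors p N k' Z" using factors_exists by blast
  have "Sing p N Z = k'"
    unfolding Sing_def factors_def[symmetric]
  proof (rule the_equality)
    show "factors p N k' Z" by (rule k')
    show "x = k'" if "factors p N x Z" for x by (rule factors_unique[OF that k'])
  qed
  then show ?thesis using k' factors_unique by blast
qed

lemma left_ker_amat:
  assumes "Z \<in> latm p N m" "j \<le> n"
  shows "left_ker p j {..<N} (column_set N (amat p m Z n)) = left_ker p j {..<N} (column_set N (amat p m Z j))"
proof (rule left_ker_column_set_cong)
  fix i l assume "i < N" "l < N"
  then show "[amat p m Z n (i, l) = amat p m Z j (i, l)] (mod int p ^ j)"
    using coherent_cong[OF mcoherentD[OF mcoherent_amat[OF assms(1)]] assms(2)] by blast
qed

text \<open>The kernel modulo p^j can be computed from any approximation of level n \<ge> j, so the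
  conditions for all n amount to one kernel size per level. For the converse, Z has some singular
  numbers k' bounded by m, and equal kernel sizes give k' = k.\<close>

theorem Sing_eq_iff:
  assumes Z: "Z \<in> QpMat p N" and k: "k \<in> Delta N" and b: "bounded_by m k"
  shows "Sing p N Z = k \<longleftrightarrow> Z \<in> latm p N m \<and>
    (\<forall>n. ker_type p n {..<N} (column_set N (amat p m Z n)) (coranks m k))"
proof -
  have kt: "(\<forall>n. ker_type p n {..<N} (column_set N (amat p m Z n)) r) \<longleftrightarrow>
      (\<forall>n. card (left_ker p n {..<N} (column_set N (amat p m Z n))) = p ^ (\<Sum>i<n. r i))"
    if "Z \<in> latm p N m" for r
    unfolding ker_type_def using left_ker_amat[OF that] by (metis order_refl)
  show ?thesis unfolding Sing_eq_iff_factors[OF Z]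
  proof
    assume "factors p N k Z"
    then show "Z \<in> latm p N m \<and>
      (\<forall>n. ker_type p n {..<N} (column_set N (amat p m Z n)) (coranks m k))"
      using kt factors_mequiv(1)[OF _ b] factors_card_left_ker[OF _ b] by blast
  next
    assume *: "Z \<in> latm p N m \<and>
      (\<forall>n. ker_type p n {..<N} (column_set N (amat p m Z n)) (coranks m k))"
    then obtain k' where k': "factors p N k' Z" "bounded_by m k'" using factors_exists by blast
    have D: "k' \<in> Delta N" using k' by (simp add: factors_def)
    have "(\<Sum>i<n. cnt k (int m - int i - 1)) = (\<Sum>i<n. cnt k' (int m - int i - 1))" for n
    proof -
      have "card (left_ker p n {..<N} (column_set N (amat p m Z n))) = p ^ (\<Sum>i<n. cnt k (int m - int i - 1))"
        using * kt by blast
      then show ?thesis using factors_card_left_ker[OF k', of n] p_gt_1 by simp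
    qed
    then have "cnt k z = cnt k' z" for z
      using D k by (intro cnt_eqI[OF b k'(2)]) (auto simp: Delta_def)
    then have "k = k'" by (rule Delta_eqI[OF k D])
    then show "factors p N k Z" using k' by simp
  qed
qed

section \<open>The Haar measure\<close>

lemma prob_space_digit: "prob_space (uniform_digit p)"
  using p_gt_0 by (intro prob_space_uniform_count_measure) auto

lemma digit_space_less: "d \<in> space (digit_space p N) \<Longrightarrow> i < N \<Longrightarrow> j < N \<Longrightarrow> d (i, j, t) < p"
  by (auto simp: space_PiM PiE_iff space_uniform_count_measure)

lemma digits_to_mat_eq:
  assumes d: "d \<in> space (digit_space p N)"
  shows "digits_to_mat p N m d = of_amat p N m (\<lambda>n (i, j). \<Sum>t<n. int (d (i, j, t)) * int p ^ t)"
proof (rule ext, clarify)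
  fix i j
  show "digits_to_mat p N m d (i, j) = of_amat p N m (\<lambda>n (i, j). \<Sum>t<n. int (d (i, j, t)) * int p ^ t) (i, j)"
  proof (cases "i < N \<and> j < N")
    case True
    have "(\<Sum>t<nat (n + int m). of_nat (d (i, j, t)) * of_nat p powi (int t - int m)) =
      of_approx p m (\<lambda>n. \<Sum>t<n. int (d (i, j, t)) * int p ^ t) n" for n
    proof (cases "n + int m \<le> 0")
      case False
      have "(\<Sum>t<n. int (d (i, j, t)) * int p ^ t) mod int p ^ n = (\<Sum>t<n. int (d (i, j, t)) * int p ^ t)" for n
        using True digit_space_less[OF d] by (intro mod_pos_pos_trivial sum_nonneg digit_sum_less) auto
      then show ?thesis using False p_gt_0
        by (simp add: of_approx_def sum_divide_distrib power_int_diff)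
    qed (simp add: of_approx_def)
    then show ?thesis using True by (simp add: digits_to_mat_def of_amat_def)
  qed (auto simp: digits_to_mat_def of_amat_def)
qed

lemma mcoherent_digits: "mcoherent p N (\<lambda>n (i, j). \<Sum>t<n. int (d (i, j, t)) * int p ^ t)"
  by (simp add: mcoherent_def mcong_def cong_def)

lemma digits_to_mat_latm:
  assumes "d \<in> space (digit_space p N)"
  shows "digits_to_mat p N m d \<in> latm p N m"
  unfolding digits_to_mat_eq[OF assms] by (rule of_amat_latm[OF mcoherent_digits])

lemma amat_digits_to_mat:
  assumes d: "d \<in> space (digit_space p N)" and ij: "i < N" "j < N"
  shows "amat p m (digits_to_mat p N m d) n (i, j) = (\<Sum>t<n. int (d (i, j, t)) * int p ^ t)"
proof -
  have "(\<Sum>t<n. int (d (i, j, t)) * int p ^ t) mod int p ^ n = (\<Sum>t<n. int (d (i, j, t)) * int p ^ t)"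
    using ij digit_space_less[OF d] by (intro mod_pos_pos_trivial sum_nonneg digit_sum_less) auto
  then show ?thesis using ij
    unfolding digits_to_mat_eq[OF d] by (simp add: amat_def of_amat_def approx_of_approx)
qed

lemma measurable_digit:
  assumes "i < N" "j < N"
  shows "(\<lambda>d. h (d (i, j, t))) \<in> measurable (digit_space p N) (count_space UNIV)"
proof -
  have "(\<lambda>d. d (i, j, t)) \<in> measurable (digit_space p N) (uniform_digit p)"
    using assms by (intro measurable_component_singleton) auto
  moreover have "h \<in> measurable (uniform_digit p) (count_space UNIV)"
    by (subst measurable_cong_sets[OF sets_uniform_count_measure_count_space refl]) simp
  ultimately show ?thesis by (rule measurable_compose)
qed

lemma measurable_digits_to_mat: "digits_to_mat p N m \<in> measurable (digit_space p N) (MatSp p N)"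
proof (rule measurable_MatSp_I)
  show "digits_to_mat p N m d \<in> QpMat p N" if "d \<in> space (digit_space p N)" for d
    using digits_to_mat_latm[OF that] latm_QpMat by blast
  fix x :: "nat \<times> nat" and n
  obtain i j where x: "x = (i, j)" by force
  show "(\<lambda>d. digits_to_mat p N m d x n) \<in> measurable (digit_space p N) (count_space UNIV)"
  proof (cases "i < N \<and> j < N")
    case True
    then show ?thesis
      by (simp add: digits_to_mat_def x)
        (intro measurable_count_space_sum measurable_digit[where h = "\<lambda>c. of_nat c * _"], auto)
  qed (auto simp: digits_to_mat_def x)
qed

lemma sets_latt [simp, measurable_cong]: "sets (latt p N m) = sets (MatSp p N)"
  by (simp add: latt_def)

lemma prob_space_latt: "prob_space (latt p N m)"
  unfolding latt_def
  by (intro prob_space.prob_space_distr prob_space_PiM prob_space_digit measurable_digits_to_mat)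

lemma amat_set_sets:
  "residue_class p N m n A \<in> sets (MatSp p N)"
proof -
  have "(\<lambda>Z. approx p m (Z x) n) \<in> measurable (MatSp p N) (count_space UNIV)" for x
    unfolding approx_def by (rule measurable_compose[OF measurable_MatSp_entry]) simp
  then have "Measurable.pred (MatSp p N) (\<lambda>Z. approx p m (Z x) n = A x)" for x
    by measurable
  then have "Measurable.pred (MatSp p N) (\<lambda>Z. \<forall>x\<in>{..<N} \<times> {..<N}. approx p m (Z x) n = A x)"
    by (intro pred_intros_finite) auto
  then show ?thesis by (simp add: amat_def pred_def)
qed

lemma latm_sets: "latm p N m \<in> sets (MatSp p N)"
proof -
  have "Measurable.pred (MatSp p N) (\<lambda>Z. \<forall>x\<in>{..<N} \<times> {..<N}. Z x (- int m) = 0)"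
    by (intro pred_intros_finite) measurable
  moreover have "latm p N m = {Z \<in> QpMat p N. \<forall>x\<in>{..<N} \<times> {..<N}. Z x (- int m) = 0}"
    by (auto simp: latm_def)
  ultimately show ?thesis by (simp add: pred_def)
qed

text \<open>A residue class fixes the n lowest digits in each of the N * N entries, hence n * N * N
  independent uniform digits.\<close>

lemma latt_cylinder:
  assumes A: "A \<in> int_matrices p N n"
  shows "measure (latt p N m) (residue_class p N m n A) = (1 / real p) ^ (n * N * N)"
proof -
  interpret D: product_prob_space "\<lambda>_. uniform_digit p" "{..<N} \<times> {..<N} \<times> (UNIV :: nat set)"
    by (rule product_prob_spaceI[OF prob_space_digit])
  have "\<exists>e. \<forall>x\<in>{..<N} \<times> {..<N}. (\<forall>t<n. e x t < p) \<and> (\<forall>d. (\<forall>t<n. d t < p) \<longrightarrow>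
     ((\<Sum>t<n. int (d t) * int p ^ t) = A x \<longleftrightarrow> (\<forall>t<n. d t = e x t)))"
  proof (rule bchoice, rule ballI)
    fix x assume "x \<in> {..<N} \<times> {..<N}"
    then have "0 \<le> A x" "A x < int p ^ n" using A by (auto simp: PiE_iff)
    then show "\<exists>e. (\<forall>t<n. e t < p) \<and> (\<forall>d. (\<forall>t<n. d t < p) \<longrightarrow>
     ((\<Sum>t<n. int (d t) * int p ^ t) = A x \<longleftrightarrow> (\<forall>t<n. d t = e t)))"
      by (rule digits_exist) blast
  qed
  then obtain e where E: "\<forall>x\<in>{..<N} \<times> {..<N}. (\<forall>t<n. e x t < p) \<and> (\<forall>d. (\<forall>t<n. d t < p) \<longrightarrow>
     ((\<Sum>t<n. int (d t) * int p ^ t) = A x \<longleftrightarrow> (\<forall>t<n. d t = e x t)))" by (rule exE)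
  have e: "e x t < p" if "x \<in> {..<N} \<times> {..<N}" "t < n" for x t
    using bspec[OF E that(1)] that(2) by simp
  have e2: "(\<Sum>t<n. int (d t) * int p ^ t) = A x \<longleftrightarrow> (\<forall>t<n. d t = e x t)"
    if "x \<in> {..<N} \<times> {..<N}" "\<And>t. t < n \<Longrightarrow> d t < p" for x d
    using bspec[OF E that(1)] that(2) by simp
  let ?C = "residue_class p N m n A"
  let ?J = "{..<N} \<times> {..<N} \<times> {..<n}"
  have "digits_to_mat p N m -` ?C \<inter> space (digit_space p N) =
     {d \<in> space (digit_space p N). \<forall>y\<in>?J. d y \<in> (case y of (i, j, t) \<Rightarrow> {e (i, j) t})}" (is "?L = ?R")
  proof -
    have "digits_to_mat p N m d \<in> ?C \<longleftrightarrow> (\<forall>y\<in>?J. d y \<in> (case y of (i, j, t) \<Rightarrow> {e (i, j) t}))"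
      if d: "d \<in> space (digit_space p N)" for d
    proof -
      have "digits_to_mat p N m d \<in> ?C \<longleftrightarrow> (\<forall>i<N. \<forall>j<N. (\<Sum>t<n. int (d (i, j, t)) * int p ^ t) = A (i, j))"
        using latm_QpMat[OF digits_to_mat_latm[OF d, of m]] by (auto simp: amat_digits_to_mat[OF d])
      also have "\<dots> \<longleftrightarrow> (\<forall>i<N. \<forall>j<N. \<forall>t<n. d (i, j, t) = e (i, j) t)"
      proof -
        have "(\<Sum>t<n. int (d (i, j, t)) * int p ^ t) = A (i, j) \<longleftrightarrow> (\<forall>t<n. d (i, j, t) = e (i, j) t)"
          if "i < N" "j < N" for i j
          using that digit_space_less[OF d that] by (intro e2) auto
        then show ?thesis by blast
      qed
      also have "\<dots> \<longleftrightarrow> (\<forall>y\<in>?J. d y \<in> (case y of (i, j, t) \<Rightarrow> {e (i, j) t}))" by auto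
      finally show ?thesis .
    qed
    then show ?thesis by blast
  qed
  then have "emeasure (latt p N m) ?C = emeasure (digit_space p N) ?R"
    unfolding latt_def emeasure_distr[OF measurable_digits_to_mat amat_set_sets] by (simp only:)
  also have "\<dots> = (\<Prod>y\<in>?J. emeasure (uniform_digit p) (case y of (i, j, t) \<Rightarrow> {e (i, j) t}))"
    using e by (intro D.emeasure_PiM_Collect) (auto simp: sets_uniform_count_measure)
  also have "\<dots> = (\<Prod>y\<in>?J. ennreal (1 / real p))"
    using e by (intro prod.cong) (auto simp: emeasure_uniform_count_measure)
  also have "\<dots> = ennreal ((1 / real p) ^ (n * N * N))"
    by (simp add: ennreal_power mult_ac)
  finally show ?thesis by (simp add: measure_def)
qed

text \<open>The event depends on Z only through finitely many residues; this form gives both its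
  measurability and, by counting residue classes, its probability.\<close>

lemma latm_ker_type_eq:
  "lattice_event p N m n r =
     latm p N m \<inter> (\<Union>A\<in>{A \<in> int_matrices p N n. ker_type p n {..<N} (column_set N A) r}.
       (residue_class p N m n A))"
proof -
  have kt: "ker_type p n {..<N} (column_set N X) r \<longleftrightarrow> ker_type p n {..<N} (column_set N Y) r"
    if "\<forall>x\<in>{..<N} \<times> {..<N}. X x = Y x" for X Y
    using that by (intro ker_type_cong left_ker_column_set_cong) auto
  have range: "restrict (amat p m Z n) ({..<N} \<times> {..<N}) \<in> int_matrices p N n"
    if "Z \<in> latm p N m" for Z
    using approx_range[OF latmD[OF that]] by (auto simp: amat_def)
  show ?thesis
  proof (intro equalityI subsetI)
    fix Z assume Z: "Z \<in> lattice_event p N m n r"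
    let ?A = "restrict (amat p m Z n) ({..<N} \<times> {..<N})"
    have *: "ker_type p n {..<N} (column_set N ?A) r" using Z kt[of ?A "amat p m Z n"] by auto
    then show "Z \<in> latm p N m \<inter> (\<Union>A\<in>{A \<in> int_matrices p N n. ker_type p n {..<N} (column_set N A) r}.
       (residue_class p N m n A))"
    proof (intro IntI UN_I)
      show "?A \<in> {A \<in> int_matrices p N n. ker_type p n {..<N} (column_set N A) r}"
        using * range[of Z] Z by blast
      show "Z \<in> {Z \<in> QpMat p N. \<forall>x\<in>{..<N} \<times> {..<N}. amat p m Z n x = ?A x}"
        using Z latm_QpMat[of Z] by auto
    qed (use Z in blast)
  next
    fix Z assume "Z \<in> latm p N m \<inter> (\<Union>A\<in>{A \<in> int_matrices p N n. ker_type p n {..<N} (column_set N A) r}.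
       (residue_class p N m n A))"
    then obtain A where "Z \<in> latm p N m" "ker_type p n {..<N} (column_set N A) r"
      "\<forall>x\<in>{..<N} \<times> {..<N}. amat p m Z n x = A x" by blast
    then show "Z \<in> lattice_event p N m n r"
      using kt[of "amat p m Z n" A] by auto
  qed
qed

lemma finite_matrices: "finite (int_matrices p N n)"
  by (intro finite_PiE) auto

lemma latm_ker_type_sets:
  "lattice_event p N m n r \<in> sets (MatSp p N)"
  unfolding latm_ker_type_eq using finite_matrices
  by (intro sets.Int latm_sets sets.finite_UN amat_set_sets) auto

lemma emeasure_latt_latm: "AE Z in latt p N m. Z \<in> latm p N m"
proof -
  have "{Z \<in> QpMat p N. Z \<in> latm p N m} = latm p N m" by (auto simp: latm_def)
  then show ?thesis unfolding latt_def using latm_sets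
    by (subst AE_distr_iff) (auto simp: measurable_digits_to_mat digits_to_mat_latm)
qed

lemma measure_latt_ker_type:
  "measure (latt p N m) (lattice_event p N m n r) =
     type_prob (1 / real p) n N r"
proof -
  interpret prob_space "latt p N m" by (rule prob_space_latt)
  let ?S = "{A \<in> int_matrices p N n. ker_type p n {..<N} (column_set N A) r}"
  let ?C = "\<lambda>A. residue_class p N m n A"
  have fin: "finite ?S" using finite_matrices by simp
  have disj: "disjoint_family_on ?C ?S"
    unfolding disjoint_family_on_def
  proof (intro ballI impI equals0I)
    fix A B Z assume AB: "A \<in> ?S" "B \<in> ?S" "A \<noteq> B" and "Z \<in> ?C A \<inter> ?C B"
    then have "A x = B x" if "x \<in> {..<N} \<times> {..<N}" for x using that by force
    then have "A = B" using AB by (intro PiE_ext[of A "{..<N} \<times> {..<N}" "\<lambda>_. {0..<int p ^ n}" B]) auto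
    then show False using AB by simp
  qed
  \<comment> \<open>A residue class is a subset of all of \<open>QpMat\<close>; intersecting it with
    the lattice changes only a null set, since \<open>latt\<close> is concentrated there.\<close>
  have "measure (latt p N m) (latm p N m \<inter> (\<Union>A\<in>?S. ?C A)) = measure (latt p N m) (\<Union>A\<in>?S. ?C A)"
  proof (rule measure_eq_AE)
    show "AE x in latt p N m. (x \<in> latm p N m \<inter> (\<Union>A\<in>?S. ?C A)) = (x \<in> (\<Union>A\<in>?S. ?C A))"
      using emeasure_latt_latm by eventually_elim blast
  qed (use fin amat_set_sets latm_sets in \<open>auto intro!: sets.Int\<close>)
  also have "\<dots> = (\<Sum>A\<in>?S. measure (latt p N m) (?C A))"
    using fin disj amat_set_sets by (intro finite_measure_finite_Union) auto
  also have "\<dots> = (\<Sum>A\<in>?S. (1 / real p) ^ (n * N * N))"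
    by (intro sum.cong refl latt_cylinder) auto
  also have "\<dots> = type_prob (1 / real p) n N r"
    using card_matrices_ker_type[OF p, of N n r] p_gt_0 by (simp add: power_one_over)
  finally show ?thesis unfolding latm_ker_type_eq .
qed

section \<open>Comparison of neighbouring lattices\<close>

lemma shift_digits_measurable: "shift_digits N \<in> measurable (digit_space p N) (digit_space p N)"
  unfolding shift_digits_def
proof (rule measurable_restrict)
  fix y :: "nat \<times> nat \<times> nat" assume y: "y \<in> {..<N} \<times> {..<N} \<times> UNIV"
  obtain i j t where "y = (i, j, t)" by (rule prod_cases3)
  then show "(\<lambda>d. case y of (i, j, t) \<Rightarrow> d (i, j, Suc t)) \<in> measurable (digit_space p N) (uniform_digit p)"
    using y by (auto intro!: measurable_component_singleton)
qed

lemma digit_cylinder_eq: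
  assumes "J \<subseteq> {..<N} \<times> {..<N} \<times> UNIV"
  shows "{d \<in> space (digit_space p N). \<forall>y\<in>J. d y \<in> A y} =
    prod_emb ({..<N} \<times> {..<N} \<times> UNIV) (\<lambda>_. uniform_digit p) J (Pi\<^sub>E J A)"
  unfolding prod_emb_def using assms by (auto simp: space_PiM Pi_iff)

lemma digit_cylinder_sets:
  assumes "finite J" "J \<subseteq> {..<N} \<times> {..<N} \<times> UNIV" "\<And>y. y \<in> J \<Longrightarrow> A y \<in> sets (uniform_digit p)"
  shows "{d \<in> space (digit_space p N). \<forall>y\<in>J. d y \<in> A y} \<in> sets (digit_space p N)"
  unfolding digit_cylinder_eq[OF assms(2)] using assms by (intro sets_PiM_I) auto

lemma leading_zero_sets: "leading_zero p N \<in> sets (digit_space p N)"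
  unfolding leading_zero_def using prime_gt_0_nat[OF p]
  by (intro digit_cylinder_sets) (auto simp: sets_uniform_count_measure)

text \<open>The leading digits and the shifted cylinder concern disjoint sets of coordinates, so by
  independence the N * N vanishing leading digits contribute the factor p^(-N^2).\<close>

lemma leading_zero_shift_cylinder:
  assumes J: "finite J" "J \<subseteq> {..<N} \<times> {..<N} \<times> UNIV" and A: "\<And>y. y \<in> J \<Longrightarrow> A y \<in> sets (uniform_digit p)"
  shows "emeasure (digit_space p N) (leading_zero p N \<inter> (shift_digits N -` {d \<in> space (digit_space p N). \<forall>y\<in>J. d y \<in> A y} \<inter> space (digit_space p N))) =
     ennreal ((1 / real p) ^ (N * N)) * (\<Prod>y\<in>J. emeasure (uniform_digit p) (A y))"
proof -
  interpret D: product_prob_space "\<lambda>_. uniform_digit p" "{..<N} \<times> {..<N} \<times> (UNIV :: nat set)"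
    by (rule product_prob_spaceI[OF prob_space_digit])
  let ?P = "digit_space p N"
  let ?J0 = "{..<N} \<times> {..<N} \<times> {0 :: nat}"
  let ?s = "\<lambda>(i :: nat, j :: nat, t). (i, j, Suc t)"
  let ?A = "\<lambda>(i, j, t). case t of 0 \<Rightarrow> {0} | Suc t' \<Rightarrow> A (i, j, t')"
  have inj: "inj_on ?s J" by (auto simp: inj_on_def)
  have disj: "?J0 \<inter> ?s ` J = {}" by auto
  have sub: "?J0 \<union> ?s ` J \<subseteq> {..<N} \<times> {..<N} \<times> UNIV" using J by auto
  have sets: "?A y \<in> sets (uniform_digit p)" if "y \<in> ?J0 \<union> ?s ` J" for y
    using that A prime_gt_0_nat[OF p] by (fastforce simp: sets_uniform_count_measure)
  have sp: "shift_digits N d \<in> space ?P" if "d \<in> space ?P" for d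
    using measurable_space[OF shift_digits_measurable that] .
  have "leading_zero p N \<inter> (shift_digits N -` {d \<in> space ?P. \<forall>y\<in>J. d y \<in> A y} \<inter> space ?P) =
     {d \<in> space ?P. \<forall>y\<in>?J0 \<union> ?s ` J. d y \<in> ?A y}"
  proof -
    have "(\<forall>y\<in>J. shift_digits N d y \<in> A y) \<longleftrightarrow> (\<forall>y\<in>?s ` J. d y \<in> ?A y)" for d
      using J(2) by (fastforce simp: shift_digits_def)
    then show ?thesis using sp by (auto simp: leading_zero_def ball_Un)
  qed
  then have "emeasure ?P (leading_zero p N \<inter> (shift_digits N -` {d \<in> space ?P. \<forall>y\<in>J. d y \<in> A y} \<inter> space ?P)) =
     (\<Prod>y\<in>?J0 \<union> ?s ` J. emeasure (uniform_digit p) (?A y))"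
    using J(1) D.emeasure_PiM_Collect[OF sub _ sets] by simp
  also have "\<dots> = (\<Prod>y\<in>?J0. emeasure (uniform_digit p) (?A y)) *
      (\<Prod>y\<in>?s ` J. emeasure (uniform_digit p) (?A y))"
    using J(1) disj by (intro prod.union_disjoint) auto
  also have "(\<Prod>y\<in>?s ` J. emeasure (uniform_digit p) (?A y)) =
      (\<Prod>y\<in>J. emeasure (uniform_digit p) (A y))"
    by (subst prod.reindex[OF inj]) (auto intro!: prod.cong)
  also have "(\<Prod>y\<in>?J0. emeasure (uniform_digit p) (?A y)) = (\<Prod>y\<in>?J0. ennreal (1 / real p))"
    using prime_gt_0_nat[OF p] by (intro prod.cong) (auto simp: emeasure_uniform_count_measure)
  also have "\<dots> = ennreal ((1 / real p) ^ (N * N))"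
    by (simp add: ennreal_power)
  finally show ?thesis .
qed

text \<open>Restricting to \<open>leading_zero\<close>, rescaling by p^(N^2) and shifting reproduces
  the digit measure. The result of these operations is the measure \<open>Q\<close>, and measures on
  the product space that agree on cylinders are equal.\<close>

lemma emeasure_leading_zero_shift:
  assumes X: "X \<in> sets (digit_space p N)"
  shows "emeasure (digit_space p N) X = ennreal (real p ^ (N * N)) *
     emeasure (digit_space p N) (leading_zero p N \<inter> (shift_digits N -` X \<inter> space (digit_space p N)))"
proof -
  let ?P = "digit_space p N"
  let ?c = "ennreal (real p ^ (N * N))"
  let ?M = "uniform_digit p"
  let ?I = "{..<N} \<times> {..<N} \<times> (UNIV :: nat set)"
  interpret D: product_prob_space "\<lambda>_. ?M" ?I
    by (rule product_prob_spaceI[OF prob_space_digit])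
  define Q where "Q = distr (density ?P (\<lambda>d. ?c * indicator (leading_zero p N) d)) ?P (shift_digits N)"
  have f: "(\<lambda>d. ?c * indicator (leading_zero p N) d) \<in> borel_measurable ?P"
    using leading_zero_sets by measurable
  have Q: "emeasure Q Y = ?c * emeasure ?P (leading_zero p N \<inter> (shift_digits N -` Y \<inter> space ?P))"
    if Y: "Y \<in> sets ?P" for Y
  proof -
    have pre: "shift_digits N -` Y \<inter> space ?P \<in> sets ?P"
      using measurable_sets[OF shift_digits_measurable Y] .
    have "emeasure Q Y = emeasure (density ?P (\<lambda>d. ?c * indicator (leading_zero p N) d)) (shift_digits N -` Y \<inter> space ?P)"
      unfolding Q_def using shift_digits_measurable Y by (subst emeasure_distr) auto
    also have "\<dots> = (\<integral>\<^sup>+d. ?c * indicator (leading_zero p N) d * indicator (shift_digits N -` Y \<inter> space ?P) d \<partial>?P)"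
      by (rule emeasure_density[OF f pre])
    also have "\<dots> = (\<integral>\<^sup>+d. ?c * indicator (leading_zero p N \<inter> (shift_digits N -` Y \<inter> space ?P)) d \<partial>?P)"
      by (intro nn_integral_cong) (auto split: split_indicator)
    also have "\<dots> = ?c * emeasure ?P (leading_zero p N \<inter> (shift_digits N -` Y \<inter> space ?P))"
      using pre leading_zero_sets by (intro nn_integral_cmult_indicator) auto
    finally show ?thesis .
  qed
  have "?P = Q"
  proof (rule measure_eqI_PiM_infinite)
    fix A J assume J: "finite J" "J \<subseteq> ?I" and A: "\<And>y. y \<in> J \<Longrightarrow> A y \<in> sets ?M"
    have e: "prod_emb ?I (\<lambda>_. ?M) J (Pi\<^sub>E J A) = {d \<in> space ?P. \<forall>y\<in>J. d y \<in> A y}"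
      by (rule digit_cylinder_eq[OF J(2), symmetric])
    have s: "{d \<in> space ?P. \<forall>y\<in>J. d y \<in> A y} \<in> sets ?P"
      using J A by (rule digit_cylinder_sets)
    have "?c * ennreal ((1 / real p) ^ (N * N)) = 1"
      using prime_gt_0_nat[OF p] by (simp add: power_one_over flip: ennreal_mult ennreal_1)
    moreover have "emeasure ?P {d \<in> space ?P. \<forall>y\<in>J. d y \<in> A y} = (\<Prod>y\<in>J. emeasure ?M (A y))"
      by (intro D.emeasure_PiM_Collect J A)
    moreover have "emeasure Q {d \<in> space ?P. \<forall>y\<in>J. d y \<in> A y} =
        ?c * (ennreal ((1 / real p) ^ (N * N)) * (\<Prod>y\<in>J. emeasure ?M (A y)))"
      unfolding Q[OF s] by (rule arg_cong[OF leading_zero_shift_cylinder]) (use J A in auto)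
    ultimately show "emeasure ?P (prod_emb ?I (\<lambda>_. ?M) J (Pi\<^sub>E J A)) = emeasure Q (prod_emb ?I (\<lambda>_. ?M) J (Pi\<^sub>E J A))"
      unfolding e by (simp add: mult.assoc[symmetric])
  qed (auto simp: Q_def D.finite_measure_axioms)
  then show ?thesis using Q[OF X] by simp
qed

lemma digits_to_mat_shift:
  assumes d: "d \<in> leading_zero p N"
  shows "digits_to_mat p N m (shift_digits N d) = digits_to_mat p N (Suc m) d"
proof (rule ext, clarify)
  fix i j
  show "digits_to_mat p N m (shift_digits N d) (i, j) = digits_to_mat p N (Suc m) d (i, j)"
  proof (cases "i < N \<and> j < N")
    case True
    have d0: "d (i, j, 0) = 0" using d True by (auto simp: leading_zero_def)
    have "(\<Sum>t<nat (n + int m). of_nat (shift_digits N d (i, j, t)) * of_nat p powi (int t - int m)) =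
       (\<Sum>t<nat (n + int (Suc m)). of_nat (d (i, j, t)) * (of_nat p :: rat) powi (int t - int (Suc m)))" for n
    proof (cases "n + int m \<ge> 0")
      case True
      then have e: "nat (n + int (Suc m)) = Suc (nat (n + int m))" by simp
      show ?thesis unfolding e sum.lessThan_Suc_shift
        using d0 \<open>i < N \<and> j < N\<close> by (simp add: shift_digits_def)
    qed simp
    then show ?thesis using True by (simp add: digits_to_mat_def)
  qed (auto simp: digits_to_mat_def)
qed

text \<open>On the smaller lattice the two sides agree; the part of A in the larger lattice outside
  it accounts for the inequality.\<close>

lemma emeasure_latt_Suc:
  assumes A: "A \<in> sets (MatSp p N)"
  shows "emeasure (latt p N m) A \<le> ennreal (real p ^ (N * N)) * emeasure (latt p N (Suc m)) A"
proof -
  let ?P = "digit_space p N"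
  note meas = measurable_digits_to_mat
  have "emeasure (latt p N m) A = emeasure ?P (digits_to_mat p N m -` A \<inter> space ?P)"
    unfolding latt_def using A meas by (intro emeasure_distr) auto
  also have "\<dots> = ennreal (real p ^ (N * N)) *
     emeasure ?P (leading_zero p N \<inter> (shift_digits N -` (digits_to_mat p N m -` A \<inter> space ?P) \<inter> space ?P))"
    by (rule emeasure_leading_zero_shift) (rule measurable_sets[OF meas A])
  also have "\<dots> \<le> ennreal (real p ^ (N * N)) * emeasure ?P (digits_to_mat p N (Suc m) -` A \<inter> space ?P)"
    by (intro mult_left_mono emeasure_mono measurable_sets[OF meas A])
      (auto simp: digits_to_mat_shift)
  also have "emeasure ?P (digits_to_mat p N (Suc m) -` A \<inter> space ?P) = emeasure (latt p N (Suc m)) A"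
    unfolding latt_def using A meas by (intro emeasure_distr[symmetric]) auto
  finally show ?thesis .
qed

lemma incseq_latt:
  assumes A: "A \<in> sets (MatSp p N)"
  shows "incseq (\<lambda>m. ennreal (real p ^ (N * N * m)) * emeasure (latt p N m) A)"
proof (rule incseq_SucI)
  fix m
  have "ennreal (real p ^ (N * N * m)) * emeasure (latt p N m) A \<le>
     ennreal (real p ^ (N * N * m)) * (ennreal (real p ^ (N * N)) * emeasure (latt p N (Suc m)) A)"
    by (intro mult_left_mono emeasure_latt_Suc A) auto
  also have "\<dots> = ennreal (real p ^ (N * N * Suc m)) * emeasure (latt p N (Suc m)) A"
  proof -
    have "real p ^ (N * N * Suc m) = real p ^ (N * N * m) * real p ^ (N * N)"
      by (simp add: power_add)
    then show ?thesis by (simp only: ennreal_mult[OF zero_le_power zero_le_power] of_nat_0_le_iff mult.assoc)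
  qed
  finally show "ennreal (real p ^ (N * N * m)) * emeasure (latt p N m) A \<le>
    ennreal (real p ^ (N * N * Suc m)) * emeasure (latt p N (Suc m)) A" .
qed

section \<open>The increasing limit of the lattice measures\<close>

lemma space_vol [simp]: "space (vol p N) = QpMat p N"
  by (simp add: vol_def space_measure_of_conv)

lemma sets_vol [simp, measurable_cong]: "sets (vol p N) = sets (MatSp p N)"
  unfolding vol_def by (metis sets.sets_measure_of_eq)

text \<open>\<open>measure_of\<close> returns the given set function once it is known to be
  countably additive. Monotonicity in m lets the supremum commute with countable sums.\<close>

lemma emeasure_vol:
  assumes A: "A \<in> sets (MatSp p N)"
  shows "emeasure (vol p N) A = (SUP m. ennreal (real p ^ (N * N * m)) * emeasure (latt p N m) A)"
  unfolding vol_def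
proof (rule emeasure_measure_of_sigma)
  show "sigma_algebra (space (MatSp p N)) (sets (MatSp p N))" by (rule sets.sigma_algebra_axioms)
  show "positive (sets (MatSp p N)) (\<lambda>A. SUP m. ennreal (real p ^ (N * N * m)) * emeasure (latt p N m) A)"
    by (simp add: positive_def)
  show "countably_additive (sets (MatSp p N)) (\<lambda>A. SUP m. ennreal (real p ^ (N * N * m)) * emeasure (latt p N m) A)"
  proof (rule countably_additiveI)
    fix B :: "nat \<Rightarrow> qpmat set"
    assume B: "range B \<subseteq> sets (MatSp p N)" "disjoint_family B"
    have "(\<Sum>i. SUP m. ennreal (real p ^ (N * N * m)) * emeasure (latt p N m) (B i)) =
      (SUP m. \<Sum>i. ennreal (real p ^ (N * N * m)) * emeasure (latt p N m) (B i))"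
      using B by (intro ennreal_suminf_SUP_eq incseq_latt) auto
    also have "\<dots> = (SUP m. ennreal (real p ^ (N * N * m)) * emeasure (latt p N m) (\<Union>i. B i))"
      using B sets_latt by (simp add: suminf_emeasure)
    finally show "(\<Sum>i. SUP m. ennreal (real p ^ (N * N * m)) * emeasure (latt p N m) (B i)) =
      (SUP m. ennreal (real p ^ (N * N * m)) * emeasure (latt p N m) (\<Union>i. B i))" .
  qed
qed (rule A)

end

section \<open>The law of the singular numbers\<close>

lemma countable_zinf_list: "countable (UNIV :: zinf list set)"
proof -
  have "(UNIV :: zinf set) = insert NegInf (range Fin)" by (auto intro: zinf.exhaust)
  then have "countable (UNIV :: zinf set)" by (metis countable_insert countable_image countableI_type)
  then have "countable (lists (UNIV :: zinf set))" by (rule countable_lists)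
  then show ?thesis by simp
qed

text \<open>A positive k_j is the number of levels i \<ge> 0 lying below it, and level i lies below
  exactly \<open>useq k i\<close> of the entries; the exponent is this double count.\<close>

lemma gamma_k_eq:
  assumes b: "bounded_by m k"
  shows "gamma_k p k = real p ^ (\<Sum>i<m. useq k i)"
proof -
  define g where "g x = (case x of NegInf \<Rightarrow> 0 | Fin a \<Rightarrow> nat a)" for x
  have g: "g (k ! j) = (\<Sum>i<m. if zle (k ! j) (Fin (int i)) then 0 else 1)" if j: "j < length k" for j
  proof (cases "k ! j")
    case (Fin a)
    have "a \<le> int m" using b j Fin by (auto simp: bounded_by_def dest: spec[of _ j])
    then have "{..<m} \<inter> {i. \<not> a \<le> int i} = {..<nat a}" by auto
    then show ?thesis by (simp add: Fin g_def sum.If_cases Compl_eq)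
  qed (simp add: g_def)
  have u: "useq k i = (\<Sum>j<length k. if zle (k ! j) (Fin (int i)) then 0 else 1)" for i
  proof -
    have "card ({..<length k} - {j. j < length k \<and> zle (k ! j) (Fin (int i))}) = useq k i"
      unfolding useq_def by (subst card_Diff_subset) auto
    moreover have "{..<length k} - {j. j < length k \<and> zle (k ! j) (Fin (int i))} =
      {..<length k} \<inter> {j. \<not> zle (k ! j) (Fin (int i))}" by auto
    ultimately show ?thesis by (simp add: sum.If_cases Compl_eq)
  qed
  have "gamma_k p k = (\<Prod>j<length k. real p ^ g (k ! j))"
    unfolding gamma_k_def by (intro prod.cong) (auto simp: g_def split: zinf.split)
  also have "\<dots> = real p ^ (\<Sum>j<length k. g (k ! j))" by (simp add: power_sum)
  also have "(\<Sum>j<length k. g (k ! j)) = (\<Sum>i<m. useq k i)"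
    unfolding u by (subst sum.swap) (simp add: g)
  finally show ?thesis .
qed

lemma cnt_le_length: "cnt k z \<le> length k"
proof -
  have "cnt k z \<le> card {..<length k}" unfolding cnt_def by (intro card_mono) auto
  then show ?thesis by simp
qed

lemma cnt_mono: "z \<le> z' \<Longrightarrow> cnt k z \<le> cnt k z'"
  unfolding cnt_def by (intro card_mono) (auto intro: zle_trans[of _ "Fin z"])

lemma vseq_eq_cnt: "vseq k i = cnt k (- int i)"
  by (simp add: vseq_def cnt_def)

lemma useq_eq_cnt: "useq k i = length k - cnt k (int i)"
  by (simp add: useq_def cnt_def)

section \<open>Telescoping of the kernel products\<close>

context
  fixes p :: nat and s :: real
  assumes p: "prime p" and s: "s > -1"
begin

text \<open>\<open>Pker p s x y\<close> is Q x * A x / (Q y * A y) times a step weight; the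
  quotients telescope and the step weights remain.\<close>

lemma telescope_Pker:
  fixes u :: "nat \<Rightarrow> nat"
  assumes u: "\<And>i. u (Suc i) \<le> u i"
  defines "Q \<equiv> qpoch (1 / real p) (1 / real p)" and "A \<equiv> qpoch (real p powr (-1 - s)) (1 / real p)"
  shows "(\<Prod>i<m. Pker p s (u i) (u (Suc i))) = Q (u 0) * A (u 0) / (Q (u m) * A (u m)) *
     (\<Prod>i<m. real p powr (- (real (u (Suc i)))\<^sup>2 - s * real (u (Suc i))) / Q (u i - u (Suc i)))"
proof (induction m)
  case 0
  have "Q n \<noteq> 0" "A n \<noteq> 0" for n
    using qpoch_pos[OF inverse_p[OF p s] inverse_p[OF p s]] qpoch_pos[OF inverse_p[OF p s] p_powr[OF p s]]
    unfolding Q_def A_def by (auto simp: less_le)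
  then show ?case by simp
next
  case (Suc m)
  have nz: "Q n \<noteq> 0" "A n \<noteq> 0" for n
    using qpoch_pos[OF inverse_p[OF p s] inverse_p[OF p s]] qpoch_pos[OF inverse_p[OF p s] p_powr[OF p s]]
    unfolding Q_def A_def by (auto simp: less_le)
  have "Pker p s (u m) (u (Suc m)) = real p powr (- (real (u (Suc m)))\<^sup>2 - s * real (u (Suc m))) * Q (u m) * A (u m)
     / (Q (u (Suc m)) * Q (u m - u (Suc m)) * A (u (Suc m)))"
    using u by (simp add: Pker_def Q_def A_def)
  then show ?case unfolding prod.lessThan_Suc Suc.IH using nz by (simp only:) (simp add: field_simps)
qed

end

text \<open>The steps of P^(0) above level 0, with u read backwards since the corank chain starts at
  the top level. The denominators Q (u i - u (i + 1)) are those of \<open>telescope_Pker\<close>, so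
  they cancel in the comparison.\<close>

lemma telescope_Pker_zero:
  fixes u :: "nat \<Rightarrow> nat"
  assumes p: "prime p" and u: "\<And>i. u (Suc i) \<le> u i" "\<And>i. u i \<le> N"
  defines "Q \<equiv> qpoch (1 / real p) (1 / real p)"
  shows "(\<Prod>i<m. Pker p 0 (N - u (Suc i)) (N - u i)) = (Q (N - u m))\<^sup>2 / (Q (N - u 0))\<^sup>2 *
     (\<Prod>i<m. real p powr (- (real N - real (u i))\<^sup>2) / Q (u i - u (Suc i)))"
proof (induction m)
  case 0
  have "Q n \<noteq> 0" for n
    using qpoch_pos[OF inverse_p[OF p, of 0] inverse_p[OF p, of 0]] unfolding Q_def by (auto simp: less_le)
  then show ?case by simp
next
  case (Suc m)
  have nz: "Q n \<noteq> 0" for n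
    using qpoch_pos[OF inverse_p[OF p, of 0] inverse_p[OF p, of 0]] unfolding Q_def by (auto simp: less_le)
  have a: "real p powr (- 1 - 0) = 1 / real p" using prime_gt_0_nat[OF p] by (simp add: powr_minus_divide)
  have d: "N - u (Suc m) - (N - u m) = u m - u (Suc m)" "N - u m \<le> N - u (Suc m)"
    using u(1)[of m] u(2)[of m] by linarith+
  have "Pker p 0 (N - u (Suc m)) (N - u m) = real p powr (- (real N - real (u m))\<^sup>2) * (Q (N - u (Suc m)))\<^sup>2
     / ((Q (N - u m))\<^sup>2 * Q (u m - u (Suc m)))"
    unfolding Pker_def a d(1) using d(2) u(2)[of m]
    by (simp add: Q_def[symmetric] power2_eq_square of_nat_diff mult_ac)
  then show ?case using Suc nz by (simp add: field_simps)
qed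

context
  fixes p :: nat and s :: real
  assumes p: "prime p" and s: "s > -1"
begin

definition density_const :: "nat \<Rightarrow> real" where
  "density_const N = qpoch (real p powr (-1 - s)) (1 / real p) N ^ 2
                   / qpoch (real p powr (-1 - s)) (1 / real p) (2 * N)"

lemma density_const_nonneg: "0 \<le> density_const N"
  unfolding density_const_def using qpoch_pos[OF inverse_p[OF p s] p_powr[OF p s]]
  by (auto intro!: divide_nonneg_nonneg simp: less_imp_le)

text \<open>After telescoping, both sides have the same denominators. The exponents match factor by
  factor, as N^2 - (N - x)^2 - (s + 2 N) x = - x^2 - s x for x = u i, and the boundary terms of the
  two telescoping products make up pi_N.\<close>

lemma scaled_chain_identity:
  fixes u :: "nat \<Rightarrow> nat"
  assumes u: "\<And>i. u (Suc i) \<le> u i" "\<And>i. u i \<le> N" and um: "u m = 0"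
  shows "density_const N * (real p ^ (\<Sum>i<m. u i)) powr (- s - 2 * real N) * real p ^ (N * N * m) *
       (\<Prod>i<m. Pker p 0 (N - u (Suc i)) (N - u i)) =
     piN p s N (N - u 0) * (\<Prod>i<m. Pker p s (u i) (u (Suc i)))"
proof -
  define Q where "Q = qpoch (1 / real p) (1 / real p)"
  define A where "A = qpoch (real p powr (-1 - s)) (1 / real p)"
  define h where "h x = real p powr (- (real x)\<^sup>2 - s * real x)" for x :: nat
  define D where "D = (\<Prod>i<m. Q (u i - u (Suc i)))"
  have nz: "Q n \<noteq> 0" "A n \<noteq> 0" for n
    using qpoch_pos[OF inverse_p[OF p s] inverse_p[OF p s]] qpoch_pos[OF inverse_p[OF p s] p_powr[OF p s]]
    unfolding Q_def A_def by (auto simp: less_le)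
  have Q0: "Q 0 = 1" "A 0 = 1" by (simp_all add: Q_def A_def)
  have p0: "real p > 0" using prime_gt_0_nat[OF p] by simp
  have "(real p ^ (\<Sum>i<m. u i)) powr (- s - 2 * real N) = (\<Prod>i<m. real p powr ((- s - 2 * real N) * real (u i)))"
    using p0 by (simp add: power_sum powr_realpow[symmetric] powr_powr prod_powr_distrib mult.commute)
  moreover have "real p ^ (N * N * m) = (\<Prod>i<m. real p powr (real N)\<^sup>2)"
  proof -
    have "real p powr (real N)\<^sup>2 = real p ^ (N * N)"
      using p0 by (simp add: power2_eq_square powr_realpow flip: of_nat_mult)
    then show ?thesis by (simp add: power_mult)
  qed
  ultimately have "(real p ^ (\<Sum>i<m. u i)) powr (- s - 2 * real N) * real p ^ (N * N * m) *
      (\<Prod>i<m. real p powr (- (real N - real (u i))\<^sup>2)) =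
      (\<Prod>i<m. real p powr ((- s - 2 * real N) * real (u i)) * real p powr (real N)\<^sup>2 * real p powr (- (real N - real (u i))\<^sup>2))"
    by (simp only: prod.distrib)
  also have "\<dots> = (\<Prod>i<m. h (u i))"
    by (intro prod.cong refl)
      (simp only: h_def powr_add[symmetric], rule arg_cong[of _ _ "(powr) (real p)"], simp add: power2_eq_square algebra_simps)
  \<comment> \<open>A kernel step carries the weight of its target, so the index moves up by one: at
    the top, u m = 0 has weight 1, and at the bottom h (u 0) is left over for pi_N.\<close>
  also have "\<dots> = h (u 0) * (\<Prod>i<m. h (u (Suc i)))"
  proof -
    have "(\<Prod>i<Suc m. h (u i)) = (\<Prod>i<m. h (u i))" using um p0 by (simp add: h_def)
    then show ?thesis by (simp only: prod.lessThan_Suc_shift)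
  qed
  finally have key: "(real p ^ (\<Sum>i<m. u i)) powr (- s - 2 * real N) * real p ^ (N * N * m) *
      (\<Prod>i<m. real p powr (- (real N - real (u i))\<^sup>2)) = h (u 0) * (\<Prod>i<m. h (u (Suc i)))" .
  have 1: "(\<Prod>i<m. Pker p 0 (N - u (Suc i)) (N - u i)) =
     (Q N)\<^sup>2 / (Q (N - u 0))\<^sup>2 * ((\<Prod>i<m. real p powr (- (real N - real (u i))\<^sup>2)) / D)"
    unfolding telescope_Pker_zero[where u = u and N = N, OF p u] by (simp add: Q_def D_def um prod_dividef)
  have 2: "(\<Prod>i<m. Pker p s (u i) (u (Suc i))) = Q (u 0) * A (u 0) * ((\<Prod>i<m. h (u (Suc i))) / D)"
    unfolding telescope_Pker[where u = u, OF p s u(1)] using Q0 by (simp add: Q_def A_def D_def h_def um prod_dividef)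
  have e: "N - (N - u 0) = u 0" using u(2)[of 0] by simp
  have 3: "piN p s N (N - u 0) = density_const N * (Q N)\<^sup>2 / ((Q (N - u 0))\<^sup>2 * Q (u 0) * A (u 0)) * h (u 0)"
    by (simp add: piN_def e density_const_def Q_def A_def h_def)
  have "density_const N * (real p ^ (\<Sum>i<m. u i)) powr (- s - 2 * real N) * real p ^ (N * N * m) *
       (\<Prod>i<m. Pker p 0 (N - u (Suc i)) (N - u i)) =
     density_const N * (Q N)\<^sup>2 / (Q (N - u 0))\<^sup>2 * ((real p ^ (\<Sum>i<m. u i)) powr (- s - 2 * real N) * real p ^ (N * N * m) *
      (\<Prod>i<m. real p powr (- (real N - real (u i))\<^sup>2))) / D"
    unfolding 1 by simp
  also have "\<dots> = piN p s N (N - u 0) * (\<Prod>i<m. Pker p s (u i) (u (Suc i)))"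
    unfolding key 2 3 using nz by (simp add: field_simps)
  finally show ?thesis .
qed

text \<open>The corank chain descends through the levels m, m - 1, ...; its first m steps, down to
  level 0, turn backwards into the chain of \<open>useq\<close>, and its next n steps are the chain
  of \<open>vseq\<close>. For n \<ge> m the chain of \<open>useq\<close> has reached 0.\<close>

lemma chain_product_eq:
  assumes k: "k \<in> Delta N" and b: "bounded_by m k" and n: "m \<le> n"
  shows "chain_weight p s N k n =
     density_const N * gamma_k p k powr (- s - 2 * real N) * real p ^ (N * N * m) *
       type_prob (1 / real p) (m + n) N (coranks m k)"
proof -
  have len: "length k = N" using k by (simp add: Delta_def)
  let ?r = "\<lambda>i. cnt k (int m - int i - 1)"
  let ?f = "\<lambda>i. Pker p 0 (cnt k (int m - int i)) (cnt k (int m - int i - 1))"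
  \<comment> \<open>At the top level m all N entries are counted, so the initial state N of the
    chain fits the general formula.\<close>
  have c: "(case i of 0 \<Rightarrow> N | Suc j \<Rightarrow> ?r j) = cnt k (int m - int i)" for i
    using cnt_eq_length[OF b, of "int m"] len by (auto split: nat.split simp: diff_diff_eq add.commute)
  have "type_prob (1 / real p) (m + n) N ?r = (\<Prod>i<m + n. ?f i)"
    unfolding type_prob_eq c corank_prob_Pker[OF p] ..
  also have "\<dots> = (\<Prod>i<m. ?f i) * (\<Prod>i<n. ?f (m + i))"
    by (induction n) (simp_all add: mult.assoc)
  also have "(\<Prod>i<n. ?f (m + i)) = (\<Prod>i<n. Pker p 0 (vseq k i) (vseq k (i + 1)))"
  proof (intro prod.cong refl)
    fix i
    have e: "int m - int (m + i) = - int i" "- int i - 1 = - int (i + 1)" by auto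
    show "?f (m + i) = Pker p 0 (vseq k i) (vseq k (i + 1))" by (simp only: vseq_eq_cnt e)
  qed
  also have "(\<Prod>i<m. ?f i) = (\<Prod>i<m. ?f (m - Suc i))"
    by (rule prod.nat_diff_reindex[symmetric])
  also have "\<dots> = (\<Prod>i<m. Pker p 0 (N - useq k (Suc i)) (N - useq k i))"
  proof (intro prod.cong refl)
    fix i assume "i \<in> {..<m}"
    then have e: "int m - int (m - Suc i) = int (Suc i)" "int (Suc i) - 1 = int i" by auto
    have "N - useq k j = cnt k (int j)" for j
      using cnt_le_length[of k "int j"] by (simp add: useq_eq_cnt len)
    then show "?f (m - Suc i) = Pker p 0 (N - useq k (Suc i)) (N - useq k i)" by (simp only: e)
  qed
  finally have tp: "type_prob (1 / real p) (m + n) N ?r =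
     (\<Prod>i<m. Pker p 0 (N - useq k (Suc i)) (N - useq k i)) * (\<Prod>i<n. Pker p 0 (vseq k i) (vseq k (i + 1)))" .
  have u: "useq k (Suc i) \<le> useq k i" "useq k i \<le> N" for i
    unfolding useq_eq_cnt len by (auto intro!: diff_le_mono2 cnt_mono)
  have u0: "useq k i = 0" if "m \<le> i" for i
    using cnt_eq_length[OF b, of "int i"] that by (simp add: useq_eq_cnt)
  \<comment> \<open>The steps from index m on go from 0 to 0 and have probability 1.\<close>
  have "(\<Prod>i<n. Pker p s (useq k i) (useq k (Suc i))) = (\<Prod>i<m. Pker p s (useq k i) (useq k (Suc i)))"
  proof (rule prod.mono_neutral_right)
    show "\<forall>i\<in>{..<n} - {..<m}. Pker p s (useq k i) (useq k (Suc i)) = 1"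
      using prime_gt_0_nat[OF p] by (auto simp: u0 Pker_def)
  qed (use n in auto)
  moreover have "vseq k 0 = N - useq k 0"
    using cnt_le_length[of k 0] by (simp add: vseq_eq_cnt useq_eq_cnt len)
  moreover have "density_const N * gamma_k p k powr (- s - 2 * real N) * real p ^ (N * N * m) *
      (\<Prod>i<m. Pker p 0 (N - useq k (Suc i)) (N - useq k i)) =
     piN p s N (N - useq k 0) * (\<Prod>i<m. Pker p s (useq k i) (useq k (Suc i)))"
    unfolding gamma_k_eq[OF b] by (rule scaled_chain_identity[where u = "useq k", OF u]) (simp add: u0)
  ultimately show ?thesis unfolding tp by (simp add: mult.assoc[symmetric])
qed

section \<open>Passage to the limit\<close>

lemma Sing_vimage:
  assumes k: "k \<in> Delta N" and b: "bounded_by m k"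
  shows "Sing p N -` {k} \<inter> QpMat p N =
    (\<Inter>n. lattice_event p N m n (coranks m k))"
proof (intro equalityI subsetI)
  fix Z assume "Z \<in> Sing p N -` {k} \<inter> QpMat p N"
  then show "Z \<in> (\<Inter>n. lattice_event p N m n (coranks m k))"
    using Sing_eq_iff[OF p _ k b, of Z] by auto
next
  fix Z assume Z: "Z \<in> (\<Inter>n. lattice_event p N m n (coranks m k))"
  then have "Z \<in> QpMat p N" using latm_QpMat by auto
  then show "Z \<in> Sing p N -` {k} \<inter> QpMat p N" using Sing_eq_iff[OF p _ k b, of Z] Z by auto
qed

lemma Sing_vimage_sets: "Sing p N -` {k} \<inter> QpMat p N \<in> sets (MatSp p N)"
proof (cases "k \<in> Delta N")
  case True
  obtain m where b: "bounded_by m k" using ex_bounded_by by blast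
  show ?thesis unfolding Sing_vimage[OF True b]
    by (intro sets.countable_INT) (auto intro: latm_ker_type_sets[OF p])
next
  case False
  then have "Sing p N -` {k} \<inter> QpMat p N = {}"
    using Sing_eq_iff_factors[OF p] by (auto simp: factors_def)
  then show ?thesis by simp
qed

lemma measurable_Sing: "Sing p N \<in> measurable (vol p N) (count_space UNIV)"
  using Sing_vimage_sets sets_vol[OF p] space_vol[OF p]
  by (auto simp: measurable_count_space_eq_countable[OF countable_zinf_list])

text \<open>The condition modulo p^(n+1) implies the one modulo p^n, so continuity from above
  applies to the events whose intersection is the fiber of \<open>Sing\<close>.\<close>

lemma latt_Sing_LIMSEQ:
  assumes k: "k \<in> Delta N" and b: "bounded_by m k"
  shows "(\<lambda>n. type_prob (1 / real p) n N (coranks m k))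
     \<longlonglongrightarrow> measure (latt p N m) (Sing p N -` {k} \<inter> QpMat p N)"
proof -
  interpret prob_space "latt p N m" by (rule prob_space_latt[OF p])
  let ?r = "\<lambda>i. cnt k (int m - int i - 1)"
  let ?E = "\<lambda>n. lattice_event p N m n ?r"
  have dec: "decseq ?E"
  proof (rule decseq_SucI, rule subsetI)
    fix n Z assume Z: "Z \<in> ?E (Suc n)"
    then have L: "Z \<in> latm p N m" by simp
    have eq: "left_ker p j {..<N} (column_set N (amat p m Z (Suc n))) = left_ker p j {..<N} (column_set N (amat p m Z n))"
      if "j \<le> n" for j
      using left_ker_amat[OF p L, of j n] left_ker_amat[OF p L, of j "Suc n"] that by simp
    have "ker_type p (Suc n) {..<N} (column_set N (amat p m Z (Suc n))) ?r" using Z by simp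
    then have "ker_type p n {..<N} (column_set N (amat p m Z (Suc n))) ?r" by (simp add: ker_type_def)
    then have "ker_type p n {..<N} (column_set N (amat p m Z n)) ?r" by (subst (asm) ker_type_cong[OF eq])
    then show "Z \<in> ?E n" using L by simp
  qed
  have "(\<lambda>n. measure (latt p N m) (?E n)) \<longlonglongrightarrow> measure (latt p N m) (\<Inter>n. ?E n)"
    using dec latm_ker_type_sets[OF p] sets_latt[OF p] by (intro finite_Lim_measure_decseq) auto
  then show ?thesis unfolding Sing_vimage[OF k b] measure_latt_ker_type[OF p] .
qed

lemma chain_LIMSEQ:
  assumes k: "k \<in> Delta N" and b: "bounded_by m k"
  shows "chain_weight p s N k
     \<longlonglongrightarrow> density_const N * gamma_k p k powr (- s - 2 * real N) *
          (real p ^ (N * N * m) * measure (latt p N m) (Sing p N -` {k} \<inter> QpMat p N))"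
proof (rule Lim_transform_eventually)
  let ?t = "\<lambda>n. type_prob (1 / real p) n N (coranks m k)"
  let ?K = "density_const N * gamma_k p k powr (- s - 2 * real N) * real p ^ (N * N * m)"
  have "(\<lambda>n. ?t (m + n)) \<longlonglongrightarrow> measure (latt p N m) (Sing p N -` {k} \<inter> QpMat p N)"
    using LIMSEQ_ignore_initial_segment[OF latt_Sing_LIMSEQ[OF k b], of m] by (simp add: add.commute)
  then show "(\<lambda>n. ?K * ?t (m + n)) \<longlonglongrightarrow> density_const N * gamma_k p k powr (- s - 2 * real N) *
          (real p ^ (N * N * m) * measure (latt p N m) (Sing p N -` {k} \<inter> QpMat p N))"
    unfolding mult.assoc[symmetric] by (intro tendsto_mult_left)
  show "\<forall>\<^sub>F n in sequentially. ?K * ?t (m + n) = chain_weight p s N k n"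
    using eventually_ge_at_top[of m] by eventually_elim (simp only: chain_product_eq[OF k b])
qed

lemma emeasure_mN:
  "emeasure (mN p s N) {k} = ennreal (density_const N * gamma_k p k powr (- s - 2 * real N)) *
     emeasure (vol p N) (Sing p N -` {k} \<inter> QpMat p N)"
proof -
  let ?f = "\<lambda>k. ennreal (density_const N * gamma_k p k powr (- s - 2 * real N))"
  let ?S = "Sing p N -` {k} \<inter> QpMat p N"
  have MN: "MN p s N = density (vol p N) (\<lambda>Z. ?f (Sing p N Z))"
    by (simp add: MN_def density_const_def)
  have f: "(\<lambda>Z. ?f (Sing p N Z)) \<in> borel_measurable (vol p N)"
    by (rule measurable_compose[OF measurable_Sing]) simp
  have S: "?S \<in> sets (vol p N)" using Sing_vimage_sets sets_vol[OF p] by simp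
  have "emeasure (mN p s N) {k} = emeasure (MN p s N) ?S"
    unfolding mN_def MN using measurable_Sing by (subst emeasure_distr) (auto simp: space_vol[OF p])
  also have "\<dots> = (\<integral>\<^sup>+Z. ?f (Sing p N Z) * indicator ?S Z \<partial>vol p N)"
    unfolding MN by (rule emeasure_density[OF f S])
  also have "\<dots> = (\<integral>\<^sup>+Z. ?f k * indicator ?S Z \<partial>vol p N)"
    by (intro nn_integral_cong) (auto split: split_indicator)
  also have "\<dots> = ?f k * emeasure (vol p N) ?S"
    by (rule nn_integral_cmult_indicator[OF S])
  finally show ?thesis .
qed

lemma SUP_eventually_const:
  fixes f :: "nat \<Rightarrow> ennreal"
  assumes "incseq f" "\<And>m. m0 \<le> m \<Longrightarrow> f m = c"
  shows "(SUP m. f m) = c"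
proof (rule LIMSEQ_unique[OF LIMSEQ_SUP[OF assms(1)]])
  show "f \<longlonglongrightarrow> c"
    by (rule tendsto_eventually) (use assms(2) in \<open>auto simp: eventually_sequentially\<close>)
qed

text \<open>The chain weights do not mention m, so their limit identifies the rescaled lattice
  measures of the fiber, weighted by the density, for all m bounding k. The supremum in
  \<open>vol\<close> is therefore reached at any such m.\<close>

lemma chain_LIMSEQ_mN:
  assumes k: "k \<in> Delta N"
  shows "chain_weight p s N k \<longlonglongrightarrow> measure (mN p s N) {k}"
proof -
  obtain m0 where m0: "bounded_by m0 k" using ex_bounded_by by blast
  let ?S = "Sing p N -` {k} \<inter> QpMat p N"
  let ?C = "density_const N * gamma_k p k powr (- s - 2 * real N)"
  define g where "g m = real p ^ (N * N * m) * measure (latt p N m) ?S" for m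
  have C: "?C \<ge> 0" using density_const_nonneg by simp
  \<comment> \<open>Uniqueness of limits, applied to the same sequence of chain weights for m and
    for m0.\<close>
  have g: "?C * g m = ?C * g m0" if "m0 \<le> m" for m
    using LIMSEQ_unique[OF chain_LIMSEQ[OF k bounded_by_mono[OF m0 that]] chain_LIMSEQ[OF k m0]]
    unfolding g_def .
  have e: "ennreal (real p ^ (N * N * m)) * emeasure (latt p N m) ?S = ennreal (g m)" for m
  proof -
    interpret prob_space "latt p N m" by (rule prob_space_latt[OF p])
    show ?thesis unfolding emeasure_eq_measure g_def by (rule ennreal_mult[symmetric]) auto
  qed
  have inc: "incseq (\<lambda>m. ennreal (g m))"
    using incseq_latt[OF p Sing_vimage_sets, of N k] by (simp only: e)
  have "emeasure (mN p s N) {k} = ennreal ?C * (SUP m. ennreal (g m))"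
    unfolding emeasure_mN emeasure_vol[OF p Sing_vimage_sets] e ..
  also have "\<dots> = (SUP m. ennreal ?C * ennreal (g m))"
    by (rule SUP_mult_left_ennreal)
  also have "\<dots> = ennreal (?C * g m0)"
  proof (rule SUP_eventually_const)
    show "incseq (\<lambda>m. ennreal ?C * ennreal (g m))"
      using inc by (auto simp: incseq_def intro: mult_left_mono)
    show "ennreal ?C * ennreal (g m) = ennreal (?C * g m0)" if "m0 \<le> m" for m
      using g[OF that] C by (simp add: ennreal_mult[symmetric] g_def)
  qed
  finally have "measure (mN p s N) {k} = ?C * g m0"
    using C by (simp add: measure_def g_def)
  then show ?thesis using chain_LIMSEQ[OF k m0] unfolding g_def by simp
qed

end

theorem theorem3p5:
  fixes p N :: nat and s :: real
  assumes "prime p" and "s > -1"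
  shows "(\<forall>x\<le>N. piN p s N x \<ge> 0) \<and> (\<Sum>x\<le>N. piN p s N x) = 1 \<and>
         (\<forall>k \<in> Delta N.
            (\<lambda>n. piN p s N (vseq k 0)
                 * (\<Prod>i<n. Pker p s (useq k i) (useq k (i + 1)))
                 * (\<Prod>i<n. Pker p 0 (vseq k i) (vseq k (i + 1))))
            \<longlonglongrightarrow> measure (mN p s N) {k})"
  using piN_nonneg[OF assms] sum_piN[OF assms] chain_LIMSEQ_mN[OF assms] by blast

end
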